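(* Let $(\theta,\beta,\gamma):(H,A,C)\to(H',A',C')$ be a morphism of Doi-Hopf data. Then there is a functor $G:{}_{A'}\mathcal{M}(H')^{C'}\to{}_A\mathcal{M}(H)^C$ given by $$G(N')=N'\square_{C'}C,$$ where the Doi-Hopf module structure on $N'\square_{C'}C$ is $$a\cdot(n'\otimes c)=\beta(a_{(0)})\cdot n'\otimes a_{(1)}\cdot c,\qquad \rho(n'\otimes c)=\alpha_{N'}(n')\otimes c_1\otimes\alpha_C^{-1}(c_2),$$ for all $a\in A$ and $n'\otimes c\in N'\square_{C'}C$ (summation understood). Moreover $(F,G)$ is a pair of adjoint functors ($F$ left adjoint to $G$), where $F:{}_A\mathcal{M}(H)^C\to{}_{A'}\mathcal{M}(H')^{C'}$ is the functor $F(M)=A'\otimes_AM$.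
   Context: Work over a field $k$, $\otimes=\otimes_k$. All structure maps $\alpha$ below are assumed bijective. Hom-algebra $(A,\alpha_A)$: a linear multiplication, a unit $1_A$ and a linear $\alpha_A:A\to A$ with $\alpha_A(ab)=\alpha_A(a)\alpha_A(b)$, $\alpha_A(1_A)=1_A$, $1_Aa=\alpha_A(a)=a1_A$, $\alpha_A(a)(bc)=(ab)\alpha_A(c)$. Hom-coalgebra $(C,\alpha_C)$: linear $\Delta:C\to C\otimes C$, $\Delta(c)=c_1\otimes c_2$, $\varepsilon:C\to k$ and $\alpha_C$ with $\varepsilon\circ\alpha_C=\varepsilon$, $(\alpha_C\otimes\alpha_C)\Delta=\Delta\alpha_C$, $(\varepsilon\otimes id)\Delta=\alpha_C=(id\otimes\varepsilon)\Delta$, $(\Delta\otimes\alpha_C)\Delta=(\alpha_C\otimes\Delta)\Delta$. Morphisms preserve all structure and commute with the $\alpha$'s. Hom-bialgebra: a Hom-algebra and Hom-coalgebra with the same $\alpha$ such that $\Delta,\varepsilon$ are Hom-algebra morphisms. Hom-Hopf algebra: a Hom-bialgebra with a linear $S$, $S\alpha=\alpha S$, $S(h_1)h_2=h_1S(h_2)=\varepsilon(h)1$. Left $A$-module $(M,\alpha_M)$: linear $A\otimes M\to M$ with $1_A\cdot m=\alpha_M(m)$, $\alpha_M(a\cdot m)=\alpha_A(a)\cdot\alpha_M(m)$, $\alpha_A(a)\cdot(b\cdot m)=(ab)\cdot\alpha_M(m)$; right modules similarly. Right $C$-comodule $(M,\alpha_M)$: linear $\rho:M\to M\otimes C$, $\rho(m)=m_{(0)}\otimes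 m_{(1)}$, with $(id\otimes\varepsilon)\rho=\alpha_M$, $(\alpha_M\otimes\alpha_C)\rho=\rho\alpha_M$, $(\rho\otimes\alpha_C)\rho=(\alpha_M\otimes\Delta)\rho$; left comodules similarly. (Co)module maps are (co)linear and commute with the $\alpha$'s. A (Hom-type) Doi-Hopf datum $(H,A,C)$ consists of a Hom-Hopf algebra $(H,\alpha_H)$, a right $H$-comodule algebra $(A,\alpha_A)$ (a Hom-algebra and right $H$-comodule, $\rho(a)=a_{(0)}\otimes a_{(1)}$, with $\rho(ab)=\rho(a)\rho(b)$, $\rho(1_A)=1_A\otimes1_H$) and a left $H$-module coalgebra $(C,\alpha_C)$ (a Hom-coalgebra and left $H$-module with $\Delta_C(h\cdot c)=h_1\cdot c_1\otimes h_2\cdot c_2$, $\varepsilon_C(h\cdot c)=\varepsilon_H(h)\varepsilon_C(c)$). A Doi-Hopf module over $(H,A,C)$ is $(M,\alpha_M)$ that is a left $A$-module and a right $C$-comodule with $\rho(a\cdot m)=a_{(0)}\cdot m_{(0)}\otimes a_{(1)}\cdot m_{(1)}$. ${}_A\mathcal{M}(H)^C$ is the category of these, with $A$-linear $C$-colinear maps. A morphism $(\theta,\beta,\gamma):(H,A,C)\to(H',A',C')$ of Doi-Hopf data consists of a Hom-Hopf algebra map $\theta:H\to H'$, a Hom-algebra map $\beta:A\to A'$ and a Hom-coalgebra map $\gamma:C\to C'$ with $\gamma(h\cdot c)=\theta(h)\cdot\gamma(c)$ and $\rho(\beta(a))=\beta(a_{(0)})\otimes\theta(a_{(1)})$. Cotensor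 product: $C$ is a left $C'$-comodule via $c\mapsto\gamma(c_1)\otimes c_2$, and $$N'\square_{C'}C=\Big\{\sum n'\otimes c\in N'\otimes C\ \Big|\ \sum\alpha_{N'}(n')\otimes\gamma(c_1)\otimes c_2=\sum n'_{(0)}\otimes n'_{(1)}\otimes\alpha_C(c)\Big\},$$ with structure map $\alpha_{N'}\otimes\alpha_C$; $G(f)=f\otimes id$. Functor $F$: $A'\otimes_AM$ is the quotient of $A'\otimes M$ by the span of all $b'\beta(a)\otimes\alpha_M(m)-\alpha_{A'}(b')\otimes a\cdot m$, with structure map $\alpha_{A'}\otimes\alpha_M$, action $a'\cdot(b'\otimes m)=\alpha_{A'}(a')b'\otimes\alpha_M(m)$ and coaction $\rho(b'\otimes m)=b'_{(0)}\otimes m_{(0)}\otimes\alpha_{C'}^{-2}(b'_{(1)}\cdot\gamma(m_{(1)}))$; $F(f)=id\otimes f$. *)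

theory Defs
  imports "HOL-Algebra.Module" "HOL-Algebra.AbelCoset" "HOL-Library.FuncSet" "HOL-Library.Infinite_Typeclass"
begin

text \<open>
  All vector spaces have their carrier inside one infinite type \<open>'u\<close>, which plays the role of
  a universe: it is closed under tensor products and quotients, because \<open>('u \<times> 'u) list\<close> embeds
  into \<open>'u\<close>. Hence the categories below are categories in the ordinary sense, and functors
  between them can be composed. Since \<open>'u\<close> is arbitrary, there is no bound on the size of the
  spaces.
\<close>

section \<open>Vector spaces with a structure map\<close>

text \<open>The fields \<open>mult\<close> and \<open>one\<close>, which a \<open>module\<close> record inherits from rings, carry the
  multiplication and the unit of a Hom-algebra; they are irrelevant for all other spaces.\<close>

record ('k, 'u) hom_space = "('k, 'u) module" +
  twist :: "'u \<Rightarrow> 'u"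

definition lin_map ::
  "('k, 'r) ring_scheme \<Rightarrow> ('k, 'u, 'x) module_scheme \<Rightarrow> ('k, 'v, 'y) module_scheme \<Rightarrow> ('u \<Rightarrow> 'v) \<Rightarrow> bool"
  where "lin_map K V W f \<longleftrightarrow> f \<in> carrier V \<rightarrow> carrier W \<and>
    (\<forall>x\<in>carrier V. \<forall>y\<in>carrier V. f (x \<oplus>\<^bsub>V\<^esub> y) = f x \<oplus>\<^bsub>W\<^esub> f y) \<and>
    (\<forall>a\<in>carrier K. \<forall>x\<in>carrier V. f (a \<odot>\<^bsub>V\<^esub> x) = a \<odot>\<^bsub>W\<^esub> f x)"

definition lin_form ::
  "('k, 'r) ring_scheme \<Rightarrow> ('k, 'u, 'x) module_scheme \<Rightarrow> ('u \<Rightarrow> 'k) \<Rightarrow> bool"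
  where "lin_form K V f \<longleftrightarrow> f \<in> carrier V \<rightarrow> carrier K \<and>
    (\<forall>x\<in>carrier V. \<forall>y\<in>carrier V. f (x \<oplus>\<^bsub>V\<^esub> y) = f x \<oplus>\<^bsub>K\<^esub> f y) \<and>
    (\<forall>a\<in>carrier K. \<forall>x\<in>carrier V. f (a \<odot>\<^bsub>V\<^esub> x) = a \<otimes>\<^bsub>K\<^esub> f x)"

definition bilin_map ::
  "('k, 'r) ring_scheme \<Rightarrow> ('k, 'u, 'x) module_scheme \<Rightarrow> ('k, 'v, 'y) module_scheme \<Rightarrow>
    ('k, 'w, 'z) module_scheme \<Rightarrow> ('u \<Rightarrow> 'v \<Rightarrow> 'w) \<Rightarrow> bool"
  where "bilin_map K U V W b \<longleftrightarrow>
    (\<forall>x\<in>carrier U. lin_map K V W (b x)) \<and> (\<forall>y\<in>carrier V. lin_map K U W (\<lambda>x. b x y))"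

definition hom_space :: "('k, 'r) ring_scheme \<Rightarrow> ('k, 'u, 'x) hom_space_scheme \<Rightarrow> bool"
  where "hom_space K V \<longleftrightarrow> field K \<and> Module.module K V \<and> lin_map K V V (twist V) \<and>
    bij_betw (twist V) (carrier V) (carrier V)"

definition untwist :: "('k, 'u, 'x) hom_space_scheme \<Rightarrow> 'u \<Rightarrow> 'u"
  where "untwist V = inv_into (carrier V) (twist V)"


section \<open>Tensor products\<close>

text \<open>A list \<open>[(m\<^sub>1, n\<^sub>1), \<dots>]\<close> stands for the formal sum \<open>m\<^sub>1 \<otimes> n\<^sub>1 + \<dots>\<close>; the tensor product
  consists of the formal sums modulo the congruence generated by commutativity and
  bilinearity. Scalars need not be recorded separately, as they are absorbed by the factors.\<close>

inductive tensor_eq ::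
  "('k, 'r) ring_scheme \<Rightarrow> ('k, 'u, 'x) module_scheme \<Rightarrow> ('k, 'u, 'y) module_scheme \<Rightarrow>
    ('u \<times> 'u) list \<Rightarrow> ('u \<times> 'u) list \<Rightarrow> bool"
  for K :: "('k, 'r) ring_scheme" and M :: "('k, 'u, 'x) module_scheme"
    and N :: "('k, 'u, 'y) module_scheme"
where
  refl: "set xs \<subseteq> carrier M \<times> carrier N \<Longrightarrow> tensor_eq K M N xs xs"
| sym: "tensor_eq K M N xs ys \<Longrightarrow> tensor_eq K M N ys xs"
| trans: "tensor_eq K M N xs ys \<Longrightarrow> tensor_eq K M N ys zs \<Longrightarrow> tensor_eq K M N xs zs"
| append: "tensor_eq K M N xs xs' \<Longrightarrow> tensor_eq K M N ys ys' \<Longrightarrow>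
    tensor_eq K M N (xs @ ys) (xs' @ ys')"
| commute: "set xs \<subseteq> carrier M \<times> carrier N \<Longrightarrow> set ys \<subseteq> carrier M \<times> carrier N \<Longrightarrow>
    tensor_eq K M N (xs @ ys) (ys @ xs)"
| zero: "n \<in> carrier N \<Longrightarrow> tensor_eq K M N [(\<zero>\<^bsub>M\<^esub>, n)] []"
| add_left: "m \<in> carrier M \<Longrightarrow> m' \<in> carrier M \<Longrightarrow> n \<in> carrier N \<Longrightarrow>
    tensor_eq K M N [(m \<oplus>\<^bsub>M\<^esub> m', n)] [(m, n), (m', n)]"
| add_right: "m \<in> carrier M \<Longrightarrow> n \<in> carrier N \<Longrightarrow> n' \<in> carrier N \<Longrightarrow>
    tensor_eq K M N [(m, n \<oplus>\<^bsub>N\<^esub> n')] [(m, n), (m, n')]"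
| scalar: "a \<in> carrier K \<Longrightarrow> m \<in> carrier M \<Longrightarrow> n \<in> carrier N \<Longrightarrow>
    tensor_eq K M N [(a \<odot>\<^bsub>M\<^esub> m, n)] [(m, a \<odot>\<^bsub>N\<^esub> n)]"

definition code :: "('u \<times> 'u) list \<Rightarrow> 'u::infinite"
  where "code = (SOME e. inj e)"

lemma ex_inj_list: "\<exists>e :: ('u \<times> 'u) list \<Rightarrow> 'u::infinite. inj e"
proof -
  have inf: "infinite (UNIV :: 'u set)" by (rule infinite_UNIV)
  have "ordLeq3 (card_of (UNIV :: ('u \<times> 'u) set)) (card_of (UNIV :: 'u set))"
    using card_of_Times_same_infinite[OF inf] ordIso_imp_ordLeq by auto
  then obtain p :: "'u \<times> 'u \<Rightarrow> 'u" where p: "inj p"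
    by (auto simp: card_of_ordLeq[symmetric])
  obtain v :: "nat \<Rightarrow> 'u" where v: "inj v"
    using inf by (auto simp: infinite_iff_countable_subset)
  define w where "w xs = foldr (\<lambda>x s. p (p x, s)) xs (v 0)" for xs :: "('u \<times> 'u) list"
  have w: "xs = ys" if "length xs = length ys" "w xs = w ys" for xs ys
    using that by (induction xs ys rule: list_induct2) (auto simp: w_def dest!: injD[OF p])
  have "inj (\<lambda>xs. p (v (length xs), w xs))"
    by (auto intro!: injI w dest!: injD[OF p] dest: injD[OF v])
  then show ?thesis by blast
qed

lemma inj_code: "inj code"
  unfolding code_def by (rule someI_ex[OF ex_inj_list])

text \<open>The element of the tensor product given by a formal sum: a representative of its class,
  chosen once for all, coded as an element of \<open>'u\<close>.\<close>

definition tensor_class ::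
  "('k, 'r) ring_scheme \<Rightarrow> ('k, 'u::infinite, 'x) module_scheme \<Rightarrow> ('k, 'u, 'y) module_scheme \<Rightarrow>
    ('u \<times> 'u) list \<Rightarrow> 'u"
  where "tensor_class K M N xs = code (SOME ys. tensor_eq K M N xs ys)"

abbreviation pure_tensor ::
  "('k, 'r) ring_scheme \<Rightarrow> ('k, 'u::infinite, 'x) module_scheme \<Rightarrow> ('k, 'u, 'y) module_scheme \<Rightarrow>
    'u \<Rightarrow> 'u \<Rightarrow> 'u"
  where "pure_tensor K M N m n \<equiv> tensor_class K M N [(m, n)]"

definition summands :: "'u::infinite \<Rightarrow> ('u \<times> 'u) list"
  where "summands = inv_into UNIV code"

text \<open>The multiplication and the unit are those of the tensor product of two Hom-algebras.\<close>

definition tensor ::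
  "('k, 'r) ring_scheme \<Rightarrow> ('k, 'u::infinite, 'x) hom_space_scheme \<Rightarrow>
    ('k, 'u, 'y) hom_space_scheme \<Rightarrow> ('k, 'u) hom_space"
  where "tensor K M N =
    \<lparr> carrier = tensor_class K M N ` {xs. set xs \<subseteq> carrier M \<times> carrier N},
      mult = (\<lambda>s t. tensor_class K M N
        [(a \<otimes>\<^bsub>M\<^esub> c, b \<otimes>\<^bsub>N\<^esub> d). (a, b) \<leftarrow> summands s, (c, d) \<leftarrow> summands t]),
      one = pure_tensor K M N \<one>\<^bsub>M\<^esub> \<one>\<^bsub>N\<^esub>,
      zero = tensor_class K M N [],
      add = (\<lambda>s t. tensor_class K M N (summands s @ summands t)),
      smult = (\<lambda>a t. tensor_class K M N (map (\<lambda>(m, n). (a \<odot>\<^bsub>M\<^esub> m, n)) (summands t))),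
      twist = (\<lambda>t. tensor_class K M N (map (\<lambda>(m, n). (twist M m, twist N n)) (summands t))) \<rparr>"

text \<open>For \<open>t = \<Sum>x \<otimes> y\<close> and bilinear \<open>b\<close> with values in \<open>P\<close>, the value \<open>\<Sum>b x y\<close>; so Sweedler's
  notation \<open>\<dots> c\<^sub>1 \<dots> c\<^sub>2 \<dots>\<close> is \<open>sweedler P (\<Delta> c) (\<lambda>c\<^sub>1 c\<^sub>2. \<dots> c\<^sub>1 \<dots> c\<^sub>2 \<dots>)\<close>.\<close>

definition sum_over :: "('u, 'x) ring_scheme \<Rightarrow> ('v \<times> 'w) list \<Rightarrow> ('v \<Rightarrow> 'w \<Rightarrow> 'u) \<Rightarrow> 'u"
  where "sum_over P xs b = foldr (\<lambda>(x, y) s. b x y \<oplus>\<^bsub>P\<^esub> s) xs \<zero>\<^bsub>P\<^esub>"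

definition sweedler ::
  "('u::infinite, 'x) ring_scheme \<Rightarrow> 'u \<Rightarrow> ('u \<Rightarrow> 'u \<Rightarrow> 'u) \<Rightarrow> 'u"
  where "sweedler P t b = sum_over P (summands t) b"


section \<open>Hom-algebras, Hom-coalgebras and Hom-Hopf algebras\<close>

definition hom_algebra :: "('k, 'r) ring_scheme \<Rightarrow> ('k, 'u, 'x) hom_space_scheme \<Rightarrow> bool"
  where "hom_algebra K A \<longleftrightarrow> hom_space K A \<and>
    bilin_map K A A A (mult A) \<and> \<one>\<^bsub>A\<^esub> \<in> carrier A \<and>
    (\<forall>a\<in>carrier A. \<forall>b\<in>carrier A. twist A (a \<otimes>\<^bsub>A\<^esub> b) = twist A a \<otimes>\<^bsub>A\<^esub> twist A b) \<and>
    twist A \<one>\<^bsub>A\<^esub> = \<one>\<^bsub>A\<^esub> \<and>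
    (\<forall>a\<in>carrier A. \<one>\<^bsub>A\<^esub> \<otimes>\<^bsub>A\<^esub> a = twist A a \<and> a \<otimes>\<^bsub>A\<^esub> \<one>\<^bsub>A\<^esub> = twist A a) \<and>
    (\<forall>a\<in>carrier A. \<forall>b\<in>carrier A. \<forall>c\<in>carrier A.
      twist A a \<otimes>\<^bsub>A\<^esub> (b \<otimes>\<^bsub>A\<^esub> c) = (a \<otimes>\<^bsub>A\<^esub> b) \<otimes>\<^bsub>A\<^esub> twist A c)"

definition hom_algebra_map ::
  "('k, 'r) ring_scheme \<Rightarrow> ('k, 'u, 'x) hom_space_scheme \<Rightarrow> ('k, 'v, 'y) hom_space_scheme \<Rightarrow>
    ('u \<Rightarrow> 'v) \<Rightarrow> bool"
  where "hom_algebra_map K A B f \<longleftrightarrow> lin_map K A B f \<and>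
    (\<forall>a\<in>carrier A. f (twist A a) = twist B (f a)) \<and>
    (\<forall>a\<in>carrier A. \<forall>b\<in>carrier A. f (a \<otimes>\<^bsub>A\<^esub> b) = f a \<otimes>\<^bsub>B\<^esub> f b) \<and>
    f \<one>\<^bsub>A\<^esub> = \<one>\<^bsub>B\<^esub>"

record ('k, 'u) hom_coalg = "('k, 'u) hom_space" +
  comult :: "'u \<Rightarrow> 'u"
  counit :: "'u \<Rightarrow> 'k"

definition hom_coalgebra ::
  "('k, 'r) ring_scheme \<Rightarrow> ('k, 'u::infinite, 'x) hom_coalg_scheme \<Rightarrow> bool"
  where "hom_coalgebra K C \<longleftrightarrow> hom_space K C \<and>
    lin_map K C (tensor K C C) (comult C) \<and> lin_form K C (counit C) \<and>
    (\<forall>c\<in>carrier C.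
      counit C (twist C c) = counit C c \<and>
      twist (tensor K C C) (comult C c) = comult C (twist C c) \<and>
      sweedler C (comult C c) (\<lambda>c1 c2. counit C c1 \<odot>\<^bsub>C\<^esub> c2) = twist C c \<and>
      sweedler C (comult C c) (\<lambda>c1 c2. counit C c2 \<odot>\<^bsub>C\<^esub> c1) = twist C c \<and>
      (let P = tensor K C (tensor K C C);
           pure3 = (\<lambda>x y z. pure_tensor K C (tensor K C C) x (pure_tensor K C C y z))
       in sweedler P (comult C c) (\<lambda>c1 c2. sweedler P (comult C c1) (\<lambda>c11 c12.
            pure3 c11 c12 (twist C c2))) =
          sweedler P (comult C c) (\<lambda>c1 c2. sweedler P (comult C c2) (\<lambda>c21 c22.
            pure3 (twist C c1) c21 c22))))"

definition hom_coalgebra_map ::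
  "('k, 'r) ring_scheme \<Rightarrow> ('k, 'u::infinite, 'x) hom_coalg_scheme \<Rightarrow>
    ('k, 'u, 'y) hom_coalg_scheme \<Rightarrow> ('u \<Rightarrow> 'u) \<Rightarrow> bool"
  where "hom_coalgebra_map K C D f \<longleftrightarrow> lin_map K C D f \<and>
    (\<forall>c\<in>carrier C. f (twist C c) = twist D (f c) \<and>
      counit D (f c) = counit C c \<and>
      comult D (f c) =
        sweedler (tensor K D D) (comult C c) (\<lambda>c1 c2. pure_tensor K D D (f c1) (f c2)))"

definition hom_bialgebra ::
  "('k, 'r) ring_scheme \<Rightarrow> ('k, 'u::infinite, 'x) hom_coalg_scheme \<Rightarrow> bool"
  where "hom_bialgebra K H \<longleftrightarrow> hom_algebra K H \<and> hom_coalgebra K H \<and>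
    hom_algebra_map K H (tensor K H H) (comult H) \<and>
    (\<forall>g\<in>carrier H. \<forall>h\<in>carrier H. counit H (g \<otimes>\<^bsub>H\<^esub> h) = counit H g \<otimes>\<^bsub>K\<^esub> counit H h) \<and>
    counit H \<one>\<^bsub>H\<^esub> = \<one>\<^bsub>K\<^esub>"

record ('k, 'u) hom_hopf = "('k, 'u) hom_coalg" +
  antipode :: "'u \<Rightarrow> 'u"

definition hom_hopf_algebra ::
  "('k, 'r) ring_scheme \<Rightarrow> ('k, 'u::infinite, 'x) hom_hopf_scheme \<Rightarrow> bool"
  where "hom_hopf_algebra K H \<longleftrightarrow> hom_bialgebra K H \<and> lin_map K H H (antipode H) \<and>
    (\<forall>h\<in>carrier H. antipode H (twist H h) = twist H (antipode H h) \<and>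
      sweedler H (comult H h) (\<lambda>h1 h2. antipode H h1 \<otimes>\<^bsub>H\<^esub> h2) = counit H h \<odot>\<^bsub>H\<^esub> \<one>\<^bsub>H\<^esub> \<and>
      sweedler H (comult H h) (\<lambda>h1 h2. h1 \<otimes>\<^bsub>H\<^esub> antipode H h2) = counit H h \<odot>\<^bsub>H\<^esub> \<one>\<^bsub>H\<^esub>)"

definition hom_hopf_map ::
  "('k, 'r) ring_scheme \<Rightarrow> ('k, 'u::infinite, 'x) hom_hopf_scheme \<Rightarrow>
    ('k, 'u, 'y) hom_hopf_scheme \<Rightarrow> ('u \<Rightarrow> 'u) \<Rightarrow> bool"
  where "hom_hopf_map K H L f \<longleftrightarrow> hom_algebra_map K H L f \<and> hom_coalgebra_map K H L f \<and>
    (\<forall>h\<in>carrier H. f (antipode H h) = antipode L (f h))"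


section \<open>Modules and comodules\<close>

definition left_hom_module ::
  "('k, 'r) ring_scheme \<Rightarrow> ('k, 'u, 'x) hom_space_scheme \<Rightarrow> ('k, 'v, 'y) hom_space_scheme \<Rightarrow>
    ('u \<Rightarrow> 'v \<Rightarrow> 'v) \<Rightarrow> bool"
  where "left_hom_module K A M act \<longleftrightarrow> hom_space K M \<and> bilin_map K A M M act \<and>
    (\<forall>m\<in>carrier M. act \<one>\<^bsub>A\<^esub> m = twist M m) \<and>
    (\<forall>a\<in>carrier A. \<forall>m\<in>carrier M. twist M (act a m) = act (twist A a) (twist M m)) \<and>
    (\<forall>a\<in>carrier A. \<forall>b\<in>carrier A. \<forall>m\<in>carrier M.
      act (twist A a) (act b m) = act (a \<otimes>\<^bsub>A\<^esub> b) (twist M m))"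

definition right_hom_comodule ::
  "('k, 'r) ring_scheme \<Rightarrow> ('k, 'u::infinite, 'x) hom_coalg_scheme \<Rightarrow>
    ('k, 'u, 'y) hom_space_scheme \<Rightarrow> ('u \<Rightarrow> 'u) \<Rightarrow> bool"
  where "right_hom_comodule K C M \<rho> \<longleftrightarrow> hom_space K M \<and> lin_map K M (tensor K M C) \<rho> \<and>
    (\<forall>m\<in>carrier M.
      sweedler M (\<rho> m) (\<lambda>m0 m1. counit C m1 \<odot>\<^bsub>M\<^esub> m0) = twist M m \<and>
      twist (tensor K M C) (\<rho> m) = \<rho> (twist M m) \<and>
      (let P = tensor K M (tensor K C C);
           pure3 = (\<lambda>x y z. pure_tensor K M (tensor K C C) x (pure_tensor K C C y z))
       in sweedler P (\<rho> m) (\<lambda>m0 m1. sweedler P (\<rho> m0) (\<lambda>m00 m01.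
            pure3 m00 m01 (twist C m1))) =
          sweedler P (\<rho> m) (\<lambda>m0 m1. sweedler P (comult C m1) (\<lambda>m11 m12.
            pure3 (twist M m0) m11 m12))))"


section \<open>Doi-Hopf data and Doi-Hopf modules\<close>

record ('k, 'u) comod_alg = "('k, 'u) hom_space" +
  alg_coact :: "'u \<Rightarrow> 'u"

record ('k, 'u) mod_coalg = "('k, 'u) hom_coalg" +
  coalg_act :: "'u \<Rightarrow> 'u \<Rightarrow> 'u"

definition comodule_algebra ::
  "('k, 'r) ring_scheme \<Rightarrow> ('k, 'u::infinite) hom_hopf \<Rightarrow> ('k, 'u) comod_alg \<Rightarrow> bool"
  where "comodule_algebra K H A \<longleftrightarrow> hom_algebra K A \<and> right_hom_comodule K H A (alg_coact A) \<and>
    (\<forall>a\<in>carrier A. \<forall>b\<in>carrier A.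
      alg_coact A (a \<otimes>\<^bsub>A\<^esub> b) = alg_coact A a \<otimes>\<^bsub>tensor K A H\<^esub> alg_coact A b) \<and>
    alg_coact A \<one>\<^bsub>A\<^esub> = pure_tensor K A H \<one>\<^bsub>A\<^esub> \<one>\<^bsub>H\<^esub>"

definition module_coalgebra ::
  "('k, 'r) ring_scheme \<Rightarrow> ('k, 'u::infinite) hom_hopf \<Rightarrow> ('k, 'u) mod_coalg \<Rightarrow> bool"
  where "module_coalgebra K H C \<longleftrightarrow> hom_coalgebra K C \<and> left_hom_module K H C (coalg_act C) \<and>
    (\<forall>h\<in>carrier H. \<forall>c\<in>carrier C.
      comult C (coalg_act C h c) =
        sweedler (tensor K C C) (comult H h) (\<lambda>h1 h2.
          sweedler (tensor K C C) (comult C c) (\<lambda>c1 c2.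
            pure_tensor K C C (coalg_act C h1 c1) (coalg_act C h2 c2))) \<and>
      counit C (coalg_act C h c) = counit H h \<otimes>\<^bsub>K\<^esub> counit C c)"

record ('k, 'u) doi_hopf =
  hopf :: "('k, 'u) hom_hopf"
  alg :: "('k, 'u) comod_alg"
  coalg :: "('k, 'u) mod_coalg"

definition doi_hopf_datum ::
  "('k, 'r) ring_scheme \<Rightarrow> ('k, 'u::infinite) doi_hopf \<Rightarrow> bool"
  where "doi_hopf_datum K D \<longleftrightarrow> hom_hopf_algebra K (hopf D) \<and>
    comodule_algebra K (hopf D) (alg D) \<and> module_coalgebra K (hopf D) (coalg D)"

definition doi_hopf_map ::
  "('k, 'r) ring_scheme \<Rightarrow> ('k, 'u::infinite) doi_hopf \<Rightarrow> ('k, 'u) doi_hopf \<Rightarrow>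
    ('u \<Rightarrow> 'u) \<Rightarrow> ('u \<Rightarrow> 'u) \<Rightarrow> ('u \<Rightarrow> 'u) \<Rightarrow> bool"
  where "doi_hopf_map K D D' \<theta> \<beta> \<gamma> \<longleftrightarrow>
    hom_hopf_map K (hopf D) (hopf D') \<theta> \<and>
    hom_algebra_map K (alg D) (alg D') \<beta> \<and>
    hom_coalgebra_map K (coalg D) (coalg D') \<gamma> \<and>
    (\<forall>h\<in>carrier (hopf D). \<forall>c\<in>carrier (coalg D).
      \<gamma> (coalg_act (coalg D) h c) = coalg_act (coalg D') (\<theta> h) (\<gamma> c)) \<and>
    (\<forall>a\<in>carrier (alg D).
      alg_coact (alg D') (\<beta> a) =
        sweedler (tensor K (alg D') (hopf D')) (alg_coact (alg D) a) (\<lambda>a0 a1.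
          pure_tensor K (alg D') (hopf D') (\<beta> a0) (\<theta> a1)))"

record ('k, 'u) dh_module = "('k, 'u) hom_space" +
  mod_act :: "'u \<Rightarrow> 'u \<Rightarrow> 'u"
  mod_coact :: "'u \<Rightarrow> 'u"

definition doi_hopf_module ::
  "('k, 'r) ring_scheme \<Rightarrow> ('k, 'u::infinite) doi_hopf \<Rightarrow> ('k, 'u) dh_module \<Rightarrow> bool"
  where "doi_hopf_module K D M \<longleftrightarrow>
    left_hom_module K (alg D) M (mod_act M) \<and>
    right_hom_comodule K (coalg D) M (mod_coact M) \<and>
    (\<forall>a\<in>carrier (alg D). \<forall>m\<in>carrier M.
      mod_coact M (mod_act M a m) =
        sweedler (tensor K M (coalg D)) (alg_coact (alg D) a) (\<lambda>a0 a1.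
          sweedler (tensor K M (coalg D)) (mod_coact M m) (\<lambda>m0 m1.
            pure_tensor K M (coalg D) (mod_act M a0 m0) (coalg_act (coalg D) a1 m1))))"

definition doi_hopf_hom ::
  "('k, 'r) ring_scheme \<Rightarrow> ('k, 'u::infinite) doi_hopf \<Rightarrow> ('k, 'u) dh_module \<Rightarrow>
    ('k, 'u) dh_module \<Rightarrow> ('u \<Rightarrow> 'u) set"
  where "doi_hopf_hom K D M N = {f \<in> extensional (carrier M). lin_map K M N f \<and>
    (\<forall>m\<in>carrier M. f (twist M m) = twist N (f m) \<and>
      (\<forall>a\<in>carrier (alg D). f (mod_act M a m) = mod_act N a (f m)) \<and>
      mod_coact N (f m) =
        sweedler (tensor K N (coalg D)) (mod_coact M m) (\<lambda>m0 m1.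
          pure_tensor K N (coalg D) (f m0) m1))}"


section \<open>Categories and adjoint functors\<close>

record ('o, 'm) category =
  Obj :: "'o set"
  Hom :: "'o \<Rightarrow> 'o \<Rightarrow> 'm set"
  Ident :: "'o \<Rightarrow> 'm"
  Comp :: "'o \<Rightarrow> 'o \<Rightarrow> 'o \<Rightarrow> 'm \<Rightarrow> 'm \<Rightarrow> 'm"

text \<open>\<open>Comp \<C> X Y Z g f\<close> is the composite of \<open>f : X \<rightarrow> Y\<close> and \<open>g : Y \<rightarrow> Z\<close>.\<close>

definition is_category :: "('o, 'm) category \<Rightarrow> bool"
  where "is_category \<C> \<longleftrightarrow>
    (\<forall>X\<in>Obj \<C>. Ident \<C> X \<in> Hom \<C> X X) \<and>
    (\<forall>X\<in>Obj \<C>. \<forall>Y\<in>Obj \<C>. \<forall>Z\<in>Obj \<C>. \<forall>f\<in>Hom \<C> X Y. \<forall>g\<in>Hom \<C> Y Z.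
      Comp \<C> X Y Z g f \<in> Hom \<C> X Z) \<and>
    (\<forall>X\<in>Obj \<C>. \<forall>Y\<in>Obj \<C>. \<forall>f\<in>Hom \<C> X Y.
      Comp \<C> X X Y f (Ident \<C> X) = f \<and> Comp \<C> X Y Y (Ident \<C> Y) f = f) \<and>
    (\<forall>W\<in>Obj \<C>. \<forall>X\<in>Obj \<C>. \<forall>Y\<in>Obj \<C>. \<forall>Z\<in>Obj \<C>.
      \<forall>f\<in>Hom \<C> W X. \<forall>g\<in>Hom \<C> X Y. \<forall>h\<in>Hom \<C> Y Z.
        Comp \<C> W X Z (Comp \<C> X Y Z h g) f = Comp \<C> W Y Z h (Comp \<C> W X Y g f))"

record ('o, 'm, 'p, 'n) cat_map =
  on_obj :: "'o \<Rightarrow> 'p"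
  on_hom :: "'o \<Rightarrow> 'o \<Rightarrow> 'm \<Rightarrow> 'n"

definition is_functor ::
  "('o, 'm) category \<Rightarrow> ('p, 'n) category \<Rightarrow> ('o, 'm, 'p, 'n) cat_map \<Rightarrow> bool"
  where "is_functor \<C> \<D> F \<longleftrightarrow> is_category \<C> \<and> is_category \<D> \<and>
    (\<forall>X\<in>Obj \<C>. on_obj F X \<in> Obj \<D>) \<and>
    (\<forall>X\<in>Obj \<C>. \<forall>Y\<in>Obj \<C>. \<forall>f\<in>Hom \<C> X Y.
      on_hom F X Y f \<in> Hom \<D> (on_obj F X) (on_obj F Y)) \<and>
    (\<forall>X\<in>Obj \<C>. on_hom F X X (Ident \<C> X) = Ident \<D> (on_obj F X)) \<and>
    (\<forall>X\<in>Obj \<C>. \<forall>Y\<in>Obj \<C>. \<forall>Z\<in>Obj \<C>. \<forall>f\<in>Hom \<C> X Y. \<forall>g\<in>Hom \<C> Y Z.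
      on_hom F X Z (Comp \<C> X Y Z g f) =
        Comp \<D> (on_obj F X) (on_obj F Y) (on_obj F Z) (on_hom F Y Z g) (on_hom F X Y f))"

text \<open>\<open>F\<close> is left adjoint to \<open>G\<close>: there are bijections
  \<open>\<Phi>\<^bsub>X,Y\<^esub> : Hom (F X) Y \<rightarrow> Hom X (G Y)\<close> which are natural in \<open>X\<close> and \<open>Y\<close>.\<close>

definition adjoint_functors ::
  "('o, 'm) category \<Rightarrow> ('p, 'n) category \<Rightarrow> ('o, 'm, 'p, 'n) cat_map \<Rightarrow>
    ('p, 'n, 'o, 'm) cat_map \<Rightarrow> bool"
  where "adjoint_functors \<C> \<D> F G \<longleftrightarrow> is_functor \<C> \<D> F \<and> is_functor \<D> \<C> G \<and>
    (\<exists>\<Phi> :: 'o \<Rightarrow> 'p \<Rightarrow> 'n \<Rightarrow> 'm.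
      (\<forall>X\<in>Obj \<C>. \<forall>Y\<in>Obj \<D>.
        bij_betw (\<Phi> X Y) (Hom \<D> (on_obj F X) Y) (Hom \<C> X (on_obj G Y))) \<and>
      (\<forall>X\<in>Obj \<C>. \<forall>X'\<in>Obj \<C>. \<forall>Y\<in>Obj \<D>. \<forall>Y'\<in>Obj \<D>.
        \<forall>f\<in>Hom \<C> X' X. \<forall>h\<in>Hom \<D> (on_obj F X) Y. \<forall>g\<in>Hom \<D> Y Y'.
          \<Phi> X' Y' (Comp \<D> (on_obj F X') Y Y' g
            (Comp \<D> (on_obj F X') (on_obj F X) Y h (on_hom F X' X f))) =
          Comp \<C> X' (on_obj G Y) (on_obj G Y') (on_hom G Y Y' g)
            (Comp \<C> X' X (on_obj G Y) (\<Phi> X Y h) f)))"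

definition doi_hopf_category ::
  "('k, 'r) ring_scheme \<Rightarrow> ('k, 'u::infinite) doi_hopf \<Rightarrow> (('k, 'u) dh_module, 'u \<Rightarrow> 'u) category"
  where "doi_hopf_category K D =
    \<lparr> Obj = {M. doi_hopf_module K D M},
      Hom = doi_hopf_hom K D,
      Ident = (\<lambda>M. \<lambda>m\<in>carrier M. m),
      Comp = (\<lambda>L M N g f. compose (carrier L) g f) \<rparr>"


section \<open>The functor $F$\<close>

text \<open>Every coset of \<open>W\<close> is represented by an element of it, chosen once for all.\<close>

definition coset_rep :: "('k, 'u, 'x) module_scheme \<Rightarrow> 'u set \<Rightarrow> 'u \<Rightarrow> 'u"
  where "coset_rep V W x = (SOME y. y \<in> W +>\<^bsub>V\<^esub> x)"

definition quotient_space :: "('k, 'u) hom_space \<Rightarrow> 'u set \<Rightarrow> ('k, 'u) hom_space"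
  where "quotient_space V W = V
    \<lparr> carrier := coset_rep V W ` carrier V,
      zero := coset_rep V W \<zero>\<^bsub>V\<^esub>,
      add := (\<lambda>x y. coset_rep V W (x \<oplus>\<^bsub>V\<^esub> y)),
      smult := (\<lambda>a x. coset_rep V W (a \<odot>\<^bsub>V\<^esub> x)),
      twist := (\<lambda>x. coset_rep V W (twist V x)) \<rparr>"

definition balancing ::
  "('k, 'r) ring_scheme \<Rightarrow> ('k, 'u::infinite) doi_hopf \<Rightarrow> ('k, 'u) doi_hopf \<Rightarrow> ('u \<Rightarrow> 'u) \<Rightarrow>
    ('k, 'u) dh_module \<Rightarrow> 'u set"
  where "balancing K D D' \<beta> M =
    (let V = tensor K (alg D') M
     in (\<lambda>W. submodule W K V) hull
       {pure_tensor K (alg D') M (b \<otimes>\<^bsub>alg D'\<^esub> \<beta> a) (twist M m) \<ominus>\<^bsub>V\<^esub>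
        pure_tensor K (alg D') M (twist (alg D') b) (mod_act M a m)
        | b a m. b \<in> carrier (alg D') \<and> a \<in> carrier (alg D) \<and> m \<in> carrier M})"

definition balanced_tensor ::
  "('k, 'r) ring_scheme \<Rightarrow> ('k, 'u::infinite) doi_hopf \<Rightarrow> ('k, 'u) doi_hopf \<Rightarrow> ('u \<Rightarrow> 'u) \<Rightarrow>
    ('k, 'u) dh_module \<Rightarrow> ('k, 'u) hom_space"
  where "balanced_tensor K D D' \<beta> M =
    quotient_space (tensor K (alg D') M) (balancing K D D' \<beta> M)"

definition pure_balanced ::
  "('k, 'r) ring_scheme \<Rightarrow> ('k, 'u::infinite) doi_hopf \<Rightarrow> ('k, 'u) doi_hopf \<Rightarrow> ('u \<Rightarrow> 'u) \<Rightarrow>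
    ('k, 'u) dh_module \<Rightarrow> 'u \<Rightarrow> 'u \<Rightarrow> 'u"
  where "pure_balanced K D D' \<beta> M b m =
    coset_rep (tensor K (alg D') M) (balancing K D D' \<beta> M) (pure_tensor K (alg D') M b m)"

text \<open>An element of the quotient is in particular an element of \<open>A' \<otimes> M\<close>, so that \<open>sweedler\<close>
  applies to it.\<close>

definition induction_functor ::
  "('k, 'r) ring_scheme \<Rightarrow> ('k, 'u::infinite) doi_hopf \<Rightarrow> ('k, 'u) doi_hopf \<Rightarrow>
    ('u \<Rightarrow> 'u) \<Rightarrow> ('u \<Rightarrow> 'u) \<Rightarrow>
    (('k, 'u) dh_module, 'u \<Rightarrow> 'u, ('k, 'u) dh_module, 'u \<Rightarrow> 'u) cat_map"
  where "induction_functor K D D' \<beta> \<gamma> =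
    \<lparr> on_obj = (\<lambda>M.
        let A' = alg D'; C' = coalg D'; Q = balanced_tensor K D D' \<beta> M;
            P = tensor K Q C'; cls = pure_balanced K D D' \<beta> M
        in hom_space.extend Q (dh_module.fields
          (\<lambda>a q. sweedler Q q (\<lambda>b m. cls (twist A' a \<otimes>\<^bsub>A'\<^esub> b) (twist M m)))
          (\<lambda>q. sweedler P q (\<lambda>b m.
            sweedler P (alg_coact A' b) (\<lambda>b0 b1.
              sweedler P (mod_coact M m) (\<lambda>m0 m1.
                pure_tensor K Q C' (cls b0 m0)
                  (untwist C' (untwist C' (coalg_act C' b1 (\<gamma> m1)))))))))),
      on_hom = (\<lambda>M N f. \<lambda>q\<in>carrier (balanced_tensor K D D' \<beta> M).
        sweedler (balanced_tensor K D D' \<beta> N) q (\<lambda>b m. pure_balanced K D D' \<beta> N b (f m))) \<rparr>"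


section \<open>The functor $G$\<close>

definition cotensor ::
  "('k, 'r) ring_scheme \<Rightarrow> ('k, 'u::infinite) doi_hopf \<Rightarrow> ('k, 'u) doi_hopf \<Rightarrow> ('u \<Rightarrow> 'u) \<Rightarrow>
    ('k, 'u) dh_module \<Rightarrow> ('k, 'u) hom_space"
  where "cotensor K D D' \<gamma> N =
    (let C = coalg D; C' = coalg D'; P = tensor K N (tensor K C' C);
         pure3 = (\<lambda>x y z. pure_tensor K N (tensor K C' C) x (pure_tensor K C' C y z))
     in (tensor K N C) \<lparr> carrier := {x \<in> carrier (tensor K N C).
       sweedler P x (\<lambda>n c. sweedler P (comult C c) (\<lambda>c1 c2. pure3 (twist N n) (\<gamma> c1) c2)) =
       sweedler P x (\<lambda>n c. sweedler P (mod_coact N n) (\<lambda>n0 n1. pure3 n0 n1 (twist C c)))} \<rparr>)"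

text \<open>The image of an element of \<open>(N' \<box> C) \<otimes> C\<close> under the inclusion into \<open>(N' \<otimes> C) \<otimes> C\<close>.\<close>

definition cotensor_incl ::
  "('k, 'r) ring_scheme \<Rightarrow> ('k, 'u::infinite) doi_hopf \<Rightarrow> ('k, 'u) dh_module \<Rightarrow> 'u \<Rightarrow> 'u"
  where "cotensor_incl K D N t =
    sweedler (tensor K (tensor K N (coalg D)) (coalg D)) t
      (\<lambda>x c. pure_tensor K (tensor K N (coalg D)) (coalg D) x c)"

definition cotensor_act_formula ::
  "('k, 'r) ring_scheme \<Rightarrow> ('k, 'u::infinite) doi_hopf \<Rightarrow> ('u \<Rightarrow> 'u) \<Rightarrow>
    ('k, 'u) dh_module \<Rightarrow> 'u \<Rightarrow> ('u \<times> 'u) list \<Rightarrow> 'u"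
  where "cotensor_act_formula K D \<beta> N a xs =
    (let C = coalg D; V = tensor K N C
     in sum_over V xs (\<lambda>n c. sweedler V (alg_coact (alg D) a) (\<lambda>a0 a1.
       pure_tensor K N C (mod_act N (\<beta> a0) n) (coalg_act C a1 c))))"

definition cotensor_coact_formula ::
  "('k, 'r) ring_scheme \<Rightarrow> ('k, 'u::infinite) doi_hopf \<Rightarrow>
    ('k, 'u) dh_module \<Rightarrow> ('u \<times> 'u) list \<Rightarrow> 'u"
  where "cotensor_coact_formula K D N xs =
    (let C = coalg D; V = tensor K N C; P = tensor K V C
     in sum_over P xs (\<lambda>n c. sweedler P (comult C c) (\<lambda>c1 c2.
       pure_tensor K V C (pure_tensor K N C (twist N n) c1) (untwist C c2))))"

text \<open>The coaction formula has values in \<open>(N' \<otimes> C) \<otimes> C\<close>; the coaction itself is its unique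
  preimage in \<open>(N' \<box> C) \<otimes> C\<close>.\<close>

definition cotensor_functor ::
  "('k, 'r) ring_scheme \<Rightarrow> ('k, 'u::infinite) doi_hopf \<Rightarrow> ('k, 'u) doi_hopf \<Rightarrow>
    ('u \<Rightarrow> 'u) \<Rightarrow> ('u \<Rightarrow> 'u) \<Rightarrow>
    (('k, 'u) dh_module, 'u \<Rightarrow> 'u, ('k, 'u) dh_module, 'u \<Rightarrow> 'u) cat_map"
  where "cotensor_functor K D D' \<beta> \<gamma> =
    \<lparr> on_obj = (\<lambda>N. let Q = cotensor K D D' \<gamma> N
        in hom_space.extend Q (dh_module.fields
          (\<lambda>a x. cotensor_act_formula K D \<beta> N a (summands x))
          (\<lambda>x. THE t. t \<in> carrier (tensor K Q (coalg D)) \<and>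
            cotensor_incl K D N t = cotensor_coact_formula K D N (summands x)))),
      on_hom = (\<lambda>N N' f. \<lambda>x\<in>carrier (cotensor K D D' \<gamma> N).
        sweedler (tensor K N' (coalg D)) x (\<lambda>n c. pure_tensor K N' (coalg D) (f n) c)) \<rparr>"

end

theory Submission
  imports Defs
begin

text \<open>
  A Hom-structure with bijective structure map \<open>\<alpha>\<close> is an ordinary structure together with an
  automorphism: \<open>\<alpha>\<^sup>-\<^sup>1(a b)\<close> is an associative unital product, \<open>\<Delta> \<circ> \<alpha>\<^sup>-\<^sup>1\<close> a coassociative
  coproduct, and so on. The theorem is therefore the adjunction between induction and coinduction
  of Doi-Hopf modules, with powers of \<open>\<alpha>\<close> inserted. The powers in the formulas for \<open>F\<close> and \<open>G\<close> are
  consistent: both functors are the classical ones followed by the twist of the action by \<open>\<alpha>\<close> and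
  of the coaction by \<open>\<alpha>\<^sup>-\<^sup>1\<close>, and \<open>\<alpha>\<close> itself is a natural isomorphism from the identity functor to
  this twist.

  \<^emph>\<open>The functor \<open>G\<close>.\<close> The formulas for the action and the coaction make sense on all of \<open>N \<otimes> C\<close> and
  turn it into a Doi-Hopf module (\<open>coind_dh_struct\<close>). The cotensor product is the equalizer of two
  linear maps \<open>L, R : N \<otimes> C \<rightarrow> N \<otimes> C' \<otimes> C\<close>. If \<open>L\<close> and \<open>R\<close> agree on \<open>x\<close>, then they agree on \<open>a \<cdot> x\<close>
  (\<open>cot_act_eq\<close>), and \<open>L \<otimes> id\<close> and \<open>R \<otimes> id\<close> agree on \<open>\<rho>(x)\<close> (\<open>cot_coact_eq\<close>). Over a field,
  tensoring with \<open>C\<close> preserves equalizers (\<open>tensor_equalizer\<close>), so \<open>\<rho>(x)\<close> lies in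
  \<open>(N \<box> C) \<otimes> C\<close>, and \<open>N \<box> C\<close> is a subobject of \<open>N \<otimes> C\<close>.

  \<^emph>\<open>The functor \<open>F\<close>.\<close> Dually, \<open>A' \<otimes> M\<close> is a Doi-Hopf module over the second datum
  (\<open>ind_dh_struct\<close>); its action and coaction respect the relations of \<open>A' \<otimes>\<^sub>A M\<close>
  (\<open>ind_act_balanced\<close>, \<open>ind_coact_balanced\<close>), so that \<open>A' \<otimes>\<^sub>A M\<close> is a quotient object.

  \<^emph>\<open>The adjunction.\<close> Both \<open>Hom(F M, N)\<close> and \<open>Hom(M, G N)\<close> are in bijection with the
  set of \<^emph>\<open>semilinear\<close> maps \<open>\<phi> : M \<rightarrow> N\<close>, that is, of the linear maps that commute with \<open>\<alpha>\<close> and satisfy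
  \<open>\<phi>(a \<cdot> m) = \<beta>(a) \<cdot> \<phi>(m)\<close> and \<open>\<rho>(\<phi>(m)) = \<phi>(m\<^sub>0) \<otimes> \<gamma>(m\<^sub>1)\<close>:
  \<^item> a map \<open>h\<close> on \<open>A' \<otimes>\<^sub>A M\<close> is determined by \<open>\<phi>(m) = h(1 \<otimes> \<alpha>(m))\<close>, and
    \<open>h(b \<otimes> m) = \<alpha>\<^sup>-\<^sup>2(b \<cdot> \<phi>(m))\<close> (\<open>bij_restrict_unit\<close>);
  \<^item> a map \<open>g\<close> into \<open>N \<box> C\<close> is determined by \<open>\<phi> = \<alpha>\<^sup>-\<^sup>1 \<circ> (id \<otimes> \<epsilon>) \<circ> g\<close>, and
    \<open>g(m) = \<phi>(m\<^sub>0) \<otimes> m\<^sub>1\<close> (\<open>bij_extend_coact\<close>).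

  All identities between Sweedler sums are checked on pure tensors, which generate
  (\<open>tensor_ext\<close>). There, products are rebracketed by Hom-associativity, structure maps are moved
  to the innermost factors, and coassociativity replaces a repeated splitting of the first leg of
  a coaction by one of the second leg (\<open>comodule_coassoc\<close>).
\<close>

section \<open>Linear maps\<close>

locale ground_field =
  fixes K :: "'k ring"
  assumes field_K: "field K"
begin

sublocale K: field K by (rule field_K)

text \<open>Spaces are vector spaces with a bijective structure map, as in \<open>hom_space\<close>.\<close>

abbreviation hs :: "('k, 'u, 'x) hom_space_scheme \<Rightarrow> bool"
  where "hs V \<equiv> hom_space K V"

abbreviation lin :: "('k, 'u, 'x) module_scheme \<Rightarrow> ('k, 'v, 'y) module_scheme \<Rightarrow> ('u \<Rightarrow> 'v) \<Rightarrow> bool"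
  where "lin \<equiv> lin_map K"

abbreviation tens :: "('k, 'u::infinite, 'x) hom_space_scheme \<Rightarrow>
    ('k, 'u, 'y) hom_space_scheme \<Rightarrow> ('k, 'u) hom_space"  (infixr "\<^bold>\<otimes>" 73)
  where "U \<^bold>\<otimes> V \<equiv> tensor K U V"

lemma hs_module: "hs V \<Longrightarrow> Module.module K V"
  by (simp add: hom_space_def)

lemma hs_abelian_group: "hs V \<Longrightarrow> abelian_group V"
  by (simp add: hom_space_def Module.module_def)

lemma hs_closed [simp]:
  assumes "hs V"
  shows "\<zero>\<^bsub>V\<^esub> \<in> carrier V"
    and "x \<in> carrier V \<Longrightarrow> y \<in> carrier V \<Longrightarrow> x \<oplus>\<^bsub>V\<^esub> y \<in> carrier V"
    and "a \<in> carrier K \<Longrightarrow> x \<in> carrier V \<Longrightarrow> a \<odot>\<^bsub>V\<^esub> x \<in> carrier V"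
    and "x \<in> carrier V \<Longrightarrow> twist V x \<in> carrier V"
proof -
  interpret V: Module.module K V using assms by (rule hs_module)
  show "\<zero>\<^bsub>V\<^esub> \<in> carrier V"
    "x \<in> carrier V \<Longrightarrow> y \<in> carrier V \<Longrightarrow> x \<oplus>\<^bsub>V\<^esub> y \<in> carrier V"
    "a \<in> carrier K \<Longrightarrow> x \<in> carrier V \<Longrightarrow> a \<odot>\<^bsub>V\<^esub> x \<in> carrier V" by simp_all
  show "x \<in> carrier V \<Longrightarrow> twist V x \<in> carrier V"
    using assms by (auto simp: hom_space_def lin_map_def)
qed

lemma lin_closed: "lin V W f \<Longrightarrow> x \<in> carrier V \<Longrightarrow> f x \<in> carrier W"
  by (auto simp: lin_map_def)

lemma lin_add: "lin V W f \<Longrightarrow> x \<in> carrier V \<Longrightarrow> y \<in> carrier V \<Longrightarrow> f (x \<oplus>\<^bsub>V\<^esub> y) = f x \<oplus>\<^bsub>W\<^esub> f y"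
  by (simp add: lin_map_def)

lemma lin_smult: "lin V W f \<Longrightarrow> a \<in> carrier K \<Longrightarrow> x \<in> carrier V \<Longrightarrow> f (a \<odot>\<^bsub>V\<^esub> x) = a \<odot>\<^bsub>W\<^esub> f x"
  by (simp add: lin_map_def)

lemma lin_zero:
  assumes "hs V" "hs W" "lin V W f"
  shows "f \<zero>\<^bsub>V\<^esub> = \<zero>\<^bsub>W\<^esub>"
proof -
  interpret V: Module.module K V using assms(1) by (rule hs_module)
  interpret W: Module.module K W using assms(2) by (rule hs_module)
  show ?thesis
    using lin_smult[OF assms(3), of "\<zero>\<^bsub>K\<^esub>" "\<zero>\<^bsub>V\<^esub>"] lin_closed[OF assms(3), of "\<zero>\<^bsub>V\<^esub>"] by simp
qed

lemma linI:
  assumes "\<And>x. x \<in> carrier V \<Longrightarrow> f x \<in> carrier W"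
    and "\<And>x y. x \<in> carrier V \<Longrightarrow> y \<in> carrier V \<Longrightarrow> f (x \<oplus>\<^bsub>V\<^esub> y) = f x \<oplus>\<^bsub>W\<^esub> f y"
    and "\<And>a x. a \<in> carrier K \<Longrightarrow> x \<in> carrier V \<Longrightarrow> f (a \<odot>\<^bsub>V\<^esub> x) = a \<odot>\<^bsub>W\<^esub> f x"
  shows "lin V W f"
  using assms by (auto simp: lin_map_def)

lemma lin_id [simp]: "lin V V (\<lambda>x. x)"
  by (auto simp: lin_map_def)

lemma lin_comp: "lin V W g \<Longrightarrow> lin U V f \<Longrightarrow> lin U W (\<lambda>x. g (f x))"
  by (auto simp: lin_map_def Pi_iff)

lemma lin_cong:
  "(\<And>x. x \<in> carrier V \<Longrightarrow> f x = g x) \<Longrightarrow> hs V \<Longrightarrow> lin V W f \<longleftrightarrow> lin V W g"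
  by (auto simp: lin_map_def Pi_iff)

lemma lin_plus:
  assumes "hs W" "lin V W f" "lin V W g"
  shows "lin V W (\<lambda>x. f x \<oplus>\<^bsub>W\<^esub> g x)"
proof -
  interpret W: Module.module K W using assms(1) by (rule hs_module)
  show ?thesis
    using assms(2,3) by (auto simp: lin_map_def Pi_iff W.a_ac W.smult_r_distr)
qed

lemma lin_zero_map: assumes "hs W" shows "lin V W (\<lambda>x. \<zero>\<^bsub>W\<^esub>)"
proof -
  interpret W: Module.module K W using assms(1) by (rule hs_module)
  show ?thesis by (auto simp: lin_map_def)
qed

lemma smult_smult:
  assumes "hs V" "a \<in> carrier K" "b \<in> carrier K" "x \<in> carrier V"
  shows "a \<odot>\<^bsub>V\<^esub> (b \<odot>\<^bsub>V\<^esub> x) = (a \<otimes>\<^bsub>K\<^esub> b) \<odot>\<^bsub>V\<^esub> x"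
proof -
  interpret V: Module.module K V using assms(1) by (rule hs_module)
  show ?thesis using assms by (simp add: V.smult_assoc1)
qed

lemma smult_commute:
  assumes "hs V" "a \<in> carrier K" "b \<in> carrier K" "x \<in> carrier V"
  shows "a \<odot>\<^bsub>V\<^esub> (b \<odot>\<^bsub>V\<^esub> x) = b \<odot>\<^bsub>V\<^esub> (a \<odot>\<^bsub>V\<^esub> x)"
  using assms by (simp add: smult_smult K.m_comm)

lemma lin_smult_map [simp]: "hs W \<Longrightarrow> a \<in> carrier K \<Longrightarrow> lin V W f \<Longrightarrow> lin V W (\<lambda>x. a \<odot>\<^bsub>W\<^esub> f x)"
proof -
  assume *: "hs W" "a \<in> carrier K" "lin V W f"
  interpret W: Module.module K W using *(1) by (rule hs_module)
  show ?thesis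
    using * by (auto simp: lin_map_def Pi_iff W.smult_r_distr smult_commute[OF *(1)])
qed

lemma lin_form_smult [simp]:
  assumes "hs W" "x \<in> carrier W" "lin_form K V f"
  shows "lin V W (\<lambda>v. f v \<odot>\<^bsub>W\<^esub> x)"
proof -
  interpret W: Module.module K W using assms(1) by (rule hs_module)
  show ?thesis
    using assms by (auto simp: lin_map_def lin_form_def Pi_iff W.smult_l_distr W.smult_assoc1)
qed

lemma lin_form_comp: "lin_form K V f \<Longrightarrow> lin U V g \<Longrightarrow> lin_form K U (\<lambda>x. f (g x))"
  by (auto simp: lin_map_def lin_form_def Pi_iff)

lemma lin_twist: "hs V \<Longrightarrow> lin V V (twist V)"
  by (simp add: hom_space_def)

lemma hs_bij: "hs V \<Longrightarrow> bij_betw (twist V) (carrier V) (carrier V)"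
  by (simp add: hom_space_def)

lemma untwist_closed [simp]: "hs V \<Longrightarrow> x \<in> carrier V \<Longrightarrow> untwist V x \<in> carrier V"
  using hs_bij[of V] by (auto simp: untwist_def bij_betw_def intro: inv_into_into)

lemma twist_untwist [simp]: "hs V \<Longrightarrow> x \<in> carrier V \<Longrightarrow> twist V (untwist V x) = x"
  using hs_bij[of V] by (simp add: untwist_def bij_betw_def f_inv_into_f)

lemma untwist_twist [simp]: "hs V \<Longrightarrow> x \<in> carrier V \<Longrightarrow> untwist V (twist V x) = x"
  using hs_bij[of V] by (simp add: untwist_def bij_betw_def)

lemma twist_eq_iff: "hs V \<Longrightarrow> x \<in> carrier V \<Longrightarrow> y \<in> carrier V \<Longrightarrow> twist V x = twist V y \<longleftrightarrow> x = y"
  by (metis untwist_twist)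

lemma untwist_unique: "hs V \<Longrightarrow> y \<in> carrier V \<Longrightarrow> twist V y = x \<Longrightarrow> untwist V x = y"
  by auto

lemma lin_untwist: assumes "hs V" shows "lin V V (untwist V)"
  by (rule linI; use assms in \<open>auto intro!: untwist_unique simp: lin_add[OF lin_twist] lin_smult[OF lin_twist]\<close>)

lemma lin_twist_comp [simp]: "hs V \<Longrightarrow> lin U V f \<Longrightarrow> lin U V (\<lambda>x. twist V (f x))"
  by (rule lin_comp[OF lin_twist])

lemma lin_untwist_comp [simp]: "hs V \<Longrightarrow> lin U V f \<Longrightarrow> lin U V (\<lambda>x. untwist V (f x))"
  by (rule lin_comp[OF lin_untwist])

end


section \<open>Finite sums\<close>

lemma sum_over_Nil [simp]: "sum_over P [] b = \<zero>\<^bsub>P\<^esub>"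
  and sum_over_Cons [simp]: "sum_over P ((x, y) # xs) b = b x y \<oplus>\<^bsub>P\<^esub> sum_over P xs b"
  by (simp_all add: sum_over_def)

lemma sum_over_cong:
  "(\<And>x y. (x, y) \<in> set xs \<Longrightarrow> b x y = b' x y) \<Longrightarrow> sum_over P xs b = sum_over P xs b'"
  by (induction xs) auto

lemma sum_over_closed:
  assumes "abelian_group P" "\<And>x y. (x, y) \<in> set xs \<Longrightarrow> b x y \<in> carrier P"
  shows "sum_over P xs b \<in> carrier P"
proof -
  interpret P: abelian_group P by fact
  show ?thesis using assms(2) by (induction xs) auto
qed

lemma sum_over_zero: "abelian_group P \<Longrightarrow> sum_over P xs (\<lambda>x y. \<zero>\<^bsub>P\<^esub>) = \<zero>\<^bsub>P\<^esub>"
proof -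
  assume "abelian_group P"
  then interpret P: abelian_group P .
  show ?thesis by (induction xs) auto
qed

lemma sum_over_append:
  assumes "abelian_group P" "\<And>x y. (x, y) \<in> set xs \<union> set ys \<Longrightarrow> b x y \<in> carrier P"
  shows "sum_over P (xs @ ys) b = sum_over P xs b \<oplus>\<^bsub>P\<^esub> sum_over P ys b"
proof -
  interpret P: abelian_group P by fact
  have c: "sum_over P ys b \<in> carrier P" using assms by (auto intro: sum_over_closed)
  have "sum_over P xs b \<in> carrier P \<and> ?thesis"
    using assms(2)
  proof (induction xs)
    case (Cons p xs)
    then show ?case using c by (cases p) (auto simp: P.a_assoc)
  qed (use c in simp)
  then show ?thesis ..
qed

lemma sum_over_add:
  assumes "abelian_group P" "\<And>x y. (x, y) \<in> set xs \<Longrightarrow> b x y \<in> carrier P"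
    "\<And>x y. (x, y) \<in> set xs \<Longrightarrow> b' x y \<in> carrier P"
  shows "sum_over P xs (\<lambda>x y. b x y \<oplus>\<^bsub>P\<^esub> b' x y) = sum_over P xs b \<oplus>\<^bsub>P\<^esub> sum_over P xs b'"
proof -
  interpret P: abelian_group P by fact
  show ?thesis using assms(2,3)
  proof (induction xs)
    case (Cons p xs)
    have "sum_over P xs b \<in> carrier P" "sum_over P xs b' \<in> carrier P"
      using Cons.prems by (auto intro!: sum_over_closed assms(1))
    with Cons show ?case by (cases p) (auto simp: P.a_ac)
  qed auto
qed

lemma sum_over_hom:
  assumes "f \<zero>\<^bsub>P\<^esub> = \<zero>\<^bsub>Q\<^esub>" "\<And>x y. x \<in> carrier P \<Longrightarrow> y \<in> carrier P \<Longrightarrow> f (x \<oplus>\<^bsub>P\<^esub> y) = f x \<oplus>\<^bsub>Q\<^esub> f y"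
    "abelian_group P" "\<And>x y. (x, y) \<in> set xs \<Longrightarrow> b x y \<in> carrier P"
  shows "f (sum_over P xs b) = sum_over Q xs (\<lambda>x y. f (b x y))"
  using assms(4)
proof (induction xs)
  case (Cons p xs)
  then show ?case
    using sum_over_closed[OF assms(3), of xs b] by (cases p) (auto simp: assms(2))
qed (simp add: assms(1))

lemma sum_over_swap:
  assumes "abelian_group P" "\<And>x y u v. (x, y) \<in> set xs \<Longrightarrow> (u, v) \<in> set us \<Longrightarrow> b x y u v \<in> carrier P"
  shows "sum_over P xs (\<lambda>x y. sum_over P us (b x y)) =
    sum_over P us (\<lambda>u v. sum_over P xs (\<lambda>x y. b x y u v))"
proof -
  interpret P: abelian_group P by fact
  show ?thesis using assms(2)
  proof (induction xs)
    case (Cons p xs)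
    obtain x y where p: "p = (x, y)" by (cases p)
    have "sum_over P us (\<lambda>u v. b x y u v \<oplus>\<^bsub>P\<^esub> sum_over P xs (\<lambda>x y. b x y u v)) =
        sum_over P us (b x y) \<oplus>\<^bsub>P\<^esub> sum_over P us (\<lambda>u v. sum_over P xs (\<lambda>x y. b x y u v))"
      using Cons.prems by (intro sum_over_add) (auto simp: p intro!: sum_over_closed assms(1))
    then show ?case using Cons by (auto simp: p)
  qed (simp add: sum_over_zero[OF assms(1)])
qed

lemma sum_over_map: "sum_over P (map (\<lambda>(x, y). (f x y, g x y)) xs) b = sum_over P xs (\<lambda>x y. b (f x y) (g x y))"
  by (induction xs) auto


section \<open>Tensor products\<close>

text \<open>Each generating relation of the congruence holds for the values of a balanced biadditive
  map; this is the universal property on the level of formal sums. It is needed for maps into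
  abelian groups, because the tensor product is not yet known to be a vector space.\<close>

lemma tensor_eq_sum_over:
  assumes eq: "tensor_eq K M N xs ys" and P: "abelian_group P" and K: "field K"
    and MN: "Module.module K M" "Module.module K N"
    and cl: "\<And>m n. m \<in> carrier M \<Longrightarrow> n \<in> carrier N \<Longrightarrow> b m n \<in> carrier P"
    and addl: "\<And>m m' n. m \<in> carrier M \<Longrightarrow> m' \<in> carrier M \<Longrightarrow> n \<in> carrier N \<Longrightarrow>
        b (m \<oplus>\<^bsub>M\<^esub> m') n = b m n \<oplus>\<^bsub>P\<^esub> b m' n"
    and addr: "\<And>m n n'. m \<in> carrier M \<Longrightarrow> n \<in> carrier N \<Longrightarrow> n' \<in> carrier N \<Longrightarrow>
        b m (n \<oplus>\<^bsub>N\<^esub> n') = b m n \<oplus>\<^bsub>P\<^esub> b m n'"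
    and bal: "\<And>a m n. a \<in> carrier K \<Longrightarrow> m \<in> carrier M \<Longrightarrow> n \<in> carrier N \<Longrightarrow>
        b (a \<odot>\<^bsub>M\<^esub> m) n = b m (a \<odot>\<^bsub>N\<^esub> n)"
  shows "set xs \<subseteq> carrier M \<times> carrier N \<and> set ys \<subseteq> carrier M \<times> carrier N \<and>
    sum_over P xs b = sum_over P ys b"
proof -
  interpret P: abelian_group P by fact
  interpret M: Module.module K M by fact
  interpret N: Module.module K N by fact
  have ok: "sum_over P xs b \<in> carrier P" if "set xs \<subseteq> carrier M \<times> carrier N" for xs
    using that cl by (auto intro!: sum_over_closed P)
  have app: "sum_over P (xs @ ys) b = sum_over P xs b \<oplus>\<^bsub>P\<^esub> sum_over P ys b"
    if "set xs \<subseteq> carrier M \<times> carrier N" "set ys \<subseteq> carrier M \<times> carrier N" for xs ys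
    using that cl by (auto intro!: sum_over_append P)
  show ?thesis
    using eq
  proof induction
    case (append xs xs' ys ys')
    then show ?case by (simp add: app)
  next
    case (commute xs ys)
    then show ?case by (simp add: app P.a_comm ok)
  next
    case (zero n)
    \<comment> \<open>Biadditivity forces \<open>b 0 n = 0\<close>, by cancellation in the group \<open>P\<close>.\<close>
    have "b \<zero>\<^bsub>M\<^esub> n = b \<zero>\<^bsub>M\<^esub> n \<oplus>\<^bsub>P\<^esub> b \<zero>\<^bsub>M\<^esub> n"
      using addl[of "\<zero>\<^bsub>M\<^esub>" "\<zero>\<^bsub>M\<^esub>" n] zero by simp
    then have "b \<zero>\<^bsub>M\<^esub> n = \<zero>\<^bsub>P\<^esub>"
      using cl[of "\<zero>\<^bsub>M\<^esub>" n] zero by (metis M.M.zero_closed P.add.l_cancel_one')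
    then show ?case using zero by auto
  qed (use cl addl addr bal in auto)
qed

context ground_field
begin

text \<open>Pure tensors as a constant of their own: \<open>pure_tensor\<close> abbreviates the class of a
  one-element list, in which the linearity in the two factors is not visible.\<close>

definition pt :: "('k, 'u::infinite, 'x) module_scheme \<Rightarrow> ('k, 'u, 'y) module_scheme \<Rightarrow> 'u \<Rightarrow> 'u \<Rightarrow> 'u"
  where "pt M N m n = pure_tensor K M N m n"

text \<open>\<open>sw U V P t b\<close> is \<open>sweedler P t b\<close> for \<open>t \<in> U \<otimes> V\<close>. As \<open>U\<close> and \<open>V\<close> can be read off from the
  term and illegal arguments are replaced by \<open>0\<close>, the equations below can be used for
  rewriting.\<close>

definition sw :: "('k, 'u::infinite, 'x) hom_space_scheme \<Rightarrow> ('k, 'u, 'y) hom_space_scheme \<Rightarrow>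
    ('k, 'u, 'z) hom_space_scheme \<Rightarrow> 'u \<Rightarrow> ('u \<Rightarrow> 'u \<Rightarrow> 'u) \<Rightarrow> 'u"
  where "sw U V P t b = sum_over P (summands t)
    (\<lambda>x y. if x \<in> carrier U \<and> y \<in> carrier V \<and> b x y \<in> carrier P then b x y else \<zero>\<^bsub>P\<^esub>)"

lemma sw_cong [cong]:
  assumes "t = t'" "\<And>x y. x \<in> carrier U \<Longrightarrow> y \<in> carrier V \<Longrightarrow> b x y = b' x y"
  shows "sw U V P t b = sw U V P t' b'"
  unfolding sw_def assms(1) by (rule sum_over_cong) (auto simp: assms(2))

lemma sw_closed [simp]: "hs P \<Longrightarrow> sw U V P t b \<in> carrier P"
  unfolding sw_def by (rule sum_over_closed) (auto simp: hs_abelian_group)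

text \<open>The order of two independent Sweedler sums is immaterial. Both sides have the same shape, so
  that rewriting needs instances in which the spaces (or the tensors) fix which sum is outermost.\<close>

lemma sw_swap:
  assumes P: "hs P"
  shows "sw U V P s (\<lambda>x y. sw U' V' P t (\<lambda>u v. b x y u v)) =
    sw U' V' P t (\<lambda>u v. sw U V P s (\<lambda>x y. b x y u v))"
proof -
  have "sw U V P s (\<lambda>x y. sw U' V' P t (\<lambda>u v. b x y u v)) =
    sum_over P (summands s) (\<lambda>x y. sum_over P (summands t) (\<lambda>u v.
      if x \<in> carrier U \<and> y \<in> carrier V \<and> u \<in> carrier U' \<and> v \<in> carrier V' \<and> b x y u v \<in> carrier P
      then b x y u v else \<zero>\<^bsub>P\<^esub>))" for U V U' V' s t b
  proof -
    note z = sum_over_zero[OF hs_abelian_group[OF P]]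
    show ?thesis
      using sw_closed[OF P, of U' V' t "b x y" for x y]
      by (simp add: sw_def z if_distrib if_distribR cong: if_cong)
         (auto intro!: sum_over_cong simp: z)
  qed
  note 1 = this
  show ?thesis
    unfolding 1 by (subst sum_over_swap) (use P in \<open>auto intro!: sum_over_cong simp: hs_abelian_group\<close>)
qed

end

context
  fixes K :: "'k ring" and M :: "('k, 'u::infinite, 'x) module_scheme"
    and N :: "('k, 'u, 'y) module_scheme"
  assumes K: "field K" and M: "Module.module K M" and N: "Module.module K N"
begin

lemma tensor_eq_closed:
  assumes "tensor_eq K M N xs ys"
  shows "set xs \<subseteq> carrier M \<times> carrier N" "set ys \<subseteq> carrier M \<times> carrier N"
proof -
  interpret M: Module.module K M by (rule M)
  interpret N: Module.module K N by (rule N)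
  have "set xs \<subseteq> carrier M \<times> carrier N \<and> set ys \<subseteq> carrier M \<times> carrier N"
    using assms by induction auto
  then show "set xs \<subseteq> carrier M \<times> carrier N" "set ys \<subseteq> carrier M \<times> carrier N" by auto
qed

lemma tensor_eq_some:
  "set xs \<subseteq> carrier M \<times> carrier N \<Longrightarrow> tensor_eq K M N xs (SOME ys. tensor_eq K M N xs ys)"
  by (rule someI) (rule tensor_eq.refl)

lemma summands_tensor_class:
  "summands (tensor_class K M N xs) = (SOME ys. tensor_eq K M N xs ys)"
  by (simp add: summands_def tensor_class_def inv_f_f[OF inj_code])

lemma tensor_eq_summands:
  "set xs \<subseteq> carrier M \<times> carrier N \<Longrightarrow> tensor_eq K M N xs (summands (tensor_class K M N xs))"
  by (simp add: summands_tensor_class tensor_eq_some)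

lemma tensor_class_eqI: "tensor_eq K M N xs ys \<Longrightarrow> tensor_class K M N xs = tensor_class K M N ys"
proof -
  assume *: "tensor_eq K M N xs ys"
  have "tensor_eq K M N xs = tensor_eq K M N ys"
    using * tensor_eq.sym tensor_eq.trans by blast
  then show ?thesis by (simp add: tensor_class_def)
qed

lemma tensor_class_summands:
  "set xs \<subseteq> carrier M \<times> carrier N \<Longrightarrow>
    tensor_class K M N (summands (tensor_class K M N xs)) = tensor_class K M N xs"
  by (metis tensor_class_eqI tensor_eq_summands)

lemma summands_closed:
  "set xs \<subseteq> carrier M \<times> carrier N \<Longrightarrow>
    set (summands (tensor_class K M N xs)) \<subseteq> carrier M \<times> carrier N"
  using tensor_eq_closed tensor_eq_summands by blast

end

lemma tensor_simps [simp]: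
  "\<zero>\<^bsub>tensor K M N\<^esub> = tensor_class K M N []"
  "\<one>\<^bsub>tensor K M N\<^esub> = pure_tensor K M N \<one>\<^bsub>M\<^esub> \<one>\<^bsub>N\<^esub>"
  by (simp_all add: tensor_def)

context ground_field
begin

context
  fixes M :: "('k, 'u::infinite, 'x) hom_space_scheme"
    and N :: "('k, 'u, 'y) hom_space_scheme"
  assumes hsM: "hs M" and hsN: "hs N"
begin

interpretation M: Module.module K M by (rule hs_module[OF hsM])
interpretation N: Module.module K N by (rule hs_module[OF hsN])

private abbreviation "ok xs \<equiv> set xs \<subseteq> carrier M \<times> carrier N"
private abbreviation "T \<equiv> tensor_class K M N"

private lemmas tensor_facts = tensor_eq_closed[OF field_K hs_module[OF hsM] hs_module[OF hsN]]
  tensor_class_eqI[OF field_K hs_module[OF hsM] hs_module[OF hsN]]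
  tensor_class_summands[OF field_K hs_module[OF hsM] hs_module[OF hsN]]
  summands_closed[OF field_K hs_module[OF hsM] hs_module[OF hsN]]

lemma tensor_class_in [simp]: "ok xs \<Longrightarrow> T xs \<in> carrier (M \<^bold>\<otimes> N)"
  by (auto simp: tensor_def)

lemma tensor_class_add: "ok xs \<Longrightarrow> ok ys \<Longrightarrow> T xs \<oplus>\<^bsub>M \<^bold>\<otimes> N\<^esub> T ys = T (xs @ ys)"
  by (auto simp: tensor_def intro!: tensor_facts(3)
      tensor_eq.append[OF tensor_eq.sym tensor_eq.sym]
      tensor_eq_summands[OF field_K hs_module[OF hsM] hs_module[OF hsN]] field_K hs_module hsM hsN)

lemma tensor_cases:
  assumes "t \<in> carrier (M \<^bold>\<otimes> N)"
  obtains xs where "ok xs" "t = T xs" "summands t = xs"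
  using assms that[of "summands t"] tensor_facts(4,5) by (auto simp: tensor_def)

text \<open>Associativity and commutativity are those of concatenation modulo the congruence. The
  inverse of a formal sum is obtained by negating all left factors.\<close>

lemma tensor_abelian_group: "abelian_group (M \<^bold>\<otimes> N)"
proof (rule abelian_groupI)
  fix x y z assume "x \<in> carrier (M \<^bold>\<otimes> N)" "y \<in> carrier (M \<^bold>\<otimes> N)" "z \<in> carrier (M \<^bold>\<otimes> N)"
  then obtain xs ys zs where "x = T xs" "y = T ys" "z = T zs" "ok xs" "ok ys" "ok zs"
    by (metis tensor_cases)
  then show "x \<oplus>\<^bsub>M \<^bold>\<otimes> N\<^esub> y \<oplus>\<^bsub>M \<^bold>\<otimes> N\<^esub> z = x \<oplus>\<^bsub>M \<^bold>\<otimes> N\<^esub> (y \<oplus>\<^bsub>M \<^bold>\<otimes> N\<^esub> z)"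
    by (simp add: tensor_class_add)
next
  fix x y assume "x \<in> carrier (M \<^bold>\<otimes> N)" "y \<in> carrier (M \<^bold>\<otimes> N)"
  then obtain xs ys where *: "x = T xs" "y = T ys" "ok xs" "ok ys"
    by (metis tensor_cases)
  then show "x \<oplus>\<^bsub>M \<^bold>\<otimes> N\<^esub> y \<in> carrier (M \<^bold>\<otimes> N)"
    by (simp add: tensor_class_add)
  show "x \<oplus>\<^bsub>M \<^bold>\<otimes> N\<^esub> y = y \<oplus>\<^bsub>M \<^bold>\<otimes> N\<^esub> x"
    using * by (auto simp: tensor_class_add intro!: tensor_facts(3) tensor_eq.commute)
next
  show "\<zero>\<^bsub>M \<^bold>\<otimes> N\<^esub> \<in> carrier (M \<^bold>\<otimes> N)" by simp
next
  fix x assume "x \<in> carrier (M \<^bold>\<otimes> N)"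
  then obtain xs where *: "x = T xs" "ok xs" by (metis tensor_cases)
  then show "\<zero>\<^bsub>M \<^bold>\<otimes> N\<^esub> \<oplus>\<^bsub>M \<^bold>\<otimes> N\<^esub> x = x" by (simp add: tensor_class_add)
  define n where "n = map (\<lambda>(m, n). (\<ominus>\<^bsub>M\<^esub> m, n)) xs"
  have "ok n \<and> tensor_eq K M N (n @ xs) []"
    using *(2) unfolding n_def
  proof (induction xs)
    case Nil
    then show ?case by (simp add: tensor_eq.refl)
  next
    case (Cons p xs)
    obtain a b where p: "p = (a, b)" by (cases p)
    have ab: "a \<in> carrier M" "b \<in> carrier N" "ok xs" using Cons.prems p by auto
    let ?n = "map (\<lambda>(m, n). (\<ominus>\<^bsub>M\<^esub> m, n)) xs"
    have 1: "ok ?n" "tensor_eq K M N (?n @ xs) []" using Cons by auto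
    have "tensor_eq K M N [(\<ominus>\<^bsub>M\<^esub> a \<oplus>\<^bsub>M\<^esub> a, b)] [(\<ominus>\<^bsub>M\<^esub> a, b), (a, b)]"
      using ab by (intro tensor_eq.add_left) auto
    then have "tensor_eq K M N [(\<zero>\<^bsub>M\<^esub>, b)] [(\<ominus>\<^bsub>M\<^esub> a, b), (a, b)]"
      using ab by (simp add: M.M.l_neg)
    then have 2: "tensor_eq K M N [(\<ominus>\<^bsub>M\<^esub> a, b), (a, b)] []"
      using tensor_eq.zero[of b N K M] ab tensor_eq.sym tensor_eq.trans by metis
    have "tensor_eq K M N ([(\<ominus>\<^bsub>M\<^esub> a, b)] @ (?n @ [(a, b)]) @ xs) ([(\<ominus>\<^bsub>M\<^esub> a, b)] @ ([(a, b)] @ ?n) @ xs)"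
      using ab 1(1) by (intro tensor_eq.append tensor_eq.refl tensor_eq.commute) auto
    then have 3: "tensor_eq K M N ((\<ominus>\<^bsub>M\<^esub> a, b) # ?n @ (a, b) # xs) ([(\<ominus>\<^bsub>M\<^esub> a, b), (a, b)] @ (?n @ xs))"
      by simp
    have "tensor_eq K M N ([(\<ominus>\<^bsub>M\<^esub> a, b), (a, b)] @ (?n @ xs)) ([] @ [])"
      using 1 2 by (intro tensor_eq.append)
    from tensor_eq.trans[OF 3 this]
    have "tensor_eq K M N ((\<ominus>\<^bsub>M\<^esub> a, b) # ?n @ (a, b) # xs) []" by simp
    then show ?case using 1(1) ab p by auto
  qed
  then have n: "ok n" "T (n @ xs) = T []" by (auto intro!: tensor_facts(3))
  then have "T n \<oplus>\<^bsub>M \<^bold>\<otimes> N\<^esub> x = \<zero>\<^bsub>M \<^bold>\<otimes> N\<^esub>" using * by (simp add: tensor_class_add)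
  then show "\<exists>y\<in>carrier (M \<^bold>\<otimes> N). y \<oplus>\<^bsub>M \<^bold>\<otimes> N\<^esub> x = \<zero>\<^bsub>M \<^bold>\<otimes> N\<^esub>"
    using n(1) by (intro bexI[of _ "T n"]) auto
qed

interpretation MN: abelian_group "M \<^bold>\<otimes> N" by (rule tensor_abelian_group)

lemma pt_closed [simp]: "m \<in> carrier M \<Longrightarrow> n \<in> carrier N \<Longrightarrow> pt M N m n \<in> carrier (M \<^bold>\<otimes> N)"
  by (simp add: pt_def)

lemma tensor_class_sum: "ok xs \<Longrightarrow> T xs = sum_over (M \<^bold>\<otimes> N) xs (pt M N)"
proof (induction xs)
  case (Cons p xs)
  obtain m n where p: "p = (m, n)" by (cases p)
  have "T ([p] @ xs) = T [p] \<oplus>\<^bsub>M \<^bold>\<otimes> N\<^esub> T xs"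
    using Cons.prems by (subst tensor_class_add) auto
  then show ?case using Cons by (simp add: p pt_def)
qed simp

lemma pt_add_left: "m \<in> carrier M \<Longrightarrow> m' \<in> carrier M \<Longrightarrow> n \<in> carrier N \<Longrightarrow>
    pt M N (m \<oplus>\<^bsub>M\<^esub> m') n = pt M N m n \<oplus>\<^bsub>M \<^bold>\<otimes> N\<^esub> pt M N m' n"
  by (simp add: pt_def tensor_class_add tensor_facts(3)[OF tensor_eq.add_left])

lemma pt_add_right: "m \<in> carrier M \<Longrightarrow> n \<in> carrier N \<Longrightarrow> n' \<in> carrier N \<Longrightarrow>
    pt M N m (n \<oplus>\<^bsub>N\<^esub> n') = pt M N m n \<oplus>\<^bsub>M \<^bold>\<otimes> N\<^esub> pt M N m n'"
  by (simp add: pt_def tensor_class_add tensor_facts(3)[OF tensor_eq.add_right])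

lemma pt_balanced: "a \<in> carrier K \<Longrightarrow> m \<in> carrier M \<Longrightarrow> n \<in> carrier N \<Longrightarrow>
    pt M N (a \<odot>\<^bsub>M\<^esub> m) n = pt M N m (a \<odot>\<^bsub>N\<^esub> n)"
  by (simp add: pt_def tensor_facts(3)[OF tensor_eq.scalar])

lemma sweedler_tensor_class:
  assumes P: "abelian_group P"
    and cl: "\<And>m n. m \<in> carrier M \<Longrightarrow> n \<in> carrier N \<Longrightarrow> b m n \<in> carrier P"
    and "\<And>m m' n. m \<in> carrier M \<Longrightarrow> m' \<in> carrier M \<Longrightarrow> n \<in> carrier N \<Longrightarrow>
        b (m \<oplus>\<^bsub>M\<^esub> m') n = b m n \<oplus>\<^bsub>P\<^esub> b m' n"
    and "\<And>m n n'. m \<in> carrier M \<Longrightarrow> n \<in> carrier N \<Longrightarrow> n' \<in> carrier N \<Longrightarrow>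
        b m (n \<oplus>\<^bsub>N\<^esub> n') = b m n \<oplus>\<^bsub>P\<^esub> b m n'"
    and "\<And>a m n. a \<in> carrier K \<Longrightarrow> m \<in> carrier M \<Longrightarrow> n \<in> carrier N \<Longrightarrow>
        b (a \<odot>\<^bsub>M\<^esub> m) n = b m (a \<odot>\<^bsub>N\<^esub> n)"
    and xs: "ok xs"
  shows "sweedler P (T xs) b = sum_over P xs b"
  using tensor_eq_sum_over[OF tensor_eq_summands[OF field_K M.module_axioms N.module_axioms xs] P
      field_K M.module_axioms N.module_axioms assms(2-5)]
  by (simp add: sweedler_def)

lemma tensor_smult_sweedler:
  "t \<in> carrier (M \<^bold>\<otimes> N) \<Longrightarrow> a \<in> carrier K \<Longrightarrow>
    a \<odot>\<^bsub>M \<^bold>\<otimes> N\<^esub> t = sweedler (M \<^bold>\<otimes> N) t (\<lambda>m n. pt M N (a \<odot>\<^bsub>M\<^esub> m) n)"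
proof (erule tensor_cases)
  fix xs assume a: "a \<in> carrier K" and xs: "ok xs" "t = T xs" "summands t = xs"
  have ok: "ok (map (\<lambda>(m, n). (a \<odot>\<^bsub>M\<^esub> m, n)) xs)" using xs(1) a by auto
  have "a \<odot>\<^bsub>M \<^bold>\<otimes> N\<^esub> t = T (map (\<lambda>(m, n). (a \<odot>\<^bsub>M\<^esub> m, n)) xs)"
    by (simp add: tensor_def xs(3))
  also have "\<dots> = sum_over (M \<^bold>\<otimes> N) xs (\<lambda>m n. pt M N (a \<odot>\<^bsub>M\<^esub> m) n)"
    by (simp only: tensor_class_sum[OF ok] sum_over_map)
  finally show ?thesis by (simp add: sweedler_def xs(3))
qed

lemma tensor_twist_sweedler:
  "t \<in> carrier (M \<^bold>\<otimes> N) \<Longrightarrow>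
    twist (M \<^bold>\<otimes> N) t = sweedler (M \<^bold>\<otimes> N) t (\<lambda>m n. pt M N (twist M m) (twist N n))"
proof (erule tensor_cases)
  fix xs assume xs: "ok xs" "t = T xs" "summands t = xs"
  have ok: "ok (map (\<lambda>(m, n). (twist M m, twist N n)) xs)" using xs(1) hsM hsN by auto
  have "twist (M \<^bold>\<otimes> N) t = T (map (\<lambda>(m, n). (twist M m, twist N n)) xs)"
    by (simp add: tensor_def xs(3))
  also have "\<dots> = sum_over (M \<^bold>\<otimes> N) xs (\<lambda>m n. pt M N (twist M m) (twist N n))"
    by (simp only: tensor_class_sum[OF ok] sum_over_map)
  finally show ?thesis by (simp add: sweedler_def xs(3))
qed

text \<open>Scalar multiplication is defined through the chosen representative of a tensor. Any formal sum
  that represents it may be used instead, because \<open>(m, n) \<mapsto> a m \<otimes> n\<close> is balanced.\<close>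

lemma tensor_smult_sum:
  assumes "a \<in> carrier K" "ok xs"
  shows "a \<odot>\<^bsub>M \<^bold>\<otimes> N\<^esub> T xs = sum_over (M \<^bold>\<otimes> N) xs (\<lambda>m n. pt M N (a \<odot>\<^bsub>M\<^esub> m) n)"
proof -
  have "sweedler (M \<^bold>\<otimes> N) (T xs) (\<lambda>m n. pt M N (a \<odot>\<^bsub>M\<^esub> m) n) =
      sum_over (M \<^bold>\<otimes> N) xs (\<lambda>m n. pt M N (a \<odot>\<^bsub>M\<^esub> m) n)"
    using assms
    by (intro sweedler_tensor_class tensor_abelian_group)
       (simp_all add: pt_add_left pt_add_right M.smult_r_distr pt_balanced smult_commute[OF hsM]
           smult_commute[OF hsN]
         flip: pt_balanced)
  then show ?thesis using assms by (simp add: tensor_smult_sweedler)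
qed

lemma tensor_class_smult:
  assumes "a \<in> carrier K" "ok xs"
  shows "a \<odot>\<^bsub>M \<^bold>\<otimes> N\<^esub> T xs = T (map (\<lambda>(m, n). (a \<odot>\<^bsub>M\<^esub> m, n)) xs)"
proof -
  have ok: "ok (map (\<lambda>(m, n). (a \<odot>\<^bsub>M\<^esub> m, n)) xs)" using assms by auto
  show ?thesis by (simp only: tensor_smult_sum[OF assms] tensor_class_sum[OF ok] sum_over_map)
qed

lemma pt_smult_left: "a \<in> carrier K \<Longrightarrow> m \<in> carrier M \<Longrightarrow> n \<in> carrier N \<Longrightarrow>
    pt M N (a \<odot>\<^bsub>M\<^esub> m) n = a \<odot>\<^bsub>M \<^bold>\<otimes> N\<^esub> pt M N m n"
  by (simp add: pt_def tensor_class_smult)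

lemma pt_smult_right: "a \<in> carrier K \<Longrightarrow> m \<in> carrier M \<Longrightarrow> n \<in> carrier N \<Longrightarrow>
    pt M N m (a \<odot>\<^bsub>N\<^esub> n) = a \<odot>\<^bsub>M \<^bold>\<otimes> N\<^esub> pt M N m n"
  by (simp add: pt_smult_left flip: pt_balanced)

lemma tensor_module: "Module.module K (M \<^bold>\<otimes> N)"
proof -
  note sm = tensor_smult_sum and sm' = tensor_class_smult and ag = tensor_abelian_group
  show ?thesis
  proof (rule Module.moduleI)
    show "cring K" by (rule K.is_cring)
    show "abelian_group (M \<^bold>\<otimes> N)" by (rule ag)
  next
    fix a t assume "a \<in> carrier K" "t \<in> carrier (M \<^bold>\<otimes> N)"
    then obtain xs where xs: "ok xs" "t = T xs" "a \<in> carrier K" using tensor_cases by metis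
    then have "ok (map (\<lambda>(m, n). (a \<odot>\<^bsub>M\<^esub> m, n)) xs)" by auto
    then show "a \<odot>\<^bsub>M \<^bold>\<otimes> N\<^esub> t \<in> carrier (M \<^bold>\<otimes> N)"
      using xs tensor_class_in by (simp only: sm')
  next
    fix a b t assume ab: "a \<in> carrier K" "b \<in> carrier K" and "t \<in> carrier (M \<^bold>\<otimes> N)"
    then obtain xs where xs: "ok xs" "t = T xs" using tensor_cases by metis
    have "(a \<oplus>\<^bsub>K\<^esub> b) \<odot>\<^bsub>M \<^bold>\<otimes> N\<^esub> T xs = sum_over (M \<^bold>\<otimes> N) xs
        (\<lambda>m n. pt M N (a \<odot>\<^bsub>M\<^esub> m) n \<oplus>\<^bsub>M \<^bold>\<otimes> N\<^esub> pt M N (b \<odot>\<^bsub>M\<^esub> m) n)"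
      using ab xs by (auto simp: sm M.smult_l_distr pt_add_left intro!: sum_over_cong)
    also have "\<dots> = a \<odot>\<^bsub>M \<^bold>\<otimes> N\<^esub> T xs \<oplus>\<^bsub>M \<^bold>\<otimes> N\<^esub> b \<odot>\<^bsub>M \<^bold>\<otimes> N\<^esub> T xs"
      using ab xs by (subst sum_over_add) (auto simp: sm ag)
    finally show "(a \<oplus>\<^bsub>K\<^esub> b) \<odot>\<^bsub>M \<^bold>\<otimes> N\<^esub> t = a \<odot>\<^bsub>M \<^bold>\<otimes> N\<^esub> t \<oplus>\<^bsub>M \<^bold>\<otimes> N\<^esub> b \<odot>\<^bsub>M \<^bold>\<otimes> N\<^esub> t"
      using xs by simp
    have ok: "ok (map (\<lambda>(m, n). (b \<odot>\<^bsub>M\<^esub> m, n)) xs)" using ab xs by auto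
    have "a \<odot>\<^bsub>M \<^bold>\<otimes> N\<^esub> (b \<odot>\<^bsub>M \<^bold>\<otimes> N\<^esub> T xs) =
        sum_over (M \<^bold>\<otimes> N) xs (\<lambda>m n. pt M N (a \<odot>\<^bsub>M\<^esub> (b \<odot>\<^bsub>M\<^esub> m)) n)"
      using ab xs by (simp only: sm'[OF ab(2) xs(1)] sm[OF ab(1) ok] sum_over_map)
    also have "\<dots> = (a \<otimes>\<^bsub>K\<^esub> b) \<odot>\<^bsub>M \<^bold>\<otimes> N\<^esub> T xs"
      using ab xs by (auto simp: sm M.smult_assoc1 intro!: sum_over_cong)
    finally show "(a \<otimes>\<^bsub>K\<^esub> b) \<odot>\<^bsub>M \<^bold>\<otimes> N\<^esub> t = a \<odot>\<^bsub>M \<^bold>\<otimes> N\<^esub> (b \<odot>\<^bsub>M \<^bold>\<otimes> N\<^esub> t)"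
      using xs by simp
  next
    fix a s t assume a: "a \<in> carrier K" and "s \<in> carrier (M \<^bold>\<otimes> N)" "t \<in> carrier (M \<^bold>\<otimes> N)"
    then obtain xs ys where xs: "ok xs" "s = T xs" "ok ys" "t = T ys" using tensor_cases by metis
    have "ok (map (\<lambda>(m, n). (a \<odot>\<^bsub>M\<^esub> m, n)) xs)" "ok (map (\<lambda>(m, n). (a \<odot>\<^bsub>M\<^esub> m, n)) ys)"
      using a xs by auto
    then show "a \<odot>\<^bsub>M \<^bold>\<otimes> N\<^esub> (s \<oplus>\<^bsub>M \<^bold>\<otimes> N\<^esub> t) = a \<odot>\<^bsub>M \<^bold>\<otimes> N\<^esub> s \<oplus>\<^bsub>M \<^bold>\<otimes> N\<^esub> a \<odot>\<^bsub>M \<^bold>\<otimes> N\<^esub> t"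
      using a xs by (simp add: tensor_class_add sm')
  next
    fix t assume "t \<in> carrier (M \<^bold>\<otimes> N)"
    then obtain xs where xs: "ok xs" "t = T xs" using tensor_cases by metis
    moreover have "map (\<lambda>(m, n). (\<one>\<^bsub>K\<^esub> \<odot>\<^bsub>M\<^esub> m, n)) xs = xs"
      using xs(1) by (intro map_idI) auto
    ultimately show "\<one>\<^bsub>K\<^esub> \<odot>\<^bsub>M \<^bold>\<otimes> N\<^esub> t = t" by (simp add: sm')
  qed
qed

end


section \<open>Sweedler sums\<close>

text \<open>If \<open>b\<close> has values in \<open>P\<close>, then the case in which \<open>sw\<close> uses the value \<open>0\<close> does not occur.\<close>

lemma sweedler_sw:
  assumes "hs U" "hs V" "t \<in> carrier (U \<^bold>\<otimes> V)"
    and "\<And>x y. x \<in> carrier U \<Longrightarrow> y \<in> carrier V \<Longrightarrow> b x y \<in> carrier P"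
  shows "sweedler P t b = sw U V P t b"
  by (rule tensor_cases[OF assms(1-3)])
     (use assms(4) in \<open>auto simp: sweedler_def sw_def intro!: sum_over_cong\<close>)

lemma sw_tensor_class:
  assumes hs: "hs U" "hs V" "hs P"
    and b: "\<And>x. x \<in> carrier U \<Longrightarrow> lin V P (b x)" "\<And>y. y \<in> carrier V \<Longrightarrow> lin U P (\<lambda>x. b x y)"
    and xs: "set xs \<subseteq> carrier U \<times> carrier V"
  shows "sw U V P (tensor_class K U V xs) b = sum_over P xs b"
proof -
  have "sweedler P (tensor_class K U V xs) b = sum_over P xs b"
    by (intro sweedler_tensor_class hs hs_abelian_group xs)
       (simp_all add: lin_closed[OF b(1)] lin_add[OF b(1)] lin_add[OF b(2)]
          lin_smult[OF b(1)] lin_smult[OF b(2)])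
  then show ?thesis
    by (subst sweedler_sw[symmetric]) (use hs xs in \<open>simp_all add: lin_closed[OF b(1)]\<close>)
qed

text \<open>The universal property: a bilinear map \<open>b\<close> extends to a linear map on the tensor product.\<close>

lemma sw_lin:
  assumes hs: "hs U" "hs V" "hs P"
    and b: "\<And>x. x \<in> carrier U \<Longrightarrow> lin V P (b x)" "\<And>y. y \<in> carrier V \<Longrightarrow> lin U P (\<lambda>x. b x y)"
  shows "lin (U \<^bold>\<otimes> V) P (\<lambda>t. sw U V P t b)"
proof (rule linI)
  interpret P: Module.module K P by (rule hs_module[OF hs(3)])
  interpret U: Module.module K U by (rule hs_module[OF hs(1)])
  interpret T: Module.module K "U \<^bold>\<otimes> V" by (rule tensor_module[OF hs(1,2)])
  note closed = lin_closed[OF b(1)] and ag = hs_abelian_group[OF hs(3)]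
  note tc = sw_tensor_class[OF hs b]
  show "sw U V P x b \<in> carrier P" for x using hs by simp
  fix s t assume "s \<in> carrier (U \<^bold>\<otimes> V)" "t \<in> carrier (U \<^bold>\<otimes> V)"
  then obtain xs ys where xs: "s = tensor_class K U V xs" "set xs \<subseteq> carrier U \<times> carrier V"
    and ys: "t = tensor_class K U V ys" "set ys \<subseteq> carrier U \<times> carrier V"
    using tensor_cases[OF hs(1,2)] by metis
  have "sw U V P (s \<oplus>\<^bsub>U \<^bold>\<otimes> V\<^esub> t) b = sum_over P (xs @ ys) b"
    using xs ys hs by (simp add: tensor_class_add tc)
  also have "\<dots> = sw U V P s b \<oplus>\<^bsub>P\<^esub> sw U V P t b"
    using xs ys closed by (auto simp: tc intro!: sum_over_append ag)
  finally show "sw U V P (s \<oplus>\<^bsub>U \<^bold>\<otimes> V\<^esub> t) b = sw U V P s b \<oplus>\<^bsub>P\<^esub> sw U V P t b" .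
next
  interpret P: Module.module K P by (rule hs_module[OF hs(3)])
  interpret U: Module.module K U by (rule hs_module[OF hs(1)])
  note closed = lin_closed[OF b(1)] and ag = hs_abelian_group[OF hs(3)]
  note tc = sw_tensor_class[OF hs b]
  fix a t assume a: "a \<in> carrier K" and t: "t \<in> carrier (U \<^bold>\<otimes> V)"
  then obtain xs where xs: "t = tensor_class K U V xs" "set xs \<subseteq> carrier U \<times> carrier V"
    using tensor_cases[OF hs(1,2)] by metis
  have ok: "set (map (\<lambda>(m, n). (a \<odot>\<^bsub>U\<^esub> m, n)) xs) \<subseteq> carrier U \<times> carrier V"
    using a xs by auto
  have "a \<odot>\<^bsub>U \<^bold>\<otimes> V\<^esub> t = tensor_class K U V (map (\<lambda>(m, n). (a \<odot>\<^bsub>U\<^esub> m, n)) xs)"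
    using a xs hs by (simp add: tensor_class_smult)
  then have "sw U V P (a \<odot>\<^bsub>U \<^bold>\<otimes> V\<^esub> t) b = sum_over P xs (\<lambda>x y. b (a \<odot>\<^bsub>U\<^esub> x) y)"
    by (simp add: tc ok sum_over_map del: set_map)
  also have "\<dots> = sum_over P xs (\<lambda>x y. a \<odot>\<^bsub>P\<^esub> b x y)"
    using xs a by (auto intro!: sum_over_cong lin_smult[OF b(2)])
  also have "\<dots> = a \<odot>\<^bsub>P\<^esub> sum_over P xs b"
    using xs a closed
    by (intro sum_over_hom[symmetric, where f = "\<lambda>x. a \<odot>\<^bsub>P\<^esub> x"]) (auto simp: P.smult_r_distr ag)
  finally show "sw U V P (a \<odot>\<^bsub>U \<^bold>\<otimes> V\<^esub> t) b = a \<odot>\<^bsub>P\<^esub> sw U V P t b"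
    using xs by (simp add: tc)
qed

lemma sw_pt [simp]:
  assumes hs: "hs U" "hs V" "hs P"
    and b: "\<And>x. x \<in> carrier U \<Longrightarrow> lin V P (b x)" "\<And>y. y \<in> carrier V \<Longrightarrow> lin U P (\<lambda>x. b x y)"
    and "x \<in> carrier U" "y \<in> carrier V"
  shows "sw U V P (pt U V x y) b = b x y"
proof -
  interpret P: Module.module K P by (rule hs_module[OF hs(3)])
  show ?thesis
    unfolding pt_def using assms(6,7) sw_tensor_class[OF hs b, of "[(x, y)]"] lin_closed[OF b(1)] by simp
qed

lemma sw_body_lin [simp]:
  assumes "hs P" "\<And>x y. x \<in> carrier U \<Longrightarrow> y \<in> carrier V \<Longrightarrow> lin W P (\<lambda>z. b z x y)"
  shows "lin W P (\<lambda>z. sw U V P t (b z))"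
proof (rule linI)
  interpret P: Module.module K P by (rule hs_module[OF assms(1)])
  note ag = hs_abelian_group[OF assms(1)]
  show "sw U V P t (b z) \<in> carrier P" for z using assms(1) by simp
  have closed: "b z x y \<in> carrier P" if "x \<in> carrier U" "y \<in> carrier V" "z \<in> carrier W" for x y z
    using lin_closed[OF assms(2)] that .
  show "sw U V P t (b (z \<oplus>\<^bsub>W\<^esub> z')) = sw U V P t (b z) \<oplus>\<^bsub>P\<^esub> sw U V P t (b z')"
    if z: "z \<in> carrier W" "z' \<in> carrier W" for z z'
    unfolding sw_def
    by (subst sum_over_add[OF ag, symmetric])
       (use z in \<open>auto intro!: sum_over_cong simp: lin_add[OF assms(2)] closed\<close>)
  show "sw U V P t (b (a \<odot>\<^bsub>W\<^esub> z)) = a \<odot>\<^bsub>P\<^esub> sw U V P t (b z)"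
    if z: "a \<in> carrier K" "z \<in> carrier W" for a z
    unfolding sw_def
    by (subst sum_over_hom[where f = "\<lambda>x. a \<odot>\<^bsub>P\<^esub> x" and Q = P])
       (use z in \<open>auto intro!: sum_over_cong simp: lin_smult[OF assms(2)] closed P.smult_r_distr ag\<close>)
qed

lemma lin_sw:
  assumes "lin P Q f" "hs P" "hs Q"
    and "\<And>x y. x \<in> carrier U \<Longrightarrow> y \<in> carrier V \<Longrightarrow> b x y \<in> carrier P"
  shows "f (sw U V P t b) = sw U V Q t (\<lambda>x y. f (b x y))"
  unfolding sw_def
  by (subst sum_over_hom[where f = f and Q = Q])
     (auto intro!: sum_over_cong lin_zero[OF assms(2,3,1)] lin_add[OF assms(1)] hs_abelian_group
        assms(2,4) lin_closed[OF assms(1)] hs_closed)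

lemma pt_lin_right: "hs U \<Longrightarrow> hs V \<Longrightarrow> x \<in> carrier U \<Longrightarrow> lin V (U \<^bold>\<otimes> V) (pt U V x)"
  by (rule linI) (auto simp: pt_add_right pt_smult_right)

lemma pt_lin_left: "hs U \<Longrightarrow> hs V \<Longrightarrow> y \<in> carrier V \<Longrightarrow> lin U (U \<^bold>\<otimes> V) (\<lambda>x. pt U V x y)"
  by (rule linI) (auto simp: pt_add_left pt_smult_left)

lemma sw_pt_eq:
  assumes "hs U" "hs V" "t \<in> carrier (U \<^bold>\<otimes> V)"
  shows "sweedler (U \<^bold>\<otimes> V) t (pt U V) = t"
  by (rule tensor_cases[OF assms]) (use assms in \<open>auto simp: sweedler_def tensor_class_sum\<close>)

text \<open>The main tool for proving identities: pure tensors generate the tensor product.\<close>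

lemma tensor_ext:
  assumes f: "lin (U \<^bold>\<otimes> V) P f" and g: "lin (U \<^bold>\<otimes> V) P g" and hs: "hs U" "hs V" "hs P"
    and fg: "\<And>x y. x \<in> carrier U \<Longrightarrow> y \<in> carrier V \<Longrightarrow> f (pt U V x y) = g (pt U V x y)"
    and t: "t \<in> carrier (U \<^bold>\<otimes> V)"
  shows "f t = g t"
proof -
  interpret P: Module.module K P by (rule hs_module[OF hs(3)])
  interpret T: Module.module K "U \<^bold>\<otimes> V" by (rule tensor_module[OF hs(1,2)])
  have z: "f \<zero>\<^bsub>U \<^bold>\<otimes> V\<^esub> = \<zero>\<^bsub>P\<^esub>" if "lin (U \<^bold>\<otimes> V) P f" for f
    using lin_smult[OF that, of "\<zero>\<^bsub>K\<^esub>" "\<zero>\<^bsub>U \<^bold>\<otimes> V\<^esub>"] lin_closed[OF that, of "\<zero>\<^bsub>U \<^bold>\<otimes> V\<^esub>"]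
    by (simp del: tensor_simps)
  obtain xs where xs: "set xs \<subseteq> carrier U \<times> carrier V" "t = tensor_class K U V xs"
    using tensor_cases[OF hs(1,2) t] by metis
  have *: "f t = sum_over P xs (\<lambda>x y. f (pt U V x y))" if "lin (U \<^bold>\<otimes> V) P f" for f
    unfolding xs(2) tensor_class_sum[OF hs(1,2) xs(1)]
    by (rule sum_over_hom[OF z[OF that] lin_add[OF that] tensor_abelian_group[OF hs(1,2)]])
       (use xs hs in auto)
  show ?thesis
    unfolding *[OF f] *[OF g] using xs by (auto intro!: sum_over_cong fg)
qed

lemma sweedler_map_class:
  assumes hs: "hs U" "hs V" and f: "lin U U f" and g: "lin V V g"
    and xs: "set xs \<subseteq> carrier U \<times> carrier V"
  shows "sweedler (U \<^bold>\<otimes> V) (tensor_class K U V xs) (\<lambda>x y. pt U V (f x) (g y)) =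
    tensor_class K U V (map (\<lambda>(x, y). (f x, g y)) xs)"
proof -
  have ok: "set (map (\<lambda>(x, y). (f x, g y)) xs) \<subseteq> carrier U \<times> carrier V"
    using xs lin_closed[OF f] lin_closed[OF g] by auto
  have "sweedler (U \<^bold>\<otimes> V) (tensor_class K U V xs) (\<lambda>x y. pt U V (f x) (g y)) =
      sum_over (U \<^bold>\<otimes> V) xs (\<lambda>x y. pt U V (f x) (g y))"
    by (intro sweedler_tensor_class hs tensor_abelian_group xs)
       (simp_all add: hs lin_closed[OF f] lin_closed[OF g] pt_add_left pt_add_right pt_balanced
          lin_add[OF f] lin_add[OF g] lin_smult[OF f] lin_smult[OF g])
  then show ?thesis by (simp only: tensor_class_sum[OF hs ok] sum_over_map)
qed

text \<open>The structure map \<open>\<alpha> \<otimes> \<alpha>\<close> is bijective with inverse \<open>\<alpha>\<^sup>-\<^sup>1 \<otimes> \<alpha>\<^sup>-\<^sup>1\<close>. Formal sums are used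
  here because the universal property above is stated for spaces that already have a structure
  map.\<close>

lemma hs_tensor [simp]:
  assumes hs: "hs U" "hs V"
  shows "hs (U \<^bold>\<otimes> V)"
proof -
  let ?T = "tensor_class K U V"
  have tw: "twist (U \<^bold>\<otimes> V) (?T xs) = ?T (map (\<lambda>(x, y). (twist U x, twist V y)) xs)"
    if "set xs \<subseteq> carrier U \<times> carrier V" for xs
    using that by (simp add: tensor_twist_sweedler hs sweedler_map_class lin_twist)
  define u where "u t = sweedler (U \<^bold>\<otimes> V) t (\<lambda>x y. pt U V (untwist U x) (untwist V y))" for t
  have u: "u (?T xs) = ?T (map (\<lambda>(x, y). (untwist U x, untwist V y)) xs)"
    if "set xs \<subseteq> carrier U \<times> carrier V" for xs
    using that by (simp add: u_def hs sweedler_map_class lin_untwist)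
  have ok: "set (map (\<lambda>(x, y). (twist U x, twist V y)) xs) \<subseteq> carrier U \<times> carrier V"
    "set (map (\<lambda>(x, y). (untwist U x, untwist V y)) xs) \<subseteq> carrier U \<times> carrier V"
    if "set xs \<subseteq> carrier U \<times> carrier V" for xs
    using that hs by auto
  have id: "map ((\<lambda>(x, y). (twist U x, twist V y)) \<circ> (\<lambda>(x, y). (untwist U x, untwist V y))) xs = xs"
    "map ((\<lambda>(x, y). (untwist U x, untwist V y)) \<circ> (\<lambda>(x, y). (twist U x, twist V y))) xs = xs"
    if "set xs \<subseteq> carrier U \<times> carrier V" for xs
    using that hs by (auto intro!: map_idI)
  have lin: "lin (U \<^bold>\<otimes> V) (U \<^bold>\<otimes> V) (twist (U \<^bold>\<otimes> V))"
  proof (rule linI)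
    fix s t assume "s \<in> carrier (U \<^bold>\<otimes> V)" "t \<in> carrier (U \<^bold>\<otimes> V)"
    then obtain xs ys where xs: "s = ?T xs" "set xs \<subseteq> carrier U \<times> carrier V"
      and ys: "t = ?T ys" "set ys \<subseteq> carrier U \<times> carrier V"
      using tensor_cases[OF hs] by metis
    show "twist (U \<^bold>\<otimes> V) s \<in> carrier (U \<^bold>\<otimes> V)"
      using xs ok(1)[OF xs(2)] by (simp only: tw tensor_class_in[OF hs])
    have "set (xs @ ys) \<subseteq> carrier U \<times> carrier V" using xs ys by auto
    then show "twist (U \<^bold>\<otimes> V) (s \<oplus>\<^bsub>U \<^bold>\<otimes> V\<^esub> t) = twist (U \<^bold>\<otimes> V) s \<oplus>\<^bsub>U \<^bold>\<otimes> V\<^esub> twist (U \<^bold>\<otimes> V) t"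
      using xs ys ok(1)[OF xs(2)] ok(1)[OF ys(2)]
      by (simp only: tw tensor_class_add[OF hs] map_append)
  next
    fix a t assume a: "a \<in> carrier K" and "t \<in> carrier (U \<^bold>\<otimes> V)"
    then obtain xs where xs: "t = ?T xs" "set xs \<subseteq> carrier U \<times> carrier V"
      using tensor_cases[OF hs] by metis
    have ok': "set (map (\<lambda>(m, n). (a \<odot>\<^bsub>U\<^esub> m, n)) xs) \<subseteq> carrier U \<times> carrier V"
      using a xs hs by auto
    have "map (\<lambda>(x, y). (twist U x, twist V y)) (map (\<lambda>(m, n). (a \<odot>\<^bsub>U\<^esub> m, n)) xs) =
        map (\<lambda>(m, n). (a \<odot>\<^bsub>U\<^esub> m, n)) (map (\<lambda>(x, y). (twist U x, twist V y)) xs)"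
      using xs a by (auto simp: lin_smult[OF lin_twist[OF hs(1)]])
    then show "twist (U \<^bold>\<otimes> V) (a \<odot>\<^bsub>U \<^bold>\<otimes> V\<^esub> t) = a \<odot>\<^bsub>U \<^bold>\<otimes> V\<^esub> twist (U \<^bold>\<otimes> V) t"
      by (simp only: xs(1) tw[OF xs(2)] tensor_class_smult[OF hs a xs(2)] tw[OF ok']
          tensor_class_smult[OF hs a ok(1)[OF xs(2)]])
  qed
  have "bij_betw (twist (U \<^bold>\<otimes> V)) (carrier (U \<^bold>\<otimes> V)) (carrier (U \<^bold>\<otimes> V))"
  proof (rule bij_betw_byWitness[of _ u])
    have *: "twist (U \<^bold>\<otimes> V) (u t) = t \<and> u (twist (U \<^bold>\<otimes> V) t) = t \<and> u t \<in> carrier (U \<^bold>\<otimes> V)"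
      if "t \<in> carrier (U \<^bold>\<otimes> V)" for t
    proof -
      obtain xs where xs: "t = ?T xs" "set xs \<subseteq> carrier U \<times> carrier V"
        using tensor_cases[OF hs \<open>t \<in> carrier (U \<^bold>\<otimes> V)\<close>] by metis
      show ?thesis
        using ok[OF xs(2)] by (simp only: xs(1) u[OF xs(2)] tw[OF xs(2)] tw[OF ok(2)[OF xs(2)]]
          u[OF ok(1)[OF xs(2)]] map_map id[OF xs(2)] tensor_class_in[OF hs])
    qed
    then show "\<forall>t\<in>carrier (U \<^bold>\<otimes> V). u (twist (U \<^bold>\<otimes> V) t) = t"
      "\<forall>t\<in>carrier (U \<^bold>\<otimes> V). twist (U \<^bold>\<otimes> V) (u t) = t"
      "u ` carrier (U \<^bold>\<otimes> V) \<subseteq> carrier (U \<^bold>\<otimes> V)" by auto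
    show "twist (U \<^bold>\<otimes> V) ` carrier (U \<^bold>\<otimes> V) \<subseteq> carrier (U \<^bold>\<otimes> V)"
      using lin_closed[OF lin] by auto
  qed
  with lin tensor_module[OF hs] show ?thesis
    by (simp add: hom_space_def[of K "U \<^bold>\<otimes> V"] field_K)
qed

lemma pt_lin [simp]:
  assumes "hs U" "hs V"
  shows "lin W U f \<Longrightarrow> y \<in> carrier V \<Longrightarrow> lin W (U \<^bold>\<otimes> V) (\<lambda>x. pt U V (f x) y)"
    and "lin W V f \<Longrightarrow> y \<in> carrier U \<Longrightarrow> lin W (U \<^bold>\<otimes> V) (\<lambda>x. pt U V y (f x))"
  using assms by (auto intro: lin_comp[OF pt_lin_left] lin_comp[OF pt_lin_right])

lemma sw_tensor_eq [simp]:
  "hs U \<Longrightarrow> hs V \<Longrightarrow> t \<in> carrier (U \<^bold>\<otimes> V) \<Longrightarrow> sw U V (U \<^bold>\<otimes> V) t (pt U V) = t"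
  by (simp add: sweedler_sw[symmetric] sw_pt_eq)

lemma sw_lin_comp [simp]:
  assumes "hs U" "hs V" "hs P"
    and "\<And>x. x \<in> carrier U \<Longrightarrow> lin V P (b x)" "\<And>y. y \<in> carrier V \<Longrightarrow> lin U P (\<lambda>x. b x y)"
    and "lin W (U \<^bold>\<otimes> V) f"
  shows "lin W P (\<lambda>z. sw U V P (f z) b)"
  using assms by (intro lin_comp[OF sw_lin])

text \<open>Nested sums: a Sweedler sum over a tensor that is itself a Sweedler sum becomes an iterated
  sum, whose inner sum can then be evaluated on pure tensors.\<close>

lemma sw_sw [simp]:
  assumes "hs U" "hs V" "hs P"
    and "\<And>x. x \<in> carrier U \<Longrightarrow> lin V P (b x)" "\<And>y. y \<in> carrier V \<Longrightarrow> lin U P (\<lambda>x. b x y)"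
    and "\<And>x y. x \<in> carrier U' \<Longrightarrow> y \<in> carrier V' \<Longrightarrow> f x y \<in> carrier (U \<^bold>\<otimes> V)"
  shows "sw U V P (sw U' V' (U \<^bold>\<otimes> V) t f) b = sw U' V' P t (\<lambda>x y. sw U V P (f x y) b)"
  by (rule lin_sw[OF sw_lin]) (use assms in auto)

lemma pt_sw [simp]:
  assumes "hs U" "hs V"
  shows "(\<And>x y. x \<in> carrier U' \<Longrightarrow> y \<in> carrier V' \<Longrightarrow> f x y \<in> carrier U) \<Longrightarrow> z \<in> carrier V \<Longrightarrow>
      pt U V (sw U' V' U t f) z = sw U' V' (U \<^bold>\<otimes> V) t (\<lambda>x y. pt U V (f x y) z)"
    and "(\<And>x y. x \<in> carrier U' \<Longrightarrow> y \<in> carrier V' \<Longrightarrow> f x y \<in> carrier V) \<Longrightarrow> w \<in> carrier U \<Longrightarrow>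
      pt U V w (sw U' V' V t f) = sw U' V' (U \<^bold>\<otimes> V) t (\<lambda>x y. pt U V w (f x y))"
  by (rule lin_sw[OF pt_lin_left] lin_sw[OF pt_lin_right]; use assms in simp)+

lemma twist_sw [simp]:
  "hs P \<Longrightarrow> (\<And>x y. x \<in> carrier U \<Longrightarrow> y \<in> carrier V \<Longrightarrow> b x y \<in> carrier P) \<Longrightarrow>
    twist P (sw U V P t b) = sw U V P t (\<lambda>x y. twist P (b x y))"
  by (rule lin_sw[OF lin_twist]) auto

lemma untwist_sw [simp]:
  "hs P \<Longrightarrow> (\<And>x y. x \<in> carrier U \<Longrightarrow> y \<in> carrier V \<Longrightarrow> b x y \<in> carrier P) \<Longrightarrow>
    untwist P (sw U V P t b) = sw U V P t (\<lambda>x y. untwist P (b x y))"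
  by (rule lin_sw[OF lin_untwist]) auto

lemma tensor_twist:
  assumes "hs U" "hs V" "t \<in> carrier (U \<^bold>\<otimes> V)"
  shows "twist (U \<^bold>\<otimes> V) t = sw U V (U \<^bold>\<otimes> V) t (\<lambda>x y. pt U V (twist U x) (twist V y))"
  using assms by (simp add: tensor_twist_sweedler sweedler_sw)

lemma twist_pt [simp]:
  "hs U \<Longrightarrow> hs V \<Longrightarrow> x \<in> carrier U \<Longrightarrow> y \<in> carrier V \<Longrightarrow>
    twist (U \<^bold>\<otimes> V) (pt U V x y) = pt U V (twist U x) (twist V y)"
  by (simp add: tensor_twist)

lemma untwist_pt [simp]:
  "hs U \<Longrightarrow> hs V \<Longrightarrow> x \<in> carrier U \<Longrightarrow> y \<in> carrier V \<Longrightarrow>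
    untwist (U \<^bold>\<otimes> V) (pt U V x y) = pt U V (untwist U x) (untwist V y)"
  by (rule untwist_unique) auto

lemma smult_sw:
  "hs P \<Longrightarrow> a \<in> carrier K \<Longrightarrow> (\<And>x y. x \<in> carrier U \<Longrightarrow> y \<in> carrier V \<Longrightarrow> b x y \<in> carrier P) \<Longrightarrow>
    sw U V P t (\<lambda>x y. a \<odot>\<^bsub>P\<^esub> b x y) = a \<odot>\<^bsub>P\<^esub> sw U V P t b"
  by (rule lin_sw[symmetric]) auto

declare pt_smult_left [simp] pt_smult_right [simp] smult_sw [simp]

lemma twist_smult [simp]:
  "hs V \<Longrightarrow> a \<in> carrier K \<Longrightarrow> x \<in> carrier V \<Longrightarrow> twist V (a \<odot>\<^bsub>V\<^esub> x) = a \<odot>\<^bsub>V\<^esub> twist V x"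
  "hs V \<Longrightarrow> a \<in> carrier K \<Longrightarrow> x \<in> carrier V \<Longrightarrow> untwist V (a \<odot>\<^bsub>V\<^esub> x) = a \<odot>\<^bsub>V\<^esub> untwist V x"
  by (rule lin_smult[OF lin_twist] lin_smult[OF lin_untwist]; simp)+

lemma tensor_mult:
  assumes hs: "hs A" "hs B" and st: "s \<in> carrier (A \<^bold>\<otimes> B)" "t \<in> carrier (A \<^bold>\<otimes> B)"
    and cl: "\<And>x y. x \<in> carrier A \<Longrightarrow> y \<in> carrier A \<Longrightarrow> x \<otimes>\<^bsub>A\<^esub> y \<in> carrier A"
      "\<And>x y. x \<in> carrier B \<Longrightarrow> y \<in> carrier B \<Longrightarrow> x \<otimes>\<^bsub>B\<^esub> y \<in> carrier B"
  shows "s \<otimes>\<^bsub>A \<^bold>\<otimes> B\<^esub> t = sw A B (A \<^bold>\<otimes> B) s (\<lambda>a b. sw A B (A \<^bold>\<otimes> B) t (\<lambda>c d.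
    pt A B (a \<otimes>\<^bsub>A\<^esub> c) (b \<otimes>\<^bsub>B\<^esub> d)))"
proof -
  note ag = tensor_abelian_group[OF hs]
  obtain xs where xs: "summands s = xs" "set xs \<subseteq> carrier A \<times> carrier B"
    using tensor_cases[OF hs st(1)] by metis
  obtain ys where ys: "summands t = ys" "set ys \<subseteq> carrier A \<times> carrier B"
    using tensor_cases[OF hs st(2)] by metis
  let ?g = "\<lambda>xs. [(a \<otimes>\<^bsub>A\<^esub> c, b \<otimes>\<^bsub>B\<^esub> d). (a, b) \<leftarrow> xs, (c, d) \<leftarrow> ys]"
  have in_g: "set (?g xs) \<subseteq> carrier A \<times> carrier B" if "set xs \<subseteq> carrier A \<times> carrier B" for xs
    using that ys(2) by (auto intro!: cl)
  have "sum_over (A \<^bold>\<otimes> B) (?g xs) (pt A B) = sum_over (A \<^bold>\<otimes> B) xs (\<lambda>a b. sum_over (A \<^bold>\<otimes> B) ys (\<lambda>c d.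
      pt A B (a \<otimes>\<^bsub>A\<^esub> c) (b \<otimes>\<^bsub>B\<^esub> d)))"
    using xs(2)
  proof (induction xs)
    case (Cons p xs)
    obtain a b where p: "p = (a, b)" by (cases p)
    have "?g (p # xs) = map (\<lambda>(c, d). (a \<otimes>\<^bsub>A\<^esub> c, b \<otimes>\<^bsub>B\<^esub> d)) ys @ ?g xs" by (simp add: p)
    then have "sum_over (A \<^bold>\<otimes> B) (?g (p # xs)) (pt A B) =
        sum_over (A \<^bold>\<otimes> B) (map (\<lambda>(c, d). (a \<otimes>\<^bsub>A\<^esub> c, b \<otimes>\<^bsub>B\<^esub> d)) ys) (pt A B) \<oplus>\<^bsub>A \<^bold>\<otimes> B\<^esub>
        sum_over (A \<^bold>\<otimes> B) (?g xs) (pt A B)"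
      using Cons.prems ys(2) p by (simp only:, intro sum_over_append ag) (auto intro!: pt_closed hs cl)
    then show ?case using Cons by (simp add: p sum_over_map)
  qed simp
  moreover have "s \<otimes>\<^bsub>A \<^bold>\<otimes> B\<^esub> t = tensor_class K A B (?g xs)"
    unfolding tensor_def by (simp add: xs(1) ys(1))
  ultimately have "s \<otimes>\<^bsub>A \<^bold>\<otimes> B\<^esub> t = sweedler (A \<^bold>\<otimes> B) s (\<lambda>a b. sweedler (A \<^bold>\<otimes> B) t (\<lambda>c d.
      pt A B (a \<otimes>\<^bsub>A\<^esub> c) (b \<otimes>\<^bsub>B\<^esub> d)))"
    unfolding sweedler_def xs(1) ys(1) by (simp only: tensor_class_sum[OF hs in_g[OF xs(2)]])
  also have "\<dots> = sw A B (A \<^bold>\<otimes> B) s (\<lambda>a b. sweedler (A \<^bold>\<otimes> B) t (\<lambda>c d.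
      pt A B (a \<otimes>\<^bsub>A\<^esub> c) (b \<otimes>\<^bsub>B\<^esub> d)))"
    using hs st cl by (intro sweedler_sw) (auto simp: sweedler_sw)
  also have "\<dots> = sw A B (A \<^bold>\<otimes> B) s (\<lambda>a b. sw A B (A \<^bold>\<otimes> B) t (\<lambda>c d.
      pt A B (a \<otimes>\<^bsub>A\<^esub> c) (b \<otimes>\<^bsub>B\<^esub> d)))"
    using hs st cl by (intro sw_cong refl sweedler_sw) auto
  finally show ?thesis .
qed


section \<open>Bilinear operations and comodules\<close>

lemma lin_form_closed: "lin_form K V f \<Longrightarrow> x \<in> carrier V \<Longrightarrow> f x \<in> carrier K"
  by (auto simp: lin_form_def)

lemma sweedler_sw_cong:
  "hs U \<Longrightarrow> hs V \<Longrightarrow> hs P \<Longrightarrow> t \<in> carrier (U \<^bold>\<otimes> V) \<Longrightarrow>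
    (\<And>x y. x \<in> carrier U \<Longrightarrow> y \<in> carrier V \<Longrightarrow> b x y = b' x y \<and> b' x y \<in> carrier P) \<Longrightarrow>
    sweedler P t b = sw U V P t b'"
  by (subst sweedler_sw[where U=U and V=V]) auto

text \<open>What is needed of a bilinear operation in order to compute with it: linearity in both
  arguments (also after composition) and compatibility with Sweedler sums and scalars.\<close>

context
  fixes U :: "('k, 'u::infinite, 'x) hom_space_scheme" and V :: "('k, 'u, 'y) hom_space_scheme"
    and W :: "('k, 'u, 'z) hom_space_scheme" and b
  assumes b: "bilin_map K U V W b" and hs: "hs U" "hs V" "hs W"
begin

lemma bilin_lin1: "lin X U f \<Longrightarrow> y \<in> carrier V \<Longrightarrow> lin X W (\<lambda>x. b (f x) y)"
  using b by (auto simp: bilin_map_def intro: lin_comp[of _ _ "\<lambda>x. b x y"])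

lemma bilin_lin2: "lin X V f \<Longrightarrow> y \<in> carrier U \<Longrightarrow> lin X W (\<lambda>x. b y (f x))"
  using b by (auto simp: bilin_map_def intro: lin_comp[of _ _ "b y"])

lemma bilin_closed: "x \<in> carrier U \<Longrightarrow> y \<in> carrier V \<Longrightarrow> b x y \<in> carrier W"
  using lin_closed[OF bilin_lin1[OF lin_id]] .

lemma bilin_sw1: "(\<And>x y. x \<in> carrier U' \<Longrightarrow> y \<in> carrier V' \<Longrightarrow> f x y \<in> carrier U) \<Longrightarrow> z \<in> carrier V \<Longrightarrow>
    b (sw U' V' U t f) z = sw U' V' W t (\<lambda>x y. b (f x y) z)"
  by (rule lin_sw[OF bilin_lin1[OF lin_id] hs(1,3)])

lemma bilin_sw2: "(\<And>x y. x \<in> carrier U' \<Longrightarrow> y \<in> carrier V' \<Longrightarrow> f x y \<in> carrier V) \<Longrightarrow> z \<in> carrier U \<Longrightarrow>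
    b z (sw U' V' V t f) = sw U' V' W t (\<lambda>x y. b z (f x y))"
  by (rule lin_sw[OF bilin_lin2[OF lin_id] hs(2,3)])

lemma bilin_smult1: "a \<in> carrier K \<Longrightarrow> x \<in> carrier U \<Longrightarrow> y \<in> carrier V \<Longrightarrow>
    b (a \<odot>\<^bsub>U\<^esub> x) y = a \<odot>\<^bsub>W\<^esub> b x y"
  by (rule lin_smult[OF bilin_lin1[OF lin_id]])

lemma bilin_smult2: "a \<in> carrier K \<Longrightarrow> x \<in> carrier U \<Longrightarrow> y \<in> carrier V \<Longrightarrow>
    b x (a \<odot>\<^bsub>V\<^esub> y) = a \<odot>\<^bsub>W\<^esub> b x y"
  by (rule lin_smult[OF bilin_lin2[OF lin_id]])

end

lemmas bilin_rules = bilin_closed bilin_lin1 bilin_lin2 bilin_sw1 bilin_sw2 bilin_smult1 bilin_smult2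

lemma lin_untwist_commute:
  assumes "lin V W f" "hs V" "hs W"
    and tw: "\<And>x. x \<in> carrier V \<Longrightarrow> f (twist V x) = twist W (f x)"
    and x: "x \<in> carrier V"
  shows "f (untwist V x) = untwist W (f x)"
  using assms lin_closed[OF assms(1)]
  by (intro untwist_unique[symmetric]) (auto simp flip: tw)

lemma lin_rules:
  assumes f: "lin V W f" and hs: "hs V" "hs W"
  shows "lin X V g \<Longrightarrow> lin X W (\<lambda>x. f (g x))"
    and "x \<in> carrier V \<Longrightarrow> f x \<in> carrier W"
    and "(\<And>x y. x \<in> carrier U' \<Longrightarrow> y \<in> carrier V' \<Longrightarrow> h x y \<in> carrier V) \<Longrightarrow>
      f (sw U' V' V t h) = sw U' V' W t (\<lambda>x y. f (h x y))"
    and "a \<in> carrier K \<Longrightarrow> x \<in> carrier V \<Longrightarrow> f (a \<odot>\<^bsub>V\<^esub> x) = a \<odot>\<^bsub>W\<^esub> f x"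
  using lin_comp[OF f] lin_closed[OF f] lin_sw[OF f hs] lin_smult[OF f] by blast+

lemma comoduleD:
  assumes "right_hom_comodule K C M \<rho>"
  shows "hs M" "lin M (M \<^bold>\<otimes> C) \<rho>"
  using assms by (auto simp: right_hom_comodule_def)

lemma coalgebraD:
  assumes "hom_coalgebra K C"
  shows "hs C" "lin C (C \<^bold>\<otimes> C) (comult C)" "lin_form K C (counit C)"
    "\<And>c. c \<in> carrier C \<Longrightarrow> counit C (twist C c) = counit C c"
  using assms by (auto simp: hom_coalgebra_def)

lemma coalgebra_comodule:
  assumes "hom_coalgebra K C"
  shows "right_hom_comodule K C C (comult C)"
  using assms by (simp add: right_hom_comodule_def hom_coalgebra_def)

context
  fixes C :: "('k, 'u::infinite, 'x) hom_coalg_scheme" and M :: "('k, 'u, 'y) hom_space_scheme" and \<rho>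
  assumes C: "hom_coalgebra K C" and M: "right_hom_comodule K C M \<rho>"
begin

private lemma facts [simp]:
  "hs C" "hs M" "x \<in> carrier M \<Longrightarrow> \<rho> x \<in> carrier (M \<^bold>\<otimes> C)"
  "y \<in> carrier C \<Longrightarrow> comult C y \<in> carrier (C \<^bold>\<otimes> C)" "y \<in> carrier C \<Longrightarrow> counit C y \<in> carrier K"
  using coalgebraD[OF C] comoduleD[OF M] by (auto simp: lin_closed lin_form_closed)

lemma comodule_twist:
  assumes "m \<in> carrier M"
  shows "\<rho> (twist M m) = sw M C (M \<^bold>\<otimes> C) (\<rho> m) (\<lambda>x y. pt M C (twist M x) (twist C y))"
    and "\<rho> (untwist M m) = sw M C (M \<^bold>\<otimes> C) (\<rho> m) (\<lambda>x y. pt M C (untwist M x) (untwist C y))"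
proof -
  have *: "\<rho> (twist M m) = twist (M \<^bold>\<otimes> C) (\<rho> m)" if "m \<in> carrier M" for m
    using M that by (simp add: right_hom_comodule_def)
  then show "\<rho> (twist M m) = sw M C (M \<^bold>\<otimes> C) (\<rho> m) (\<lambda>x y. pt M C (twist M x) (twist C y))"
    using assms by (simp add: tensor_twist)
  have "\<rho> (untwist M m) = untwist (M \<^bold>\<otimes> C) (\<rho> m)"
    using assms by (intro lin_untwist_commute comoduleD[OF M]) (auto simp: *)
  also have "\<dots> = untwist (M \<^bold>\<otimes> C) (sw M C (M \<^bold>\<otimes> C) (\<rho> m) (pt M C))" using assms by simp
  also have "\<dots> = sw M C (M \<^bold>\<otimes> C) (\<rho> m) (\<lambda>x y. pt M C (untwist M x) (untwist C y))"
    using assms by (simp del: sw_tensor_eq)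
  finally show "\<rho> (untwist M m) = sw M C (M \<^bold>\<otimes> C) (\<rho> m) (\<lambda>x y. pt M C (untwist M x) (untwist C y))" .
qed

lemma comodule_counit:
  assumes "m \<in> carrier M" "hs P" "lin M P f"
  shows "sw M C P (\<rho> m) (\<lambda>x y. counit C y \<odot>\<^bsub>P\<^esub> f x) = f (twist M m)"
proof -
  have "twist M m = sweedler M (\<rho> m) (\<lambda>m0 m1. counit C m1 \<odot>\<^bsub>M\<^esub> m0)"
    using M assms(1) by (simp add: right_hom_comodule_def)
  also have "\<dots> = sw M C M (\<rho> m) (\<lambda>m0 m1. counit C m1 \<odot>\<^bsub>M\<^esub> m0)"
    by (rule sweedler_sw) (use assms in auto)
  finally show ?thesis
    using assms by (simp add: lin_rules[OF assms(3) _ assms(2)])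
qed

text \<open>The axiom compares two tensors with structure maps \<open>\<alpha>\<close> on some legs. In this form it holds
  for every trilinear \<open>b\<close>, and its left-hand side is free of structure maps, so that it always
  applies: splitting the first leg twice is replaced by splitting the second leg. It follows by
  applying to the axiom the linear map \<open>x \<otimes> y \<otimes> z \<mapsto> b(x, y, \<alpha>\<^sup>-\<^sup>1(z))\<close>.\<close>

lemma comodule_coassoc:
  assumes m: "m \<in> carrier M" and P: "hs P"
    and b: "\<And>y z. y \<in> carrier C \<Longrightarrow> z \<in> carrier C \<Longrightarrow> lin M P (\<lambda>x. b x y z)"
      "\<And>x z. x \<in> carrier M \<Longrightarrow> z \<in> carrier C \<Longrightarrow> lin C P (\<lambda>y. b x y z)"
      "\<And>x y. x \<in> carrier M \<Longrightarrow> y \<in> carrier C \<Longrightarrow> lin C P (\<lambda>z. b x y z)"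
  shows "sw M C P (\<rho> m) (\<lambda>m0 m1. sw M C P (\<rho> m0) (\<lambda>x y. b x y m1)) =
    sw M C P (\<rho> m) (\<lambda>m0 m1. sw C C P (comult C m1) (\<lambda>y z. b (twist M m0) y (untwist C z)))"
proof -
  let ?P = "M \<^bold>\<otimes> (C \<^bold>\<otimes> C)"
  have *: "sweedler ?P t f = sw M C ?P t f" if "t \<in> carrier (M \<^bold>\<otimes> C)"
      "\<And>x y. x \<in> carrier M \<Longrightarrow> y \<in> carrier C \<Longrightarrow> f x y \<in> carrier ?P" for t f
    using that by (intro sweedler_sw) auto
  have **: "sweedler ?P t f = sw C C ?P t f" if "t \<in> carrier (C \<^bold>\<otimes> C)"
      "\<And>x y. x \<in> carrier C \<Longrightarrow> y \<in> carrier C \<Longrightarrow> f x y \<in> carrier ?P" for t f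
    using that by (intro sweedler_sw) auto
  have "sweedler ?P (\<rho> m) (\<lambda>m0 m1. sweedler ?P (\<rho> m0) (\<lambda>x y. pt M (C \<^bold>\<otimes> C) x (pt C C y (twist C m1)))) =
      sweedler ?P (\<rho> m) (\<lambda>m0 m1. sweedler ?P (comult C m1) (\<lambda>y z. pt M (C \<^bold>\<otimes> C) (twist M m0) (pt C C y z)))"
    using M m by (simp add: right_hom_comodule_def pt_def Let_def)
  then have eq: "sw M C ?P (\<rho> m) (\<lambda>m0 m1. sw M C ?P (\<rho> m0) (\<lambda>x y. pt M (C \<^bold>\<otimes> C) x (pt C C y (twist C m1)))) =
      sw M C ?P (\<rho> m) (\<lambda>m0 m1. sw C C ?P (comult C m1) (\<lambda>y z. pt M (C \<^bold>\<otimes> C) (twist M m0) (pt C C y z)))"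
    using m by (simp add: * ** cong: sw_cong)
  define T where "T t = sw M (C \<^bold>\<otimes> C) P t (\<lambda>x yz. sw C C P yz (\<lambda>y z. b x y (untwist C z)))" for t
  have b': "lin C P (\<lambda>z. b x y (untwist C z))" if "x \<in> carrier M" "y \<in> carrier C" for x y
    by (rule lin_comp[OF b(3)]) (use that in \<open>auto intro: lin_untwist\<close>)
  have Tlin: "lin ?P P T"
    unfolding T_def by (rule sw_lin) (use b(1,2) b' P in auto)
  have T: "T (pt M (C \<^bold>\<otimes> C) x (pt C C y z)) = b x y (untwist C z)"
    if "x \<in> carrier M" "y \<in> carrier C" "z \<in> carrier C" for x y z
    unfolding T_def using that b(1,2) b' P by simp
  have "T (sw M C ?P (\<rho> m) (\<lambda>m0 m1. sw M C ?P (\<rho> m0) (\<lambda>x y. pt M (C \<^bold>\<otimes> C) x (pt C C y (twist C m1))))) =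
      T (sw M C ?P (\<rho> m) (\<lambda>m0 m1. sw C C ?P (comult C m1) (\<lambda>y z. pt M (C \<^bold>\<otimes> C) (twist M m0) (pt C C y z))))"
    by (simp only: eq)
  then show ?thesis
    using m P by (simp add: lin_rules[OF Tlin] T cong: sw_cong)
qed

end

text \<open>The axioms of a comodule with the spaces of all Sweedler sums made explicit.\<close>

lemma comoduleI:
  assumes C: "hom_coalgebra K C" and M: "hs M" "lin M (M \<^bold>\<otimes> C) \<rho>"
    and counit: "\<And>m. m \<in> carrier M \<Longrightarrow> sw M C M (\<rho> m) (\<lambda>x y. counit C y \<odot>\<^bsub>M\<^esub> x) = twist M m"
    and tw: "\<And>m. m \<in> carrier M \<Longrightarrow> \<rho> (twist M m) = twist (M \<^bold>\<otimes> C) (\<rho> m)"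
    and coassoc: "\<And>m. m \<in> carrier M \<Longrightarrow>
      sw M C (M \<^bold>\<otimes> (C \<^bold>\<otimes> C)) (\<rho> m) (\<lambda>m0 m1. sw M C (M \<^bold>\<otimes> (C \<^bold>\<otimes> C)) (\<rho> m0)
          (\<lambda>x y. pt M (C \<^bold>\<otimes> C) x (pt C C y (twist C m1)))) =
      sw M C (M \<^bold>\<otimes> (C \<^bold>\<otimes> C)) (\<rho> m) (\<lambda>m0 m1. sw C C (M \<^bold>\<otimes> (C \<^bold>\<otimes> C)) (comult C m1)
          (\<lambda>y z. pt M (C \<^bold>\<otimes> C) (twist M m0) (pt C C y z)))"
  shows "right_hom_comodule K C M \<rho>"
proof -
  let ?P = "M \<^bold>\<otimes> (C \<^bold>\<otimes> C)"
  note [simp] = coalgebraD(1)[OF C] lin_rules[OF M(2)] lin_rules[OF coalgebraD(2)[OF C]] M(1)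
    lin_form_closed[OF coalgebraD(3)[OF C]]
  have *: "sweedler ?P t f = sw M C ?P t f" if "t \<in> carrier (M \<^bold>\<otimes> C)"
      "\<And>x y. x \<in> carrier M \<Longrightarrow> y \<in> carrier C \<Longrightarrow> f x y \<in> carrier ?P" for t f
    using that by (intro sweedler_sw) auto
  have **: "sweedler ?P t f = sw C C ?P t f" if "t \<in> carrier (C \<^bold>\<otimes> C)"
      "\<And>x y. x \<in> carrier C \<Longrightarrow> y \<in> carrier C \<Longrightarrow> f x y \<in> carrier ?P" for t f
    using that by (intro sweedler_sw) auto
  have c: "sweedler M (\<rho> m) (\<lambda>x y. counit C y \<odot>\<^bsub>M\<^esub> x) = twist M m" if "m \<in> carrier M" for m
    using counit[OF that] that by (subst sweedler_sw) auto
  show ?thesis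
    unfolding right_hom_comodule_def Let_def
    using M tw coassoc by (simp add: c pt_def[symmetric] * ** cong: sw_cong)
qed


section \<open>Hom-algebras, modules and Hom-coalgebras\<close>

context
  fixes A :: "('k, 'u::infinite, 'x) hom_space_scheme"
  assumes A: "hom_algebra K A"
begin

lemma algebra_hs: "hs A" and algebra_bilin: "bilin_map K A A A (mult A)"
  and algebra_one: "\<one>\<^bsub>A\<^esub> \<in> carrier A" "twist A \<one>\<^bsub>A\<^esub> = \<one>\<^bsub>A\<^esub>"
  using A by (simp_all add: hom_algebra_def)

lemma algebra_one_untwist: "untwist A \<one>\<^bsub>A\<^esub> = \<one>\<^bsub>A\<^esub>"
  using untwist_twist[OF algebra_hs algebra_one(1)] algebra_one(2) by simp

lemma algebra_twist_mult: "a \<in> carrier A \<Longrightarrow> b \<in> carrier A \<Longrightarrow>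
    twist A (a \<otimes>\<^bsub>A\<^esub> b) = twist A a \<otimes>\<^bsub>A\<^esub> twist A b"
  using A by (simp add: hom_algebra_def)

lemma algebra_untwist_mult: "a \<in> carrier A \<Longrightarrow> b \<in> carrier A \<Longrightarrow>
    untwist A (a \<otimes>\<^bsub>A\<^esub> b) = untwist A a \<otimes>\<^bsub>A\<^esub> untwist A b"
  by (rule untwist_unique)
     (simp_all add: algebra_hs algebra_twist_mult
         bilin_closed[OF algebra_bilin algebra_hs algebra_hs algebra_hs])

lemma algebra_unit: "a \<in> carrier A \<Longrightarrow> \<one>\<^bsub>A\<^esub> \<otimes>\<^bsub>A\<^esub> a = twist A a"
  "a \<in> carrier A \<Longrightarrow> a \<otimes>\<^bsub>A\<^esub> \<one>\<^bsub>A\<^esub> = twist A a"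
  using A by (simp_all add: hom_algebra_def)

text \<open>Products, also those of the action below, are bracketed to the left, by solving
  Hom-associativity for \<open>a (b c)\<close>.\<close>

lemma algebra_assoc:
  assumes "a \<in> carrier A" "b \<in> carrier A" "c \<in> carrier A"
  shows "a \<otimes>\<^bsub>A\<^esub> (b \<otimes>\<^bsub>A\<^esub> c) = (untwist A a \<otimes>\<^bsub>A\<^esub> b) \<otimes>\<^bsub>A\<^esub> twist A c"
proof -
  have "\<forall>a\<in>carrier A. \<forall>b\<in>carrier A. \<forall>c\<in>carrier A.
      twist A a \<otimes>\<^bsub>A\<^esub> (b \<otimes>\<^bsub>A\<^esub> c) = (a \<otimes>\<^bsub>A\<^esub> b) \<otimes>\<^bsub>A\<^esub> twist A c"
    using A unfolding hom_algebra_def by blast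
  from this[rule_format, of "untwist A a" b c] show ?thesis using assms algebra_hs by simp
qed

lemmas algebra_rules = algebra_hs algebra_one algebra_one_untwist algebra_twist_mult
  algebra_untwist_mult algebra_unit algebra_assoc
  bilin_rules[OF algebra_bilin algebra_hs algebra_hs algebra_hs]

end

context
  fixes A :: "('k, 'u::infinite, 'x) hom_space_scheme"
    and M :: "('k, 'u, 'y) hom_space_scheme" and act
  assumes A: "hom_algebra K A" and M: "left_hom_module K A M act"
begin

lemma module_hs: "hs M" and module_bilin: "bilin_map K A M M act"
  using M by (simp_all add: left_hom_module_def)

lemma module_unit: "m \<in> carrier M \<Longrightarrow> act \<one>\<^bsub>A\<^esub> m = twist M m"
  using M by (simp add: left_hom_module_def)

lemma module_twist: "a \<in> carrier A \<Longrightarrow> m \<in> carrier M \<Longrightarrow> twist M (act a m) = act (twist A a) (twist M m)"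
  using M by (simp add: left_hom_module_def)

lemma module_untwist: "a \<in> carrier A \<Longrightarrow> m \<in> carrier M \<Longrightarrow>
    untwist M (act a m) = act (untwist A a) (untwist M m)"
  by (rule untwist_unique)
     (simp_all add: algebra_hs[OF A] module_hs module_twist
         bilin_closed[OF module_bilin algebra_hs[OF A] module_hs module_hs])

lemma module_assoc:
  assumes "a \<in> carrier A" "b \<in> carrier A" "m \<in> carrier M"
  shows "act a (act b m) = act (untwist A a \<otimes>\<^bsub>A\<^esub> b) (twist M m)"
proof -
  have "\<forall>a\<in>carrier A. \<forall>b\<in>carrier A. \<forall>m\<in>carrier M.
      act (twist A a) (act b m) = act (a \<otimes>\<^bsub>A\<^esub> b) (twist M m)"
    using M unfolding left_hom_module_def by blast
  from this[rule_format, of "untwist A a" b m] show ?thesis using assms algebra_hs[OF A] by simp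
qed

lemmas module_rules = module_unit module_twist module_untwist module_assoc
  bilin_rules[OF module_bilin algebra_hs[OF A] module_hs module_hs]

end

context
  fixes C :: "('k, 'u::infinite, 'x) hom_coalg_scheme"
  assumes C: "hom_coalgebra K C"
begin

lemma coalgebra_left_counit:
  assumes "c \<in> carrier C" "hs P" "lin C P f"
  shows "sw C C P (comult C c) (\<lambda>x y. counit C x \<odot>\<^bsub>P\<^esub> f y) = f (twist C c)"
proof -
  note [simp] = coalgebraD(1)[OF C] lin_rules[OF coalgebraD(2)[OF C]] lin_form_closed[OF coalgebraD(3)[OF C]]
  have "twist C c = sweedler C (comult C c) (\<lambda>x y. counit C x \<odot>\<^bsub>C\<^esub> y)"
    using C assms(1) unfolding hom_coalgebra_def by metis
  also have "\<dots> = sw C C C (comult C c) (\<lambda>x y. counit C x \<odot>\<^bsub>C\<^esub> y)"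
    by (rule sweedler_sw) (use assms in auto)
  finally show ?thesis
    using assms by (simp add: lin_rules[OF assms(3) _ assms(2)])
qed

lemma counit_untwist: "c \<in> carrier C \<Longrightarrow> counit C (untwist C c) = counit C c"
  using coalgebraD(4)[OF C, of "untwist C c"] coalgebraD(1)[OF C] by simp

lemmas coalgebra_rules = coalgebraD(1)[OF C] coalgebraD(4)[OF C] counit_untwist
  lin_form_closed[OF coalgebraD(3)[OF C]] lin_form_comp[OF coalgebraD(3)[OF C]]
  comodule_twist[OF C coalgebra_comodule[OF C]]
  comodule_counit[OF C coalgebra_comodule[OF C]] coalgebra_left_counit
  lin_rules[OF coalgebraD(2)[OF C] coalgebraD(1)[OF C] hs_tensor[OF coalgebraD(1)[OF C] coalgebraD(1)[OF C]]]

lemmas coalgebra_coassoc = comodule_coassoc[OF C coalgebra_comodule[OF C]]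

end

end


section \<open>Doi-Hopf data and their morphisms\<close>

locale dh_datum = ground_field K
  for K :: "'k ring" +
  fixes D :: "('k, 'u::infinite) doi_hopf"
  assumes datum: "doi_hopf_datum K D"
begin

abbreviation H where "H \<equiv> hopf D"
abbreviation A where "A \<equiv> alg D"
abbreviation C where "C \<equiv> coalg D"

lemma algebra_A: "hom_algebra K A" and algebra_H: "hom_algebra K H"
  and coalgebra_H: "hom_coalgebra K H" and coalgebra_C: "hom_coalgebra K C"
  and comodule_A: "right_hom_comodule K H A (alg_coact A)"
  and module_C: "left_hom_module K H C (coalg_act C)"
  using datum
  by (simp_all add: doi_hopf_datum_def comodule_algebra_def module_coalgebra_def
      hom_hopf_algebra_def hom_bialgebra_def)

lemmas [simp] = algebra_rules[OF algebra_A] algebra_rules[OF algebra_H]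
  coalgebra_rules[OF coalgebra_H] coalgebra_rules[OF coalgebra_C]
  module_rules[OF algebra_H module_C]

lemmas [simp] =
  comodule_twist[OF coalgebra_H comodule_A]
  comodule_counit[OF coalgebra_H comodule_A]
  lin_rules[OF comoduleD(2)[OF comodule_A] algebra_hs[OF algebra_A]
    hs_tensor[OF algebra_hs[OF algebra_A] algebra_hs[OF algebra_H]]]

lemmas coassoc = coalgebra_coassoc[OF coalgebra_H] coalgebra_coassoc[OF coalgebra_C]
  comodule_coassoc[OF coalgebra_H comodule_A]

lemma coact_mult [simp]:
  assumes "a \<in> carrier A" "b \<in> carrier A"
  shows "alg_coact A (a \<otimes>\<^bsub>A\<^esub> b) = sw A H (A \<^bold>\<otimes> H) (alg_coact A a) (\<lambda>a0 a1.
    sw A H (A \<^bold>\<otimes> H) (alg_coact A b) (\<lambda>b0 b1. pt A H (a0 \<otimes>\<^bsub>A\<^esub> b0) (a1 \<otimes>\<^bsub>H\<^esub> b1)))"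
proof -
  have "alg_coact A (a \<otimes>\<^bsub>A\<^esub> b) = alg_coact A a \<otimes>\<^bsub>A \<^bold>\<otimes> H\<^esub> alg_coact A b"
    using datum assms by (simp add: doi_hopf_datum_def comodule_algebra_def)
  then show ?thesis using assms by (simp add: tensor_mult)
qed

lemma coact_one [simp]: "alg_coact A \<one>\<^bsub>A\<^esub> = pt A H \<one>\<^bsub>A\<^esub> \<one>\<^bsub>H\<^esub>"
  using datum by (simp add: doi_hopf_datum_def comodule_algebra_def pt_def)

lemma coalg_act_comult [simp]:
  assumes "h \<in> carrier H" "c \<in> carrier C"
  shows "comult C (coalg_act C h c) = sw H H (C \<^bold>\<otimes> C) (comult H h) (\<lambda>h1 h2.
    sw C C (C \<^bold>\<otimes> C) (comult C c) (\<lambda>c1 c2. pt C C (coalg_act C h1 c1) (coalg_act C h2 c2)))"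
proof -
  have "comult C (coalg_act C h c) = sweedler (C \<^bold>\<otimes> C) (comult H h) (\<lambda>h1 h2.
      sweedler (C \<^bold>\<otimes> C) (comult C c) (\<lambda>c1 c2. pt C C (coalg_act C h1 c1) (coalg_act C h2 c2)))"
    using datum assms by (simp add: doi_hopf_datum_def module_coalgebra_def pt_def)
  also have "\<dots> = sw H H (C \<^bold>\<otimes> C) (comult H h) (\<lambda>h1 h2.
      sw C C (C \<^bold>\<otimes> C) (comult C c) (\<lambda>c1 c2. pt C C (coalg_act C h1 c1) (coalg_act C h2 c2)))"
    using assms by (intro sweedler_sw_cong) (auto simp: sweedler_sw[where U=C and V=C])
  finally show ?thesis .
qed

lemma coalg_act_counit [simp]:
  "h \<in> carrier H \<Longrightarrow> c \<in> carrier C \<Longrightarrow> counit C (coalg_act C h c) = counit H h \<otimes>\<^bsub>K\<^esub> counit C c"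
  using datum by (simp add: doi_hopf_datum_def module_coalgebra_def)

lemma smult_mult [simp]:
  "hs V \<Longrightarrow> a \<in> carrier K \<Longrightarrow> b \<in> carrier K \<Longrightarrow> x \<in> carrier V \<Longrightarrow>
    (a \<otimes>\<^bsub>K\<^esub> b) \<odot>\<^bsub>V\<^esub> x = a \<odot>\<^bsub>V\<^esub> (b \<odot>\<^bsub>V\<^esub> x)"
  by (simp add: smult_smult)

text \<open>The data of a Doi-Hopf module, unbundled: the action and the coaction are separate from the
  space, so that spaces with several structures, and subspaces and quotients of them, can be
  treated without forming records.\<close>

definition dh_struct :: "('k, 'u, 'x) hom_space_scheme \<Rightarrow> ('u \<Rightarrow> 'u \<Rightarrow> 'u) \<Rightarrow> ('u \<Rightarrow> 'u) \<Rightarrow> bool"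
  where "dh_struct M act \<rho> \<longleftrightarrow> left_hom_module K A M act \<and> right_hom_comodule K C M \<rho> \<and>
    (\<forall>a\<in>carrier A. \<forall>m\<in>carrier M. \<rho> (act a m) =
      sw A H (M \<^bold>\<otimes> C) (alg_coact A a) (\<lambda>a0 a1. sw M C (M \<^bold>\<otimes> C) (\<rho> m) (\<lambda>m0 m1.
        pt M C (act a0 m0) (coalg_act C a1 m1))))"

lemma doi_hopf_module_iff: "doi_hopf_module K D M \<longleftrightarrow> dh_struct M (mod_act M) (mod_coact M)"
proof -
  have "sweedler (M \<^bold>\<otimes> C) (alg_coact A a) (\<lambda>a0 a1. sweedler (M \<^bold>\<otimes> C) (mod_coact M m) (\<lambda>m0 m1.
      pt M C (mod_act M a0 m0) (coalg_act C a1 m1))) =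
    sw A H (M \<^bold>\<otimes> C) (alg_coact A a) (\<lambda>a0 a1. sw M C (M \<^bold>\<otimes> C) (mod_coact M m) (\<lambda>m0 m1.
        pt M C (mod_act M a0 m0) (coalg_act C a1 m1)))"
    if M: "left_hom_module K A M (mod_act M)" and c: "right_hom_comodule K C M (mod_coact M)"
      and a: "a \<in> carrier A" and m: "m \<in> carrier M" for a m
  proof -
    note [simp] = module_rules[OF algebra_A M] comoduleD(1)[OF c] lin_closed[OF comoduleD(2)[OF c]]
    show ?thesis
      using a m by (intro sweedler_sw_cong) (auto simp: sweedler_sw[where U=M and V=C])
  qed
  then show ?thesis
    by (auto simp: doi_hopf_module_def dh_struct_def pt_def)
qed

context
  fixes M :: "('k, 'u, 'x) hom_space_scheme" and act \<rho>
  assumes M: "dh_struct M act \<rho>"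
begin

lemma dh_module: "left_hom_module K A M act" and dh_comodule: "right_hom_comodule K C M \<rho>"
  using M by (simp_all add: dh_struct_def)

lemma dh_hs: "hs M" by (rule module_hs[OF algebra_A dh_module])

lemma dh_coact_act: "a \<in> carrier A \<Longrightarrow> m \<in> carrier M \<Longrightarrow> \<rho> (act a m) =
      sw A H (M \<^bold>\<otimes> C) (alg_coact A a) (\<lambda>a0 a1. sw M C (M \<^bold>\<otimes> C) (\<rho> m) (\<lambda>m0 m1.
        pt M C (act a0 m0) (coalg_act C a1 m1)))"
  using M by (simp add: dh_struct_def)

lemmas dh_rules = dh_hs module_rules[OF algebra_A dh_module]
  comodule_twist[OF coalgebra_C dh_comodule] comodule_counit[OF coalgebra_C dh_comodule]
  lin_rules[OF comoduleD(2)[OF dh_comodule] dh_hs hs_tensor[OF dh_hs coalgebraD(1)[OF coalgebra_C]]]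
  dh_coact_act

lemmas dh_coassoc = comodule_coassoc[OF coalgebra_C dh_comodule]

end

end

locale dh_morphism = ground_field K + D: dh_datum K D + D': dh_datum K D'
  for K :: "'k ring" and D D' :: "('k, 'u::infinite) doi_hopf" +
  fixes \<theta> \<beta> \<gamma> :: "'u \<Rightarrow> 'u"
  assumes morphism: "doi_hopf_map K D D' \<theta> \<beta> \<gamma>"
begin

lemma lin_\<theta>: "lin D.H D'.H \<theta>" and lin_\<beta>: "lin D.A D'.A \<beta>" and lin_\<gamma>: "lin D.C D'.C \<gamma>"
  using morphism
  by (simp_all add: doi_hopf_map_def hom_hopf_map_def hom_algebra_map_def hom_coalgebra_map_def)

lemmas [simp] =
  lin_rules[OF lin_\<theta> algebra_hs[OF D.algebra_H] algebra_hs[OF D'.algebra_H]]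
  lin_rules[OF lin_\<beta> algebra_hs[OF D.algebra_A] algebra_hs[OF D'.algebra_A]]
  lin_rules[OF lin_\<gamma> coalgebraD(1)[OF D.coalgebra_C] coalgebraD(1)[OF D'.coalgebra_C]]

text \<open>Compatibility of the three maps with the structures, oriented so that expressions have one
  normal form: structure maps move inside, a product of values becomes the value at a product,
  and \<open>\<gamma>\<close> moves inside the action.\<close>

lemma \<beta>_mult: "a \<in> carrier D.A \<Longrightarrow> b \<in> carrier D.A \<Longrightarrow> \<beta> a \<otimes>\<^bsub>D'.A\<^esub> \<beta> b = \<beta> (a \<otimes>\<^bsub>D.A\<^esub> b)"
  and \<beta>_one: "\<beta> \<one>\<^bsub>D.A\<^esub> = \<one>\<^bsub>D'.A\<^esub>"
  and \<theta>_mult: "g \<in> carrier D.H \<Longrightarrow> h \<in> carrier D.H \<Longrightarrow> \<theta> g \<otimes>\<^bsub>D'.H\<^esub> \<theta> h = \<theta> (g \<otimes>\<^bsub>D.H\<^esub> h)"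
  and \<gamma>_act: "h \<in> carrier D.H \<Longrightarrow> c \<in> carrier D.C \<Longrightarrow>
    \<gamma> (coalg_act D.C h c) = coalg_act D'.C (\<theta> h) (\<gamma> c)"
  and \<gamma>_counit: "c \<in> carrier D.C \<Longrightarrow> counit D'.C (\<gamma> c) = counit D.C c"
  using morphism
  by (simp_all add: doi_hopf_map_def hom_hopf_map_def hom_algebra_map_def hom_coalgebra_map_def)

lemma \<gamma>_comult_sweedler:
  "c \<in> carrier D.C \<Longrightarrow> comult D'.C (\<gamma> c) =
    sweedler (D'.C \<^bold>\<otimes> D'.C) (comult D.C c) (\<lambda>c1 c2. pt D'.C D'.C (\<gamma> c1) (\<gamma> c2))"
  and \<beta>_coact_sweedler:
  "a \<in> carrier D.A \<Longrightarrow> alg_coact D'.A (\<beta> a) =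
    sweedler (D'.A \<^bold>\<otimes> D'.H) (alg_coact D.A a) (\<lambda>a0 a1. pt D'.A D'.H (\<beta> a0) (\<theta> a1))"
  using morphism by (simp_all add: doi_hopf_map_def hom_coalgebra_map_def pt_def)

lemma twist_maps:
  "h \<in> carrier D.H \<Longrightarrow> twist D'.H (\<theta> h) = \<theta> (twist D.H h)"
  "a \<in> carrier D.A \<Longrightarrow> twist D'.A (\<beta> a) = \<beta> (twist D.A a)"
  "c \<in> carrier D.C \<Longrightarrow> twist D'.C (\<gamma> c) = \<gamma> (twist D.C c)"
  using morphism
  by (simp_all add: doi_hopf_map_def hom_hopf_map_def hom_algebra_map_def hom_coalgebra_map_def)

declare \<beta>_mult [simp] \<beta>_one [simp] \<theta>_mult [simp] \<gamma>_act [simp] \<gamma>_counit [simp] twist_maps [simp]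

lemma untwist_maps [simp]:
  "h \<in> carrier D.H \<Longrightarrow> untwist D'.H (\<theta> h) = \<theta> (untwist D.H h)"
  "a \<in> carrier D.A \<Longrightarrow> untwist D'.A (\<beta> a) = \<beta> (untwist D.A a)"
  "c \<in> carrier D.C \<Longrightarrow> untwist D'.C (\<gamma> c) = \<gamma> (untwist D.C c)"
  by (simp_all add: untwist_unique)

lemma \<gamma>_comult [simp]:
  "c \<in> carrier D.C \<Longrightarrow> comult D'.C (\<gamma> c) =
    sw D.C D.C (D'.C \<^bold>\<otimes> D'.C) (comult D.C c) (\<lambda>c1 c2. pt D'.C D'.C (\<gamma> c1) (\<gamma> c2))"
  by (simp add: \<gamma>_comult_sweedler sweedler_sw[where U=D.C and V=D.C])

lemma \<beta>_coact [simp]: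
  "a \<in> carrier D.A \<Longrightarrow> alg_coact D'.A (\<beta> a) =
    sw D.A D.H (D'.A \<^bold>\<otimes> D'.H) (alg_coact D.A a) (\<lambda>a0 a1. pt D'.A D'.H (\<beta> a0) (\<theta> a1))"
  by (simp add: \<beta>_coact_sweedler sweedler_sw[where U=D.A and V=D.H])

end


section \<open>Exactness of the tensor product over a field\<close>

context ground_field
begin

lemma subspaceI:
  assumes V: "Module.module K V" and W: "W \<subseteq> carrier V" "\<zero>\<^bsub>V\<^esub> \<in> W"
    "\<And>x y. x \<in> W \<Longrightarrow> y \<in> W \<Longrightarrow> x \<oplus>\<^bsub>V\<^esub> y \<in> W"
    "\<And>a x. a \<in> carrier K \<Longrightarrow> x \<in> W \<Longrightarrow> a \<odot>\<^bsub>V\<^esub> x \<in> W"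
  shows "submodule W K V"
proof -
  interpret V: Module.module K V by (rule V)
  show ?thesis
  proof (rule V.submoduleI)
    fix a assume a: "a \<in> W"
    then have "(\<ominus>\<^bsub>K\<^esub> \<one>\<^bsub>K\<^esub>) \<odot>\<^bsub>V\<^esub> a = \<ominus>\<^bsub>V\<^esub> a" using W(1) by (auto simp: V.smult_l_minus)
    then show "\<ominus>\<^bsub>V\<^esub> a \<in> W" using W(4)[of "\<ominus>\<^bsub>K\<^esub> \<one>\<^bsub>K\<^esub>" a] a by simp
  qed (use W in auto)
qed

lemma subspaceD:
  assumes V: "Module.module K V" and W: "submodule W K V"
  shows "W \<subseteq> carrier V" "\<zero>\<^bsub>V\<^esub> \<in> W"
    "x \<in> W \<Longrightarrow> y \<in> W \<Longrightarrow> x \<oplus>\<^bsub>V\<^esub> y \<in> W"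
    "a \<in> carrier K \<Longrightarrow> x \<in> W \<Longrightarrow> a \<odot>\<^bsub>V\<^esub> x \<in> W"
    "x \<in> W \<Longrightarrow> \<ominus>\<^bsub>V\<^esub> x \<in> W"
    "x \<in> W \<Longrightarrow> y \<in> W \<Longrightarrow> x \<ominus>\<^bsub>V\<^esub> y \<in> W"
proof -
  interpret V: Module.module K V by (rule V)
  interpret W: subgroup W "add_monoid V" by (rule submodule.axioms(1)[OF W])
  show "W \<subseteq> carrier V" "\<zero>\<^bsub>V\<^esub> \<in> W" using W.subset W.one_closed by auto
  note * = V.submoduleE(3-5)[OF W]
  show "x \<in> W \<Longrightarrow> y \<in> W \<Longrightarrow> x \<oplus>\<^bsub>V\<^esub> y \<in> W"
    "a \<in> carrier K \<Longrightarrow> x \<in> W \<Longrightarrow> a \<odot>\<^bsub>V\<^esub> x \<in> W" "x \<in> W \<Longrightarrow> \<ominus>\<^bsub>V\<^esub> x \<in> W"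
    "x \<in> W \<Longrightarrow> y \<in> W \<Longrightarrow> x \<ominus>\<^bsub>V\<^esub> y \<in> W"
    using * by (auto simp: a_minus_def)
qed

lemma eq_if_minus_zero:
  assumes "Module.module K V" "x \<in> carrier V" "y \<in> carrier V" "x \<ominus>\<^bsub>V\<^esub> y = \<zero>\<^bsub>V\<^esub>"
  shows "x = y"
proof -
  interpret V: Module.module K V by fact
  have "x = (x \<ominus>\<^bsub>V\<^esub> y) \<oplus>\<^bsub>V\<^esub> y"
    using assms(2,3) by (simp add: a_minus_def V.M.a_assoc V.M.l_neg)
  then show ?thesis using assms by simp
qed

text \<open>A subspace \<open>U\<close> that is maximal among those meeting \<open>W\<close> only in \<open>0\<close> is a complement of \<open>W\<close>:
  if \<open>v\<close> were not in \<open>U + W\<close>, then \<open>U + K v\<close> would still meet \<open>W\<close> only in \<open>0\<close>, since a relation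
  \<open>u + a v = w\<close> with \<open>a \<noteq> 0\<close> can be solved for \<open>v\<close>.\<close>

lemma exists_complement:
  assumes V: "Module.module K V" and W: "submodule W K V"
  obtains U where "submodule U K V" "U \<inter> W = {\<zero>\<^bsub>V\<^esub>}"
    "\<And>v. v \<in> carrier V \<Longrightarrow> \<exists>u\<in>U. \<exists>w\<in>W. v = u \<oplus>\<^bsub>V\<^esub> w"
proof -
  interpret V: Module.module K V by (rule V)
  note W' = subspaceD[OF V W]
  define S where "S = {U. submodule U K V \<and> U \<inter> W = {\<zero>\<^bsub>V\<^esub>}}"
  have "\<exists>U\<in>S. \<forall>X\<in>S. U \<subseteq> X \<longrightarrow> X = U"
  proof (rule subset_Zorn_nonempty)
    have "{\<zero>\<^bsub>V\<^esub>} \<in> S" unfolding S_def using W' by (auto intro!: subspaceI V)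
    then show "S \<noteq> {}" by auto
  next
    fix \<C> assume ne: "\<C> \<noteq> {}" and ch: "subset.chain S \<C>"
    have mem: "submodule U K V" "U \<inter> W = {\<zero>\<^bsub>V\<^esub>}" if "U \<in> \<C>" for U
      using ch that by (auto simp: subset.chain_def S_def)
    note memD = subspaceD[OF V mem(1)]
    have "submodule (\<Union>\<C>) K V"
    proof (rule subspaceI[OF V])
      show "\<Union>\<C> \<subseteq> carrier V" "\<zero>\<^bsub>V\<^esub> \<in> \<Union>\<C>" using memD(1,2) ne by blast+
      show "a \<odot>\<^bsub>V\<^esub> x \<in> \<Union>\<C>" if "a \<in> carrier K" "x \<in> \<Union>\<C>" for a x
        using that memD(4) by blast
      show "x \<oplus>\<^bsub>V\<^esub> y \<in> \<Union>\<C>" if xy: "x \<in> \<Union>\<C>" "y \<in> \<Union>\<C>" for x y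
      proof -
        obtain X Y where XY: "X \<in> \<C>" "Y \<in> \<C>" "x \<in> X" "y \<in> Y" using xy by auto
        then have "X \<subseteq> Y \<or> Y \<subseteq> X" using ch by (auto simp: subset.chain_def)
        then show ?thesis using XY memD(3) by blast
      qed
    qed
    moreover have "\<Union>\<C> \<inter> W = {\<zero>\<^bsub>V\<^esub>}" using mem(2) ne by blast
    ultimately show "\<Union>\<C> \<in> S" by (simp add: S_def)
  qed
  then obtain U where U: "submodule U K V" "U \<inter> W = {\<zero>\<^bsub>V\<^esub>}"
    and max: "\<And>X. submodule X K V \<Longrightarrow> X \<inter> W = {\<zero>\<^bsub>V\<^esub>} \<Longrightarrow> U \<subseteq> X \<Longrightarrow> X = U"
    by (auto simp: S_def)
  note U' = subspaceD[OF V U(1)]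
  show thesis
  proof (rule that[OF U])
    fix v assume v: "v \<in> carrier V"
    show "\<exists>u\<in>U. \<exists>w\<in>W. v = u \<oplus>\<^bsub>V\<^esub> w"
    proof (rule ccontr)
      assume no: "\<not> ?thesis"
      define X where "X = {u \<oplus>\<^bsub>V\<^esub> a \<odot>\<^bsub>V\<^esub> v | u a. u \<in> U \<and> a \<in> carrier K}"
      have inX: "u \<oplus>\<^bsub>V\<^esub> a \<odot>\<^bsub>V\<^esub> v \<in> X" if "u \<in> U" "a \<in> carrier K" for u a
        using that by (auto simp: X_def)
      have UV: "u \<in> U \<Longrightarrow> u \<in> carrier V" for u using U' by auto
      have "submodule X K V"
      proof (rule subspaceI[OF V])
        show "X \<subseteq> carrier V" using UV v by (auto simp: X_def)
        show "\<zero>\<^bsub>V\<^esub> \<in> X" using inX[of "\<zero>\<^bsub>V\<^esub>" "\<zero>\<^bsub>K\<^esub>"] U' v by simp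
      next
        fix x y assume "x \<in> X" "y \<in> X"
        then obtain u a u' a' where *: "x = u \<oplus>\<^bsub>V\<^esub> a \<odot>\<^bsub>V\<^esub> v" "y = u' \<oplus>\<^bsub>V\<^esub> a' \<odot>\<^bsub>V\<^esub> v"
          "u \<in> U" "u' \<in> U" "a \<in> carrier K" "a' \<in> carrier K" by (auto simp: X_def)
        then have "x \<oplus>\<^bsub>V\<^esub> y = (u \<oplus>\<^bsub>V\<^esub> u') \<oplus>\<^bsub>V\<^esub> (a \<oplus>\<^bsub>K\<^esub> a') \<odot>\<^bsub>V\<^esub> v"
          using v UV by (simp add: V.smult_l_distr V.M.a_ac)
        then show "x \<oplus>\<^bsub>V\<^esub> y \<in> X" using inX * U' by simp
      next
        fix c x assume c: "c \<in> carrier K" and "x \<in> X"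
        then obtain u a where *: "x = u \<oplus>\<^bsub>V\<^esub> a \<odot>\<^bsub>V\<^esub> v" "u \<in> U" "a \<in> carrier K" by (auto simp: X_def)
        then have "c \<odot>\<^bsub>V\<^esub> x = c \<odot>\<^bsub>V\<^esub> u \<oplus>\<^bsub>V\<^esub> (c \<otimes>\<^bsub>K\<^esub> a) \<odot>\<^bsub>V\<^esub> v"
          using v UV c by (simp add: V.smult_r_distr V.smult_assoc1)
        then show "c \<odot>\<^bsub>V\<^esub> x \<in> X" using inX * U' c by simp
      qed
      moreover have "X \<inter> W = {\<zero>\<^bsub>V\<^esub>}"
      proof -
        have "w = \<zero>\<^bsub>V\<^esub>" if w: "w \<in> W" "w \<in> X" for w
        proof -
          obtain u a where *: "w = u \<oplus>\<^bsub>V\<^esub> a \<odot>\<^bsub>V\<^esub> v" "u \<in> U" "a \<in> carrier K" using w by (auto simp: X_def)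
          have wV: "w \<in> carrier V" using w W' by auto
          show ?thesis
          proof (cases "a = \<zero>\<^bsub>K\<^esub>")
            case True
            then have "w = u" using * UV v by simp
            then show ?thesis using U(2) *(2) w(1) by auto
          next
            case False
            then have a: "a \<in> Units K" using * K.field_Units by auto
            have "a \<odot>\<^bsub>V\<^esub> v = \<ominus>\<^bsub>V\<^esub> u \<oplus>\<^bsub>V\<^esub> w"
              using * UV v wV by (simp add: V.M.r_neg2 V.M.r_neg1)
            then have e1: "inv\<^bsub>K\<^esub> a \<odot>\<^bsub>V\<^esub> (a \<odot>\<^bsub>V\<^esub> v) = inv\<^bsub>K\<^esub> a \<odot>\<^bsub>V\<^esub> (\<ominus>\<^bsub>V\<^esub> u) \<oplus>\<^bsub>V\<^esub> inv\<^bsub>K\<^esub> a \<odot>\<^bsub>V\<^esub> w"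
              using a *(2) UV wV by (simp add: V.smult_r_distr)
            have e2: "inv\<^bsub>K\<^esub> a \<odot>\<^bsub>V\<^esub> (a \<odot>\<^bsub>V\<^esub> v) = v"
              using a * v by (simp flip: V.smult_assoc1)
            have "v = inv\<^bsub>K\<^esub> a \<odot>\<^bsub>V\<^esub> (\<ominus>\<^bsub>V\<^esub> u) \<oplus>\<^bsub>V\<^esub> inv\<^bsub>K\<^esub> a \<odot>\<^bsub>V\<^esub> w"
              using e1 unfolding e2 .
            moreover have "inv\<^bsub>K\<^esub> a \<odot>\<^bsub>V\<^esub> (\<ominus>\<^bsub>V\<^esub> u) \<in> U" "inv\<^bsub>K\<^esub> a \<odot>\<^bsub>V\<^esub> w \<in> W"
              using a * U' W' w by auto
            ultimately show ?thesis using no by blast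
          qed
        qed
        moreover have "\<zero>\<^bsub>V\<^esub> \<in> X" using inX[of "\<zero>\<^bsub>V\<^esub>" "\<zero>\<^bsub>K\<^esub>"] U' v by simp
        ultimately show ?thesis using W'(2) by blast
      qed
      moreover have "U \<subseteq> X"
      proof
        fix u assume "u \<in> U"
        then show "u \<in> X" using inX[of u "\<zero>\<^bsub>K\<^esub>"] UV v by simp
      qed
      ultimately have "X = U" by (rule max)
      then have "v \<in> U" using inX[of "\<zero>\<^bsub>V\<^esub>" "\<one>\<^bsub>K\<^esub>"] U' v by simp
      then show False using no W' v by (metis V.M.r_zero)
    qed
  qed
qed

text \<open>The projection onto \<open>W\<close> along a complement.\<close>

lemma exists_projection:
  assumes V: "hs V" and W: "submodule W K V"
  obtains p where "lin V V p" "\<And>v. v \<in> carrier V \<Longrightarrow> p v \<in> W" "\<And>w. w \<in> W \<Longrightarrow> p w = w"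
proof -
  note mV = hs_module[OF V]
  interpret V: Module.module K V by (rule mV)
  obtain U where U: "submodule U K V" "U \<inter> W = {\<zero>\<^bsub>V\<^esub>}"
    "\<And>v. v \<in> carrier V \<Longrightarrow> \<exists>u\<in>U. \<exists>w\<in>W. v = u \<oplus>\<^bsub>V\<^esub> w"
    using exists_complement[OF mV W] by blast
  note W' = subspaceD[OF mV W] and U' = subspaceD[OF mV U(1)]
  have WV: "w \<in> W \<Longrightarrow> w \<in> carrier V" and UV: "w \<in> U \<Longrightarrow> w \<in> carrier V" for w using W' U' by auto
  obtain p where p: "\<And>v. v \<in> carrier V \<Longrightarrow> p v \<in> W \<and> (\<exists>u\<in>U. v = u \<oplus>\<^bsub>V\<^esub> p v)"
    using U(3) by metis
  have uniq: "p (u \<oplus>\<^bsub>V\<^esub> w) = w" if uw: "u \<in> U" "w \<in> W" for u w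
  proof -
    obtain u' where u': "u' \<in> U" "u \<oplus>\<^bsub>V\<^esub> w = u' \<oplus>\<^bsub>V\<^esub> p (u \<oplus>\<^bsub>V\<^esub> w)" and pW: "p (u \<oplus>\<^bsub>V\<^esub> w) \<in> W"
      using p[of "u \<oplus>\<^bsub>V\<^esub> w"] uw UV WV by auto
    let ?w = "p (u \<oplus>\<^bsub>V\<^esub> w)"
    have c: "u \<in> carrier V" "u' \<in> carrier V" "w \<in> carrier V" "?w \<in> carrier V"
      using that u' pW UV WV by auto
    have "u \<ominus>\<^bsub>V\<^esub> u' = ?w \<ominus>\<^bsub>V\<^esub> w"
    proof -
      have "u \<ominus>\<^bsub>V\<^esub> u' = (u \<oplus>\<^bsub>V\<^esub> w) \<oplus>\<^bsub>V\<^esub> (\<ominus>\<^bsub>V\<^esub> w \<oplus>\<^bsub>V\<^esub> \<ominus>\<^bsub>V\<^esub> u')"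
        using c by (simp add: a_minus_def V.M.a_assoc V.M.r_neg2)
      also have "\<dots> = (?w \<oplus>\<^bsub>V\<^esub> u') \<oplus>\<^bsub>V\<^esub> (\<ominus>\<^bsub>V\<^esub> u' \<oplus>\<^bsub>V\<^esub> \<ominus>\<^bsub>V\<^esub> w)"
        using c by (subst u'(2)) (simp only: V.M.a_comm[of u' ?w] V.M.a_comm[of "\<ominus>\<^bsub>V\<^esub> w"] V.M.a_inv_closed)
      also have "\<dots> = ?w \<ominus>\<^bsub>V\<^esub> w"
        using c by (simp only: a_minus_def V.M.a_assoc V.M.r_neg2 V.M.a_inv_closed V.M.a_closed)
      finally show ?thesis .
    qed
    moreover have "u \<ominus>\<^bsub>V\<^esub> u' \<in> U" "?w \<ominus>\<^bsub>V\<^esub> w \<in> W" using U' W' that u' pW by auto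
    ultimately have "?w \<ominus>\<^bsub>V\<^esub> w = \<zero>\<^bsub>V\<^esub>" using U(2) by auto
    then show ?thesis using c eq_if_minus_zero[OF V.module_axioms] by blast
  qed
  show thesis
  proof (rule that[of p])
    show "p v \<in> W" if "v \<in> carrier V" for v using p that by blast
    show "p w = w" if "w \<in> W" for w using uniq[of "\<zero>\<^bsub>V\<^esub>" w] U' that WV by simp
    show "lin V V p"
    proof (rule linI)
      show "p x \<in> carrier V" if "x \<in> carrier V" for x using p that WV by blast
      fix x y assume xy: "x \<in> carrier V" "y \<in> carrier V"
      then obtain u v where uv: "u \<in> U" "x = u \<oplus>\<^bsub>V\<^esub> p x" "v \<in> U" "y = v \<oplus>\<^bsub>V\<^esub> p y" "p x \<in> W" "p y \<in> W"
        using p by metis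
      then have c: "u \<in> carrier V" "v \<in> carrier V" "p x \<in> carrier V" "p y \<in> carrier V" using UV WV by auto
      have "x \<oplus>\<^bsub>V\<^esub> y = (u \<oplus>\<^bsub>V\<^esub> p x) \<oplus>\<^bsub>V\<^esub> (v \<oplus>\<^bsub>V\<^esub> p y)" using uv by simp
      also have "\<dots> = (u \<oplus>\<^bsub>V\<^esub> v) \<oplus>\<^bsub>V\<^esub> (p x \<oplus>\<^bsub>V\<^esub> p y)"
        using c by (simp add: V.M.a_ac)
      finally show "p (x \<oplus>\<^bsub>V\<^esub> y) = p x \<oplus>\<^bsub>V\<^esub> p y" using uniq U' W' uv by simp
    next
      fix a x assume ax: "a \<in> carrier K" "x \<in> carrier V"
      then obtain u where u: "u \<in> U" "x = u \<oplus>\<^bsub>V\<^esub> p x" "p x \<in> W" using p by metis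
      then have "a \<odot>\<^bsub>V\<^esub> x = a \<odot>\<^bsub>V\<^esub> u \<oplus>\<^bsub>V\<^esub> a \<odot>\<^bsub>V\<^esub> p x"
        using ax UV WV by (metis V.smult_r_distr)
      then show "p (a \<odot>\<^bsub>V\<^esub> x) = a \<odot>\<^bsub>V\<^esub> p x" using uniq U' W' u ax by simp
    qed
  qed
qed

text \<open>Every linear map \<open>f\<close> has a generalized inverse \<open>s\<close>. Let \<open>p\<close> be a projection onto the kernel
  of \<open>f\<close>, let \<open>r\<close> be one onto the image, and \<open>g = 1 - p\<close>. Then \<open>g(v)\<close> depends only on \<open>f(v)\<close>, so
  that \<open>s(x) = g(v)\<close> for any \<open>v\<close> with \<open>f(v) = r(x)\<close> is well defined and linear.\<close>

lemma exists_generalized_inverse: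
  assumes V: "hs V" and X: "hs X" and f: "lin V X f"
  obtains s where "lin X V s" "\<And>v. v \<in> carrier V \<Longrightarrow> f (s (f v)) = f v"
proof -
  note mV = hs_module[OF V] and mX = hs_module[OF X]
  interpret V: Module.module K V by (rule mV)
  interpret X: Module.module K X by (rule mX)
  note fc = lin_closed[OF f] and fa = lin_add[OF f] and fs = lin_smult[OF f] and fz = lin_zero[OF V X f]
  define Q where "Q = {v \<in> carrier V. f v = \<zero>\<^bsub>X\<^esub>}"
  have Q: "submodule Q K V" by (rule subspaceI[OF mV]) (auto simp: Q_def fz fa fs)
  have I: "submodule (f ` carrier V) K X"
    by (rule subspaceI[OF mX]) (auto simp: fc image_iff fz[symmetric] fa[symmetric] fs[symmetric]
        intro: V.M.a_closed V.M.zero_closed V.smult_closed)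
  obtain p where p: "lin V V p" "\<And>v. v \<in> carrier V \<Longrightarrow> p v \<in> Q" "\<And>w. w \<in> Q \<Longrightarrow> p w = w"
    using exists_projection[OF V Q] by blast
  obtain r where r: "lin X X r" "\<And>v. v \<in> carrier X \<Longrightarrow> r v \<in> f ` carrier V" "\<And>w. w \<in> f ` carrier V \<Longrightarrow> r w = w"
    using exists_projection[OF X I] by blast
  \<comment> \<open>Subtraction is written as addition of the multiple by \<open>-1\<close>, which linear maps preserve.\<close>
  define m where "m = \<ominus>\<^bsub>K\<^esub> \<one>\<^bsub>K\<^esub>"
  have m: "m \<in> carrier K" "\<And>v. v \<in> carrier V \<Longrightarrow> m \<odot>\<^bsub>V\<^esub> v = \<ominus>\<^bsub>V\<^esub> v" "\<And>v. v \<in> carrier X \<Longrightarrow> m \<odot>\<^bsub>X\<^esub> v = \<ominus>\<^bsub>X\<^esub> v"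
    by (simp_all add: m_def V.smult_l_minus X.smult_l_minus)
  define g where "g v = v \<oplus>\<^bsub>V\<^esub> m \<odot>\<^bsub>V\<^esub> p v" for v
  have pV: "p v \<in> carrier V" if "v \<in> carrier V" for v using lin_closed[OF p(1)] that .
  have g: "lin V V g" unfolding g_def by (intro lin_plus lin_smult_map V lin_id m p)
  have fg: "f (g v) = f v" if "v \<in> carrier V" for v
    using that p(2)[of v] m(1) fc by (simp add: g_def fa fs pV Q_def)
  have g_eq: "g v = g w" if vw: "v \<in> carrier V" "w \<in> carrier V" "f v = f w" for v w
  proof -
    let ?d = "v \<oplus>\<^bsub>V\<^esub> m \<odot>\<^bsub>V\<^esub> w"
    have "f ?d = \<zero>\<^bsub>X\<^esub>" using vw m(1) m(3)[of "f w"] fc by (simp add: fa fs X.M.r_neg)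
    then have "?d \<in> Q" using vw m by (simp add: Q_def)
    then have "g ?d = \<zero>\<^bsub>V\<^esub>" using p(3) m vw by (simp add: g_def V.M.r_neg)
    then have *: "g v \<oplus>\<^bsub>V\<^esub> m \<odot>\<^bsub>V\<^esub> g w = \<zero>\<^bsub>V\<^esub>" using vw m(1)
        by (simp only: lin_add[OF g] lin_smult[OF g] V.smult_closed)
    have c: "g v \<in> carrier V" "g w \<in> carrier V" using lin_closed[OF g] vw by auto
    have "g v \<ominus>\<^bsub>V\<^esub> g w = \<zero>\<^bsub>V\<^esub>" using * m c by (simp only: a_minus_def)
    then show ?thesis using c eq_if_minus_zero[OF V.module_axioms] by blast
  qed
  define h where "h x = (SOME v. v \<in> carrier V \<and> f v = r x)" for x
  have h: "h x \<in> carrier V" "f (h x) = r x" if "x \<in> carrier X" for x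
  proof -
    have "\<exists>v. v \<in> carrier V \<and> f v = r x" using r(2)[OF that] by auto
    from someI_ex[OF this] show "h x \<in> carrier V" "f (h x) = r x" by (auto simp: h_def)
  qed
  note ra = lin_add[OF r(1)] and rs = lin_smult[OF r(1)]
  have "lin X V (\<lambda>x. g (h x))"
  proof (rule linI)
    show "g (h x) \<in> carrier V" if "x \<in> carrier X" for x using lin_closed[OF g] h that by auto
    show "g (h (x \<oplus>\<^bsub>X\<^esub> y)) = g (h x) \<oplus>\<^bsub>V\<^esub> g (h y)" if "x \<in> carrier X" "y \<in> carrier X" for x y
      using that h by (subst lin_add[OF g, symmetric]) (auto intro!: g_eq simp: fa ra)
    show "g (h (a \<odot>\<^bsub>X\<^esub> x)) = a \<odot>\<^bsub>V\<^esub> g (h x)" if "a \<in> carrier K" "x \<in> carrier X" for a x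
      using that h by (subst lin_smult[OF g, symmetric]) (auto intro!: g_eq simp: fs rs)
  qed
  moreover have "f (g (h (f v))) = f v" if "v \<in> carrier V" for v
    using that h fc r(3) by (simp add: fg)
  ultimately show thesis using that by blast
qed

text \<open>Tensoring with \<open>C\<close> preserves injectivity, because an injective map has a retraction.\<close>

lemma tensor_inj:
  assumes hs: "hs Q" "hs V" "hs C" and i: "lin Q V i" "inj_on i (carrier Q)"
    and t: "s \<in> carrier (Q \<^bold>\<otimes> C)" "t \<in> carrier (Q \<^bold>\<otimes> C)"
    and eq: "sw Q C (V \<^bold>\<otimes> C) s (\<lambda>q c. pt V C (i q) c) = sw Q C (V \<^bold>\<otimes> C) t (\<lambda>q c. pt V C (i q) c)"
  shows "s = t"
proof -
  obtain r where r: "lin V Q r" "\<And>q. q \<in> carrier Q \<Longrightarrow> i (r (i q)) = i q"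
    using exists_generalized_inverse[OF hs(1,2) i(1)] by blast
  have ri: "r (i q) = q" if "q \<in> carrier Q" for q
    using i(2) r(2)[OF that] lin_closed[OF r(1)] lin_closed[OF i(1)] that by (auto dest: inj_onD)
  have "sw V C (Q \<^bold>\<otimes> C) (sw Q C (V \<^bold>\<otimes> C) t (\<lambda>q c. pt V C (i q) c)) (\<lambda>v c. pt Q C (r v) c) = t"
    if "t \<in> carrier (Q \<^bold>\<otimes> C)" for t
    using that hs by (simp add: lin_rules[OF i(1)] lin_rules[OF r(1)] ri)
  then show ?thesis using t eq by metis
qed

lemma sw_add_body:
  assumes "hs P" "\<And>x y. x \<in> carrier U \<Longrightarrow> y \<in> carrier V \<Longrightarrow> b x y \<in> carrier P"
    "\<And>x y. x \<in> carrier U \<Longrightarrow> y \<in> carrier V \<Longrightarrow> b' x y \<in> carrier P"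
  shows "sw U V P t (\<lambda>x y. b x y \<oplus>\<^bsub>P\<^esub> b' x y) = sw U V P t b \<oplus>\<^bsub>P\<^esub> sw U V P t b'"
proof -
  interpret P: Module.module K P by (rule hs_module[OF assms(1)])
  show ?thesis
    unfolding sw_def
    by (subst sum_over_add[symmetric])
       (use assms in \<open>auto intro!: sum_over_cong simp: hs_abelian_group\<close>)
qed

text \<open>Tensoring with \<open>C\<close> preserves equalizers: if \<open>s\<close> is a generalized inverse of
  \<open>f = L - R\<close>, then \<open>1 - s f\<close> maps into the equalizer, and \<open>(s f) \<otimes> id\<close> kills every
  tensor on which \<open>L \<otimes> id\<close> and \<open>R \<otimes> id\<close> agree.\<close>

lemma tensor_equalizer:
  assumes hs: "hs V" "hs X" "hs C" and L: "lin V X L" and R: "lin V X R"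
    and t: "t \<in> carrier (V \<^bold>\<otimes> C)"
    and eq: "sw V C (X \<^bold>\<otimes> C) t (\<lambda>v c. pt X C (L v) c) = sw V C (X \<^bold>\<otimes> C) t (\<lambda>v c. pt X C (R v) c)"
  obtains xs where "set xs \<subseteq> {v \<in> carrier V. L v = R v} \<times> carrier C" "t = tensor_class K V C xs"
proof -
  interpret V: Module.module K V by (rule hs_module[OF hs(1)])
  interpret X: Module.module K X by (rule hs_module[OF hs(2)])
  interpret VC: Module.module K "V \<^bold>\<otimes> C" by (rule tensor_module[OF hs(1,3)])
  interpret XC: Module.module K "X \<^bold>\<otimes> C" by (rule tensor_module[OF hs(2,3)])
  define m where "m = \<ominus>\<^bsub>K\<^esub> \<one>\<^bsub>K\<^esub>"
  have m: "m \<in> carrier K" "\<And>v. v \<in> carrier V \<Longrightarrow> m \<odot>\<^bsub>V\<^esub> v = \<ominus>\<^bsub>V\<^esub> v" "\<And>v. v \<in> carrier X \<Longrightarrow> m \<odot>\<^bsub>X\<^esub> v = \<ominus>\<^bsub>X\<^esub> v"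
    "\<And>v. v \<in> carrier (X \<^bold>\<otimes> C) \<Longrightarrow> m \<odot>\<^bsub>X \<^bold>\<otimes> C\<^esub> v = \<ominus>\<^bsub>X \<^bold>\<otimes> C\<^esub> v"
    by (simp_all add: m_def V.smult_l_minus X.smult_l_minus XC.smult_l_minus)
  define f where "f v = L v \<oplus>\<^bsub>X\<^esub> m \<odot>\<^bsub>X\<^esub> R v" for v
  have f: "lin V X f" unfolding f_def by (intro lin_plus lin_smult_map hs L R m)
  have Lc: "L v \<in> carrier X" and Rc: "R v \<in> carrier X" and fc: "f v \<in> carrier X"
    if "v \<in> carrier V" for v
    using lin_closed[OF L] lin_closed[OF R] lin_closed[OF f] that by auto
  obtain s where s: "lin X V s" "\<And>v. v \<in> carrier V \<Longrightarrow> f (s (f v)) = f v"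
    using exists_generalized_inverse[OF hs(1,2) f] by blast
  note [simp] = lin_rules[OF f hs(1,2)] lin_rules[OF s(1) hs(2,1)] hs m(1) lin_rules[OF L] lin_rules[OF R]
  define e where "e v = v \<oplus>\<^bsub>V\<^esub> m \<odot>\<^bsub>V\<^esub> s (f v)" for v
  have e: "lin V V e" unfolding e_def by (intro lin_plus lin_smult_map) auto
  have eQ: "L (e v) = R (e v)" if v: "v \<in> carrier V" for v
  proof -
    have ev: "e v \<in> carrier V" using lin_closed[OF e v] .
    have "f (e v) = \<zero>\<^bsub>X\<^esub>"
      using v fc m(3)[of "f v"] by (simp add: e_def lin_add[OF f] s(2) X.M.r_neg)
    then have "L (e v) \<ominus>\<^bsub>X\<^esub> R (e v) = \<zero>\<^bsub>X\<^esub>"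
      using ev m Rc by (simp add: f_def a_minus_def)
    then show ?thesis using ev Lc Rc eq_if_minus_zero[OF X.module_axioms] by blast
  qed
  have ft: "sw V C (X \<^bold>\<otimes> C) t (\<lambda>v c. pt X C (f v) c) = \<zero>\<^bsub>X \<^bold>\<otimes> C\<^esub>"
  proof -
    have "sw V C (X \<^bold>\<otimes> C) t (\<lambda>v c. pt X C (f v) c) =
        sw V C (X \<^bold>\<otimes> C) t (\<lambda>v c. pt X C (L v) c \<oplus>\<^bsub>X \<^bold>\<otimes> C\<^esub> m \<odot>\<^bsub>X \<^bold>\<otimes> C\<^esub> pt X C (R v) c)"
      by (rule sw_cong) (auto simp: f_def pt_add_left Lc Rc)
    also have "\<dots> = sw V C (X \<^bold>\<otimes> C) t (\<lambda>v c. pt X C (L v) c) \<oplus>\<^bsub>X \<^bold>\<otimes> C\<^esub>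
        m \<odot>\<^bsub>X \<^bold>\<otimes> C\<^esub> sw V C (X \<^bold>\<otimes> C) t (\<lambda>v c. pt X C (R v) c)"
      by (subst sw_add_body) (auto simp: Lc Rc)
    finally show ?thesis unfolding eq by (simp add: m(4) XC.M.r_neg del: tensor_simps)
  qed
  have "sw V C (V \<^bold>\<otimes> C) t (\<lambda>v c. pt V C (s (f v)) c) =
      sw X C (V \<^bold>\<otimes> C) (sw V C (X \<^bold>\<otimes> C) t (\<lambda>v c. pt X C (f v) c)) (\<lambda>x c. pt V C (s x) c)"
    by simp
  also have "\<dots> = \<zero>\<^bsub>V \<^bold>\<otimes> C\<^esub>"
    unfolding ft by (rule lin_zero[OF _ _ sw_lin]) auto
  finally have sft: "sw V C (V \<^bold>\<otimes> C) t (\<lambda>v c. pt V C (s (f v)) c) = \<zero>\<^bsub>V \<^bold>\<otimes> C\<^esub>" .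
  have "sw V C (V \<^bold>\<otimes> C) t (\<lambda>v c. pt V C (e v) c) =
      sw V C (V \<^bold>\<otimes> C) t (\<lambda>v c. pt V C v c \<oplus>\<^bsub>V \<^bold>\<otimes> C\<^esub> m \<odot>\<^bsub>V \<^bold>\<otimes> C\<^esub> pt V C (s (f v)) c)"
    by (rule sw_cong) (auto simp: e_def pt_add_left)
  also have "\<dots> = sw V C (V \<^bold>\<otimes> C) t (pt V C) \<oplus>\<^bsub>V \<^bold>\<otimes> C\<^esub>
      m \<odot>\<^bsub>V \<^bold>\<otimes> C\<^esub> sw V C (V \<^bold>\<otimes> C) t (\<lambda>v c. pt V C (s (f v)) c)"
    by (subst sw_add_body) auto
  also have "\<dots> = t" using t unfolding sft by (simp del: tensor_simps)
  finally have te: "t = sw V C (V \<^bold>\<otimes> C) t (\<lambda>v c. pt V C (e v) c)" by simp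
  obtain xs where xs: "set xs \<subseteq> carrier V \<times> carrier C" "t = tensor_class K V C xs"
    using tensor_cases[OF hs(1,3) t] by metis
  have ok: "set (map (\<lambda>(v, c). (e v, c)) xs) \<subseteq> carrier V \<times> carrier C"
    using xs lin_closed[OF e] by auto
  have "t = sum_over (V \<^bold>\<otimes> C) xs (\<lambda>v c. pt V C (e v) c)"
    by (subst te, subst xs(2), subst sw_tensor_class) (use xs e lin_closed[OF e] in auto)
  also have "\<dots> = tensor_class K V C (map (\<lambda>(v, c). (e v, c)) xs)"
    by (simp only: tensor_class_sum[OF hs(1,3) ok] sum_over_map)
  finally have "t = tensor_class K V C (map (\<lambda>(v, c). (e v, c)) xs)" .
  moreover have "set (map (\<lambda>(v, c). (e v, c)) xs) \<subseteq> {v \<in> carrier V. L v = R v} \<times> carrier C"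
    using ok xs eQ by auto
  ultimately show thesis using that by blast
qed


section \<open>Subobjects and quotients of Doi-Hopf modules\<close>

text \<open>Linearity may be tested after an injective linear map, and below, before a surjective one.\<close>

lemma lin_reflect:
  assumes hs: "hs V" "hs W" and j: "lin W X j" "inj_on j (carrier W)"
    and f: "\<And>x. x \<in> carrier V \<Longrightarrow> f x \<in> carrier W" and jf: "lin V X (\<lambda>x. j (f x))"
  shows "lin V W f"
  by (rule linI; (rule f | rule inj_onD[OF j(2)]);
      simp add: f hs lin_add[OF jf] lin_smult[OF jf] lin_add[OF j(1)] lin_smult[OF j(1)])

lemma lin_surj:
  assumes hs: "hs V" "hs Q" "hs X" and p: "lin V Q p" "p ` carrier V = carrier Q"
    and f: "lin V X (\<lambda>v. f (p v))"
  shows "lin Q X f"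
proof -
  have *: "\<exists>v\<in>carrier V. q = p v" if "q \<in> carrier Q" for q using p(2) that by auto
  show ?thesis
  proof (rule linI)
    fix x assume "x \<in> carrier Q"
    then show "f x \<in> carrier X" using * lin_closed[OF f] by blast
  next
    fix x y assume "x \<in> carrier Q" "y \<in> carrier Q"
    then obtain v w where v: "v \<in> carrier V" "w \<in> carrier V" "x = p v" "y = p w" using * by metis
    then have "f (p v \<oplus>\<^bsub>Q\<^esub> p w) = f (p (v \<oplus>\<^bsub>V\<^esub> w))" by (simp add: lin_add[OF p(1)])
    also have "\<dots> = f (p v) \<oplus>\<^bsub>X\<^esub> f (p w)" using v by (simp add: lin_add[OF f])
    finally show "f (x \<oplus>\<^bsub>Q\<^esub> y) = f x \<oplus>\<^bsub>X\<^esub> f y" using v by simp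
  next
    fix a x assume a: "a \<in> carrier K" and "x \<in> carrier Q"
    then obtain v where v: "v \<in> carrier V" "x = p v" using * by metis
    then have "f (a \<odot>\<^bsub>Q\<^esub> p v) = f (p (a \<odot>\<^bsub>V\<^esub> v))" using a by (simp add: lin_smult[OF p(1)])
    also have "\<dots> = a \<odot>\<^bsub>X\<^esub> f (p v)" using v a by (simp add: lin_smult[OF f])
    finally show "f (a \<odot>\<^bsub>Q\<^esub> x) = a \<odot>\<^bsub>X\<^esub> f x" using v by simp
  qed
qed

end

context dh_datum
begin

lemma dh_structI:
  assumes M: "hs M" and act: "bilin_map K A M M act" and \<rho>: "lin M (M \<^bold>\<otimes> C) \<rho>"
    and "\<And>m. m \<in> carrier M \<Longrightarrow> act \<one>\<^bsub>A\<^esub> m = twist M m"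
    and "\<And>a m. a \<in> carrier A \<Longrightarrow> m \<in> carrier M \<Longrightarrow> twist M (act a m) = act (twist A a) (twist M m)"
    and "\<And>a b m. a \<in> carrier A \<Longrightarrow> b \<in> carrier A \<Longrightarrow> m \<in> carrier M \<Longrightarrow>
      act (twist A a) (act b m) = act (a \<otimes>\<^bsub>A\<^esub> b) (twist M m)"
    and "\<And>m. m \<in> carrier M \<Longrightarrow> sw M C M (\<rho> m) (\<lambda>x y. counit C y \<odot>\<^bsub>M\<^esub> x) = twist M m"
    and "\<And>m. m \<in> carrier M \<Longrightarrow> \<rho> (twist M m) = twist (M \<^bold>\<otimes> C) (\<rho> m)"
    and "\<And>m. m \<in> carrier M \<Longrightarrow>
      sw M C (M \<^bold>\<otimes> (C \<^bold>\<otimes> C)) (\<rho> m) (\<lambda>m0 m1. sw M C (M \<^bold>\<otimes> (C \<^bold>\<otimes> C)) (\<rho> m0)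
          (\<lambda>x y. pt M (C \<^bold>\<otimes> C) x (pt C C y (twist C m1)))) =
      sw M C (M \<^bold>\<otimes> (C \<^bold>\<otimes> C)) (\<rho> m) (\<lambda>m0 m1. sw C C (M \<^bold>\<otimes> (C \<^bold>\<otimes> C)) (comult C m1)
          (\<lambda>y z. pt M (C \<^bold>\<otimes> C) (twist M m0) (pt C C y z)))"
    and "\<And>a m. a \<in> carrier A \<Longrightarrow> m \<in> carrier M \<Longrightarrow> \<rho> (act a m) =
      sw A H (M \<^bold>\<otimes> C) (alg_coact A a) (\<lambda>a0 a1. sw M C (M \<^bold>\<otimes> C) (\<rho> m) (\<lambda>m0 m1.
        pt M C (act a0 m0) (coalg_act C a1 m1)))"
  shows "dh_struct M act \<rho>"
  unfolding dh_struct_def left_hom_module_def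
  using assms by (auto intro!: comoduleI[OF coalgebra_C])

text \<open>If a Doi-Hopf structure \<open>V\<close> restricts along an injective linear map \<open>i : Q \<rightarrow> V\<close>, then all
  axioms hold for \<open>Q\<close>. They can be tested in \<open>V\<close>, \<open>V \<otimes> C\<close> and \<open>V \<otimes> C \<otimes> C\<close>, because \<open>i\<close> remains
  injective after tensoring.\<close>

lemma dh_struct_sub:
  assumes V: "dh_struct V act \<rho>" and Q: "hs Q"
    and i: "lin Q V i" "inj_on i (carrier Q)" "\<And>q. q \<in> carrier Q \<Longrightarrow> i (twist Q q) = twist V (i q)"
    and actQ: "\<And>a q. a \<in> carrier A \<Longrightarrow> q \<in> carrier Q \<Longrightarrow> actQ a q \<in> carrier Q"
      "\<And>a q. a \<in> carrier A \<Longrightarrow> q \<in> carrier Q \<Longrightarrow> i (actQ a q) = act a (i q)"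
    and \<rho>Q: "\<And>q. q \<in> carrier Q \<Longrightarrow> \<rho>Q q \<in> carrier (Q \<^bold>\<otimes> C)"
      "\<And>q. q \<in> carrier Q \<Longrightarrow> sw Q C (V \<^bold>\<otimes> C) (\<rho>Q q) (\<lambda>x y. pt V C (i x) y) = \<rho> (i q)"
  shows "dh_struct Q actQ \<rho>Q"
proof -
  note [simp] = dh_rules[OF V] Q lin_rules[OF i(1)] i(3) actQ \<rho>Q(1)
  note inj = inj_onD[OF i(2)]
  \<comment> \<open>A sum over \<open>\<rho>(q)\<close> that involves the first leg only through \<open>i\<close> is a sum over \<open>\<rho>(i(q))\<close>.\<close>
  have fold: "sw Q C P (\<rho>Q q) (\<lambda>x y. B (i x) y) = sw V C P (\<rho> (i q)) B"
    if "q \<in> carrier Q" "hs P" "\<And>x. x \<in> carrier V \<Longrightarrow> lin C P (B x)" "\<And>y. y \<in> carrier C \<Longrightarrow> lin V P (\<lambda>x. B x y)"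
    for q P and B :: "'u \<Rightarrow> 'u \<Rightarrow> 'u"
    using that by (simp flip: \<rho>Q(2))
  define J where "J t = sw Q C (V \<^bold>\<otimes> C) t (\<lambda>x y. pt V C (i x) y)" for t
  have J: "lin (Q \<^bold>\<otimes> C) (V \<^bold>\<otimes> C) J" unfolding J_def by simp
  have J_inj: "inj_on J (carrier (Q \<^bold>\<otimes> C))"
    unfolding J_def by (rule inj_onI, rule tensor_inj[OF _ _ _ i(1,2)]) auto
  have J\<rho>: "J (\<rho>Q q) = \<rho> (i q)" if "q \<in> carrier Q" for q unfolding J_def using that by (simp add: \<rho>Q(2))
  have bilin: "bilin_map K A Q Q actQ"
    unfolding bilin_map_def
  proof (intro conjI ballI)
    show "lin Q Q (actQ a)" if "a \<in> carrier A" for a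
      by (rule lin_reflect[OF _ _ i(1,2)]) (use that in \<open>simp_all add:
          lin_cong[of Q "\<lambda>x. i (actQ a x)" "\<lambda>x. act a (i x)"]\<close>)
    show "lin A Q (\<lambda>a. actQ a q)" if "q \<in> carrier Q" for q
      by (rule lin_reflect[OF _ _ i(1,2)]) (use that in \<open>simp_all add:
          lin_cong[of A "\<lambda>x. i (actQ x q)" "\<lambda>x. act x (i q)"]\<close>)
  qed
  note [simp] = bilin_rules[OF bilin algebra_hs[OF algebra_A] Q Q]
  have lin_\<rho>Q: "lin Q (Q \<^bold>\<otimes> C) \<rho>Q"
    by (rule lin_reflect[OF _ _ J J_inj]) (simp_all add: J\<rho> lin_cong[of Q "\<lambda>x. J (\<rho>Q x)" "\<lambda>x. \<rho> (i x)"])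
  note [simp] = lin_rules[OF lin_\<rho>Q]
  show ?thesis
  proof (rule dh_structI)
    show "hs Q" "bilin_map K A Q Q actQ" "lin Q (Q \<^bold>\<otimes> C) \<rho>Q" by (fact Q bilin lin_\<rho>Q)+
    show "actQ \<one>\<^bsub>A\<^esub> m = twist Q m" if "m \<in> carrier Q" for m
      by (rule inj) (use that in simp_all)
    show "twist Q (actQ a m) = actQ (twist A a) (twist Q m)" if "a \<in> carrier A" "m \<in> carrier Q" for a m
      by (rule inj) (use that in simp_all)
    show "actQ (twist A a) (actQ b m) = actQ (a \<otimes>\<^bsub>A\<^esub> b) (twist Q m)"
      if "a \<in> carrier A" "b \<in> carrier A" "m \<in> carrier Q" for a b m
      by (rule inj) (use that in simp_all)
  next
    fix m assume m: "m \<in> carrier Q"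
    show "sw Q C Q (\<rho>Q m) (\<lambda>x y. counit C y \<odot>\<^bsub>Q\<^esub> x) = twist Q m"
    proof (rule inj)
      have "sw Q C V (\<rho>Q m) (\<lambda>x y. counit C y \<odot>\<^bsub>V\<^esub> i x) = sw V C V (\<rho> (i m)) (\<lambda>x y. counit C y \<odot>\<^bsub>V\<^esub> x)"
        using m by (intro fold) simp_all
      then show "i (sw Q C Q (\<rho>Q m) (\<lambda>x y. counit C y \<odot>\<^bsub>Q\<^esub> x)) = i (twist Q m)"
        using m by simp
    qed (use m in simp_all)
    show "\<rho>Q (twist Q m) = twist (Q \<^bold>\<otimes> C) (\<rho>Q m)"
    proof (rule inj_onD[OF J_inj])
      have "sw Q C (V \<^bold>\<otimes> C) (\<rho>Q m) (\<lambda>x y. pt V C (twist V (i x)) (twist C y)) =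
          sw V C (V \<^bold>\<otimes> C) (\<rho> (i m)) (\<lambda>x y. pt V C (twist V x) (twist C y))"
        using m by (intro fold) simp_all
      then have "J (twist (Q \<^bold>\<otimes> C) (\<rho>Q m)) = \<rho> (twist V (i m))"
        using m by (simp add: J_def tensor_twist)
      then show "J (\<rho>Q (twist Q m)) = J (twist (Q \<^bold>\<otimes> C) (\<rho>Q m))"
        using m by (simp only: J\<rho> i(3) hs_closed Q)
    qed (use m in simp_all)
    let ?V = "V \<^bold>\<otimes> (C \<^bold>\<otimes> C)" and ?Q = "Q \<^bold>\<otimes> (C \<^bold>\<otimes> C)"
    show "sw Q C ?Q (\<rho>Q m) (\<lambda>m0 m1. sw Q C ?Q (\<rho>Q m0) (\<lambda>x y. pt Q (C \<^bold>\<otimes> C) x (pt C C y (twist C m1)))) =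
      sw Q C ?Q (\<rho>Q m) (\<lambda>m0 m1. sw C C ?Q (comult C m1)
          (\<lambda>y z. pt Q (C \<^bold>\<otimes> C) (twist Q m0) (pt C C y z)))" (is "?L = ?R")
    proof (rule tensor_inj[OF _ _ _ i(1,2)])
      have inner: "sw Q C ?V (\<rho>Q q) (\<lambda>x y. pt V (C \<^bold>\<otimes> C) (i x) (pt C C y (twist C c))) =
          sw V C ?V (\<rho> (i q)) (\<lambda>x y. pt V (C \<^bold>\<otimes> C) x (pt C C y (twist C c)))"
        if "q \<in> carrier Q" "c \<in> carrier C" for q c
        using that by (intro fold) simp_all
      have "sw Q (C \<^bold>\<otimes> C) ?V ?L (\<lambda>q c. pt V (C \<^bold>\<otimes> C) (i q) c) =
          sw Q C ?V (\<rho>Q m) (\<lambda>m0 m1. sw V C ?V (\<rho> (i m0)) (\<lambda>x y. pt V (C \<^bold>\<otimes> C) x (pt C C y (twist C m1))))"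
        using m by (simp add: inner cong: sw_cong)
      also have "\<dots> = sw V C ?V (\<rho> (i m)) (\<lambda>m0 m1. sw V C ?V (\<rho> m0)
          (\<lambda>x y. pt V (C \<^bold>\<otimes> C) x (pt C C y (twist C m1))))"
        using m by (intro fold) simp_all
      also have "\<dots> = sw V C ?V (\<rho> (i m)) (\<lambda>m0 m1. sw C C ?V (comult C m1)
          (\<lambda>y z. pt V (C \<^bold>\<otimes> C) (twist V m0) (pt C C y z)))"
        using m by (simp add: dh_coassoc[OF V])
      also have "\<dots> = sw Q C ?V (\<rho>Q m) (\<lambda>m0 m1. sw C C ?V (comult C m1)
          (\<lambda>y z. pt V (C \<^bold>\<otimes> C) (twist V (i m0)) (pt C C y z)))"
        using m by (intro fold[symmetric]) simp_all
      also have "\<dots> = sw Q (C \<^bold>\<otimes> C) ?V ?R (\<lambda>q c. pt V (C \<^bold>\<otimes> C) (i q) c)"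
        using m by simp
      finally show "sw Q (C \<^bold>\<otimes> C) ?V ?L (\<lambda>q c. pt V (C \<^bold>\<otimes> C) (i q) c) =
        sw Q (C \<^bold>\<otimes> C) ?V ?R (\<lambda>q c. pt V (C \<^bold>\<otimes> C) (i q) c)" .
    qed simp_all
  next
    fix a m assume am: "a \<in> carrier A" "m \<in> carrier Q"
    show "\<rho>Q (actQ a m) = sw A H (Q \<^bold>\<otimes> C) (alg_coact A a) (\<lambda>a0 a1. sw Q C (Q \<^bold>\<otimes> C) (\<rho>Q m) (\<lambda>m0 m1.
        pt Q C (actQ a0 m0) (coalg_act C a1 m1)))"
    proof (rule inj_onD[OF J_inj])
      have f: "sw Q C (V \<^bold>\<otimes> C) (\<rho>Q m) (\<lambda>m0 m1. pt V C (act a0 (i m0)) (coalg_act C a1 m1)) =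
        sw V C (V \<^bold>\<otimes> C) (\<rho> (i m)) (\<lambda>m0 m1. pt V C (act a0 m0) (coalg_act C a1 m1))"
        if "a0 \<in> carrier A" "a1 \<in> carrier H" for a0 a1
        using that am by (intro fold) simp_all
      show "J (\<rho>Q (actQ a m)) = J (sw A H (Q \<^bold>\<otimes> C) (alg_coact A a) (\<lambda>a0 a1. sw Q C (Q \<^bold>\<otimes> C) (\<rho>Q m) (\<lambda>m0 m1.
        pt Q C (actQ a0 m0) (coalg_act C a1 m1))))"
        using am by (simp add: J\<rho>) (simp add: J_def f)
    qed (use am in simp_all)
  qed
qed

text \<open>If a Doi-Hopf structure \<open>V\<close> descends along a surjective linear map \<open>p : V \<rightarrow> Q\<close>, then all
  axioms hold for \<open>Q\<close>, because every element of \<open>Q\<close> is of the form \<open>p(v)\<close>.\<close>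

lemma dh_struct_quotient:
  assumes V: "dh_struct V act \<rho>" and Q: "hs Q"
    and p: "lin V Q p" "p ` carrier V = carrier Q" "\<And>v. v \<in> carrier V \<Longrightarrow> twist Q (p v) = p (twist V v)"
    and actQ: "\<And>a v. a \<in> carrier A \<Longrightarrow> v \<in> carrier V \<Longrightarrow> actQ a (p v) = p (act a v)"
    and \<rho>Q: "\<And>v. v \<in> carrier V \<Longrightarrow> \<rho>Q (p v) = sw V C (Q \<^bold>\<otimes> C) (\<rho> v) (\<lambda>x y. pt Q C (p x) y)"
  shows "dh_struct Q actQ \<rho>Q"
proof -
  note [simp] = dh_rules[OF V] Q lin_rules[OF p(1)] p(3) actQ \<rho>Q
  have surj: "(\<And>v. v \<in> carrier V \<Longrightarrow> P (p v)) \<Longrightarrow> q \<in> carrier Q \<Longrightarrow> P q" for P q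
    using p(2) by (metis imageE)
  have lin_cong': "lin V W f" if "\<And>x. x \<in> carrier V \<Longrightarrow> f x = g x" "lin V W g" "hs V"
    for V :: "('k, 'u, 'g) hom_space_scheme" and W :: "('k, 'u, 'h) hom_space_scheme" and f g
    using lin_cong that by metis
  have bilin: "bilin_map K A Q Q actQ"
    unfolding bilin_map_def
  proof (intro conjI ballI)
    show "lin Q Q (actQ a)" if "a \<in> carrier A" for a
      by (rule lin_surj[OF _ _ _ p(1,2)], simp_all, rule lin_cong') (use that in auto)
    show "lin A Q (\<lambda>a. actQ a q)" if "q \<in> carrier Q" for q
      by (rule surj[OF _ that], rule lin_cong') auto
  qed
  have lin_\<rho>Q: "lin Q (Q \<^bold>\<otimes> C) \<rho>Q"
    by (rule lin_surj[OF _ _ _ p(1,2)], simp_all, rule lin_cong') auto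
  note [simp] = bilin_rules[OF bilin algebra_hs[OF algebra_A] Q Q] lin_rules[OF lin_\<rho>Q]
  show ?thesis
  proof (rule dh_structI)
    show "hs Q" "bilin_map K A Q Q actQ" "lin Q (Q \<^bold>\<otimes> C) \<rho>Q" by (fact Q bilin lin_\<rho>Q)+
  next
    fix m assume m: "m \<in> carrier Q"
    show "actQ \<one>\<^bsub>A\<^esub> m = twist Q m" by (rule surj[OF _ m]) simp
    show "sw Q C Q (\<rho>Q m) (\<lambda>x y. counit C y \<odot>\<^bsub>Q\<^esub> x) = twist Q m" by (rule surj[OF _ m]) simp
    show "\<rho>Q (twist Q m) = twist (Q \<^bold>\<otimes> C) (\<rho>Q m)" by (rule surj[OF _ m]) simp
    let ?Q = "Q \<^bold>\<otimes> (C \<^bold>\<otimes> C)"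
    show "sw Q C ?Q (\<rho>Q m) (\<lambda>m0 m1. sw Q C ?Q (\<rho>Q m0) (\<lambda>x y. pt Q (C \<^bold>\<otimes> C) x (pt C C y (twist C m1)))) =
      sw Q C ?Q (\<rho>Q m) (\<lambda>m0 m1. sw C C ?Q (comult C m1) (\<lambda>y z. pt Q (C \<^bold>\<otimes> C) (twist Q m0) (pt C C y z)))"
      by (rule surj[OF _ m]) (simp add: dh_coassoc[OF V])
  next
    fix a m assume a: "a \<in> carrier A" and m: "m \<in> carrier Q"
    show "twist Q (actQ a m) = actQ (twist A a) (twist Q m)" by (rule surj[OF _ m]) (use a in simp)
    show "\<rho>Q (actQ a m) = sw A H (Q \<^bold>\<otimes> C) (alg_coact A a) (\<lambda>a0 a1. sw Q C (Q \<^bold>\<otimes> C) (\<rho>Q m) (\<lambda>m0 m1.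
        pt Q C (actQ a0 m0) (coalg_act C a1 m1)))" by (rule surj[OF _ m]) (use a in simp)
    fix b assume b: "b \<in> carrier A"
    show "actQ (twist A a) (actQ b m) = actQ (a \<otimes>\<^bsub>A\<^esub> b) (twist Q m)"
      by (rule surj[OF _ m]) (use a b in simp)
  qed
qed

end


section \<open>Coinduction\<close>

context dh_morphism
begin

text \<open>The action \<open>a \<cdot> (n \<otimes> c) = \<beta>(a\<^sub>0) \<cdot> n \<otimes> a\<^sub>1 \<cdot> c\<close> and the coaction
  \<open>\<rho>(n \<otimes> c) = \<alpha>(n) \<otimes> c\<^sub>1 \<otimes> \<alpha>\<^sup>-\<^sup>1(c\<^sub>2)\<close> on all of \<open>N \<otimes> C\<close>.\<close>

definition coind_act :: "('k, 'u, 'x) hom_space_scheme \<Rightarrow> ('u \<Rightarrow> 'u \<Rightarrow> 'u) \<Rightarrow> 'u \<Rightarrow> 'u \<Rightarrow> 'u"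
  where "coind_act N act a x = sw N D.C (N \<^bold>\<otimes> D.C) x (\<lambda>n c.
    sw D.A D.H (N \<^bold>\<otimes> D.C) (alg_coact D.A a) (\<lambda>a0 a1. pt N D.C (act (\<beta> a0) n) (coalg_act D.C a1 c)))"

definition coind_coact :: "('k, 'u, 'x) hom_space_scheme \<Rightarrow> 'u \<Rightarrow> 'u"
  where "coind_coact N x = sw N D.C ((N \<^bold>\<otimes> D.C) \<^bold>\<otimes> D.C) x (\<lambda>n c.
    sw D.C D.C ((N \<^bold>\<otimes> D.C) \<^bold>\<otimes> D.C) (comult D.C c) (\<lambda>c1 c2.
      pt (N \<^bold>\<otimes> D.C) D.C (pt N D.C (twist N n) c1) (untwist D.C c2)))"

text \<open>The two maps whose equalizer is the cotensor product.\<close>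

definition cot_left :: "('k, 'u, 'x) hom_space_scheme \<Rightarrow> 'u \<Rightarrow> 'u"
  where "cot_left N x = sw N D.C (N \<^bold>\<otimes> D'.C \<^bold>\<otimes> D.C) x (\<lambda>n c.
    sw D.C D.C (N \<^bold>\<otimes> D'.C \<^bold>\<otimes> D.C) (comult D.C c) (\<lambda>c1 c2.
      pt N (D'.C \<^bold>\<otimes> D.C) (twist N n) (pt D'.C D.C (\<gamma> c1) c2)))"

definition cot_right :: "('k, 'u, 'x) hom_space_scheme \<Rightarrow> ('u \<Rightarrow> 'u) \<Rightarrow> 'u \<Rightarrow> 'u"
  where "cot_right N \<rho> x = sw N D.C (N \<^bold>\<otimes> D'.C \<^bold>\<otimes> D.C) x (\<lambda>n c.
    sw N D'.C (N \<^bold>\<otimes> D'.C \<^bold>\<otimes> D.C) (\<rho> n) (\<lambda>n0 n1.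
      pt N (D'.C \<^bold>\<otimes> D.C) n0 (pt D'.C D.C n1 (twist D.C c))))"

text \<open>The operator on \<open>N \<otimes> C' \<otimes> C\<close> that corresponds to the action of \<open>a\<close> under both maps above:
  \<open>n \<otimes> y \<otimes> c \<mapsto> \<beta>(a\<^sub>0\<^sub>0) \<cdot> n \<otimes> \<theta>(a\<^sub>0\<^sub>1) \<cdot> y \<otimes> \<alpha>(a\<^sub>1) \<cdot> c\<close>.\<close>

definition cot_act :: "('k, 'u, 'x) hom_space_scheme \<Rightarrow> ('u \<Rightarrow> 'u \<Rightarrow> 'u) \<Rightarrow> 'u \<Rightarrow> 'u \<Rightarrow> 'u"
  where "cot_act N act a t = sw N (D'.C \<^bold>\<otimes> D.C) (N \<^bold>\<otimes> D'.C \<^bold>\<otimes> D.C) t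
      (\<lambda>n u. sw D'.C D.C (N \<^bold>\<otimes> D'.C \<^bold>\<otimes> D.C) u (\<lambda>y c.
    sw D.A D.H (N \<^bold>\<otimes> D'.C \<^bold>\<otimes> D.C) (alg_coact D.A a)
        (\<lambda>a0 a1. sw D.A D.H (N \<^bold>\<otimes> D'.C \<^bold>\<otimes> D.C) (alg_coact D.A a0) (\<lambda>a00 a01.
      pt N (D'.C \<^bold>\<otimes> D.C) (act (\<beta> a00) n)
        (pt D'.C D.C (coalg_act D'.C (\<theta> a01) y) (coalg_act D.C (twist D.H a1) c))))))"

text \<open>The map that corresponds to the coaction under both maps:
  \<open>n \<otimes> y \<otimes> c \<mapsto> (\<alpha>(n) \<otimes> \<alpha>(y) \<otimes> c\<^sub>1) \<otimes> \<alpha>\<^sup>-\<^sup>2(c\<^sub>2)\<close>.\<close>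

definition cot_coact :: "('k, 'u, 'x) hom_space_scheme \<Rightarrow> 'u \<Rightarrow> 'u"
  where "cot_coact N t = sw N (D'.C \<^bold>\<otimes> D.C) ((N \<^bold>\<otimes> D'.C \<^bold>\<otimes> D.C) \<^bold>\<otimes> D.C) t
      (\<lambda>n u. sw D'.C D.C ((N \<^bold>\<otimes> D'.C \<^bold>\<otimes> D.C) \<^bold>\<otimes> D.C) u (\<lambda>y c.
    sw D.C D.C ((N \<^bold>\<otimes> D'.C \<^bold>\<otimes> D.C) \<^bold>\<otimes> D.C) (comult D.C c) (\<lambda>c1 c2.
      pt (N \<^bold>\<otimes> D'.C \<^bold>\<otimes> D.C) D.C (pt N (D'.C \<^bold>\<otimes> D.C) (twist N n) (pt D'.C D.C (twist D'.C y) c1))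
        (untwist D.C (untwist D.C c2)))))"

context
  fixes N :: "('k, 'u, 'x) hom_space_scheme" and act \<rho>
  assumes N: "D'.dh_struct N act \<rho>"
begin

private lemmas [simp] = D'.dh_rules[OF N]

private abbreviation "V \<equiv> N \<^bold>\<otimes> D.C"

private lemma coind_hs: "hs V" by simp

lemma coind_act_bilin: "bilin_map K D.A V V (coind_act N act)"
  unfolding coind_act_def bilin_map_def by simp

lemma coind_coact_lin: "lin V (V \<^bold>\<otimes> D.C) (coind_coact N)"
  unfolding coind_coact_def by simp

private lemmas coind_rules [simp] = 
  bilin_rules[OF coind_act_bilin algebra_hs[OF D.algebra_A] coind_hs coind_hs]
  lin_rules[OF coind_coact_lin]

lemma coind_act_pt [simp]: "a \<in> carrier D.A \<Longrightarrow> n \<in> carrier N \<Longrightarrow> c \<in> carrier D.C \<Longrightarrow>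
   coind_act N act a (pt N D.C n c) = sw D.A D.H V (alg_coact D.A a)
     (\<lambda>a0 a1. pt N D.C (act (\<beta> a0) n) (coalg_act D.C a1 c))"
  by (simp add: coind_act_def)

lemma coind_coact_pt [simp]: "n \<in> carrier N \<Longrightarrow> c \<in> carrier D.C \<Longrightarrow>
   coind_coact N (pt N D.C n c) = sw D.C D.C (V \<^bold>\<otimes> D.C) (comult D.C c) (\<lambda>c1 c2.
      pt (N \<^bold>\<otimes> D.C) D.C (pt N D.C (twist N n) c1) (untwist D.C c2))"
  by (simp add: coind_coact_def)

text \<open>The module axioms and the compatibility reduce to multiplicativity and coassociativity of
  the coaction of \<open>A\<close>, and the comodule axioms are those of \<open>C\<close>.\<close>

lemma coind_dh_struct: "D.dh_struct V (coind_act N act) (coind_coact N)"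
proof (rule D.dh_structI)
  show "bilin_map K D.A V V (coind_act N act)" by (rule coind_act_bilin)
  show "lin V (V \<^bold>\<otimes> D.C) (coind_coact N)" by (rule coind_coact_lin)
  show "hs V" by simp
next
  fix m assume m: "m \<in> carrier V"
  show "coind_act N act \<one>\<^bsub>D.A\<^esub> m = twist V m"
    by (rule tensor_ext[OF _ _ _ _ _ _ m, where P = V]) simp_all
  show "sw V D.C V (coind_coact N m) (\<lambda>x y. counit D.C y \<odot>\<^bsub>V\<^esub> x) = twist V m"
    by (rule tensor_ext[OF _ _ _ _ _ _ m, where P = V]) simp_all
  show "coind_coact N (twist V m) = twist (V \<^bold>\<otimes> D.C) (coind_coact N m)"
    by (rule tensor_ext[OF _ _ _ _ _ _ m, where P = "V \<^bold>\<otimes> D.C"]) simp_all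
  let ?P = "V \<^bold>\<otimes> (D.C \<^bold>\<otimes> D.C)"
  show "sw V D.C ?P (coind_coact N m) (\<lambda>m0 m1. sw V D.C ?P (coind_coact N m0)
      (\<lambda>x y. pt V (D.C \<^bold>\<otimes> D.C) x (pt D.C D.C y (twist D.C m1)))) =
    sw V D.C ?P (coind_coact N m) (\<lambda>m0 m1. sw D.C D.C ?P (comult D.C m1)
        (\<lambda>y z. pt V (D.C \<^bold>\<otimes> D.C) (twist V m0) (pt D.C D.C y z)))"
    by (rule tensor_ext[OF _ _ _ _ _ _ m, where P = ?P]) (simp_all add: D.coassoc)
next
  fix a m assume a: "a \<in> carrier D.A" and m: "m \<in> carrier V"
  show "twist V (coind_act N act a m) = coind_act N act (twist D.A a) (twist V m)"
    by (rule tensor_ext[OF _ _ _ _ _ _ m, where P = V]) (use a in simp_all)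
  \<comment> \<open>Both sides are sums over \<open>a\<^sub>0 \<otimes> a\<^sub>1\<^sub>1 \<otimes> a\<^sub>1\<^sub>2\<close> and \<open>c\<^sub>1 \<otimes> c\<^sub>2\<close>, once those over \<open>a\<close> are moved
    outside.\<close>
  show "coind_coact N (coind_act N act a m) =
      sw D.A D.H (V \<^bold>\<otimes> D.C) (alg_coact D.A a) (\<lambda>a0 a1. sw V D.C (V \<^bold>\<otimes> D.C) (coind_coact N m) (\<lambda>m0 m1.
        pt V D.C (coind_act N act a0 m0) (coalg_act D.C a1 m1)))"
    by (rule tensor_ext[OF _ _ _ _ _ _ m, where P = "V \<^bold>\<otimes> D.C"])
        (use a in \<open>simp_all add: sw_swap[where U = D.C and V = D.C and U' = D.A and V' = D.H] D.coassoc\<close>)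
  fix b assume b: "b \<in> carrier D.A"
  show "coind_act N act (twist D.A a) (coind_act N act b m) = coind_act N act (a \<otimes>\<^bsub>D.A\<^esub> b) (twist V m)"
    by (rule tensor_ext[OF _ _ _ _ _ _ m, where P = V])
        (use a b in \<open>simp_all add: sw_swap[where s = "alg_coact D.A b" and t = "alg_coact D.A a"]\<close>)
qed

private abbreviation "P \<equiv> N \<^bold>\<otimes> D'.C \<^bold>\<otimes> D.C"

lemma cot_left_lin: "lin V P (cot_left N)" and cot_right_lin: "lin V P (cot_right N \<rho>)"
  unfolding cot_left_def cot_right_def by simp_all

private lemmas cot_lin [simp] = lin_rules[OF cot_left_lin] lin_rules[OF cot_right_lin]

lemma cot_left_pt [simp]: "n \<in> carrier N \<Longrightarrow> c \<in> carrier D.C \<Longrightarrow>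
    cot_left N (pt N D.C n c) = sw D.C D.C P (comult D.C c) (\<lambda>c1 c2.
      pt N (D'.C \<^bold>\<otimes> D.C) (twist N n) (pt D'.C D.C (\<gamma> c1) c2))"
  and cot_right_pt [simp]: "n \<in> carrier N \<Longrightarrow> c \<in> carrier D.C \<Longrightarrow>
    cot_right N \<rho> (pt N D.C n c) = sw N D'.C P (\<rho> n) (\<lambda>n0 n1.
      pt N (D'.C \<^bold>\<otimes> D.C) n0 (pt D'.C D.C n1 (twist D.C c)))"
  unfolding cot_left_def cot_right_def by simp_all

lemma cot_twist:
  assumes "x \<in> carrier V"
  shows "cot_left N (twist V x) = twist P (cot_left N x)" "cot_right N \<rho> (twist V x) =
      twist P (cot_right N \<rho> x)"
  by (rule tensor_ext[OF _ _ _ _ _ _ assms, where P = P]; simp)+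

private lemma cot_act_lin: "a \<in> carrier D.A \<Longrightarrow> lin P P (cot_act N act a)"
  unfolding cot_act_def by simp

text \<open>For the first map, \<open>\<gamma>(a\<^sub>1\<^sub>1 \<cdot> c\<^sub>1) = \<theta>(a\<^sub>1\<^sub>1) \<cdot> \<gamma>(c\<^sub>1)\<close> and coassociativity of the coaction
  of \<open>A\<close>; for the second, compatibility of \<open>\<rho>\<^sub>N\<close> with the action and \<open>\<rho>(\<beta>(a)) = \<beta>(a\<^sub>0) \<otimes> \<theta>(a\<^sub>1)\<close>.\<close>

lemma cot_act_eq:
  assumes "a \<in> carrier D.A" "x \<in> carrier V"
  shows "cot_left N (coind_act N act a x) = cot_act N act a (cot_left N x)"
    and "cot_right N \<rho> (coind_act N act a x) = cot_act N act a (cot_right N \<rho> x)"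
proof -
  note [simp] = lin_rules[OF cot_act_lin[OF assms(1)]]
  have pt: "cot_act N act a (pt N (D'.C \<^bold>\<otimes> D.C) n (pt D'.C D.C y c)) =
    sw D.A D.H P (alg_coact D.A a) (\<lambda>a0 a1. sw D.A D.H P (alg_coact D.A a0) (\<lambda>a00 a01.
      pt N (D'.C \<^bold>\<otimes> D.C) (act (\<beta> a00) n)
        (pt D'.C D.C (coalg_act D'.C (\<theta> a01) y) (coalg_act D.C (twist D.H a1) c))))"
    if "n \<in> carrier N" "y \<in> carrier D'.C" "c \<in> carrier D.C" for n y c
    unfolding cot_act_def using that assms by simp
  show "cot_left N (coind_act N act a x) = cot_act N act a (cot_left N x)"
    by (rule tensor_ext[OF _ _ _ _ _ _ assms(2), where P = P])
       (use assms(1) in \<open>simp_all add: pt sw_swap[where U = D.C and V = D.C and U' = D.A and V' = D.H]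
         sw_swap[where U = D.C and V = D.C and U' = D.H and V' = D.H] D.coassoc\<close>)
  show "cot_right N \<rho> (coind_act N act a x) = cot_act N act a (cot_right N \<rho> x)"
    by (rule tensor_ext[OF _ _ _ _ _ _ assms(2), where P = P])
       (use assms(1) in \<open>simp_all add: pt sw_swap[where U = N and V = D'.C and U' = D.A and V' = D.H]
         sw_swap[where U = N and V = D'.C and U' = D.H and V' = D.H] D.coassoc\<close>)
qed

private lemma cot_coact_lin: "lin P (P \<^bold>\<otimes> D.C) (cot_coact N)"
  unfolding cot_coact_def by simp

lemma cot_coact_eq:
  assumes "x \<in> carrier V"
  shows "sw V D.C (P \<^bold>\<otimes> D.C) (coind_coact N x) (\<lambda>v c. pt P D.C (cot_left N v) c) = cot_coact N (cot_left N x)"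
    and "sw V D.C (P \<^bold>\<otimes> D.C) (coind_coact N x) (\<lambda>v c. pt P D.C (cot_right N \<rho> v) c) =
        cot_coact N (cot_right N \<rho> x)"
proof -
  note [simp] = lin_rules[OF cot_coact_lin]
  have pt: "cot_coact N (pt N (D'.C \<^bold>\<otimes> D.C) n (pt D'.C D.C y c)) =
    sw D.C D.C (P \<^bold>\<otimes> D.C) (comult D.C c) (\<lambda>c1 c2.
      pt P D.C (pt N (D'.C \<^bold>\<otimes> D.C) (twist N n) (pt D'.C D.C (twist D'.C y) c1))
        (untwist D.C (untwist D.C c2)))"
    if "n \<in> carrier N" "y \<in> carrier D'.C" "c \<in> carrier D.C" for n y c
    unfolding cot_coact_def using that assms by simp
  show "sw V D.C (P \<^bold>\<otimes> D.C) (coind_coact N x) (\<lambda>v c. pt P D.C (cot_left N v) c) = cot_coact N (cot_left N x)"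
    by (rule tensor_ext[OF _ _ _ _ _ _ assms, where P = "P \<^bold>\<otimes> D.C"]) (simp_all add: pt D.coassoc)
  show "sw V D.C (P \<^bold>\<otimes> D.C) (coind_coact N x) (\<lambda>v c. pt P D.C (cot_right N \<rho> v) c) =
      cot_coact N (cot_right N \<rho> x)"
    by (rule tensor_ext[OF _ _ _ _ _ _ assms, where P = "P \<^bold>\<otimes> D.C"])
       (simp_all add: pt sw_swap[where U = N and V = D'.C and U' = D.C and V' = D.C])
qed

end


section \<open>Induction\<close>

text \<open>The action \<open>a \<cdot> (b \<otimes> m) = \<alpha>(a) b \<otimes> \<alpha>(m)\<close> and the coaction
  \<open>\<rho>(b \<otimes> m) = b\<^sub>0 \<otimes> m\<^sub>0 \<otimes> \<alpha>\<^sup>-\<^sup>2(b\<^sub>1 \<cdot> \<gamma>(m\<^sub>1))\<close> on all of \<open>A' \<otimes> M\<close>.\<close>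

definition ind_act :: "('k, 'u, 'x) hom_space_scheme \<Rightarrow> 'u \<Rightarrow> 'u \<Rightarrow> 'u"
  where "ind_act M a t = sw D'.A M (D'.A \<^bold>\<otimes> M) t (\<lambda>b m. pt D'.A M (twist D'.A a \<otimes>\<^bsub>D'.A\<^esub> b) (twist M m))"

definition ind_coact :: "('k, 'u, 'x) hom_space_scheme \<Rightarrow> ('u \<Rightarrow> 'u) \<Rightarrow> 'u \<Rightarrow> 'u"
  where "ind_coact M \<rho> t = sw D'.A M ((D'.A \<^bold>\<otimes> M) \<^bold>\<otimes> D'.C) t (\<lambda>b m.
    sw D'.A D'.H ((D'.A \<^bold>\<otimes> M) \<^bold>\<otimes> D'.C) (alg_coact D'.A b) (\<lambda>b0 b1.
      sw M D.C ((D'.A \<^bold>\<otimes> M) \<^bold>\<otimes> D'.C) (\<rho> m) (\<lambda>m0 m1.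
        pt (D'.A \<^bold>\<otimes> M) D'.C (pt D'.A M b0 m0)
          (untwist D'.C (untwist D'.C (coalg_act D'.C b1 (\<gamma> m1)))))))"

context
  fixes M :: "('k, 'u, 'x) hom_space_scheme" and act \<rho>
  assumes M: "D.dh_struct M act \<rho>"
begin

private lemmas [simp] = D.dh_rules[OF M]

private abbreviation "W \<equiv> D'.A \<^bold>\<otimes> M"

private lemma ind_hs: "hs W" by simp

lemma ind_act_bilin: "bilin_map K D'.A W W (ind_act M)"
  unfolding ind_act_def bilin_map_def by simp

lemma ind_coact_lin: "lin W (W \<^bold>\<otimes> D'.C) (ind_coact M \<rho>)"
  unfolding ind_coact_def by simp

private lemmas ind_rules [simp] =
  bilin_rules[OF ind_act_bilin algebra_hs[OF D'.algebra_A] ind_hs ind_hs]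
  lin_rules[OF ind_coact_lin]

lemma ind_act_pt [simp]: "a \<in> carrier D'.A \<Longrightarrow> b \<in> carrier D'.A \<Longrightarrow> m \<in> carrier M \<Longrightarrow>
    ind_act M a (pt D'.A M b m) = pt D'.A M (twist D'.A a \<otimes>\<^bsub>D'.A\<^esub> b) (twist M m)"
  by (simp add: ind_act_def)

lemma ind_coact_pt [simp]: "b \<in> carrier D'.A \<Longrightarrow> m \<in> carrier M \<Longrightarrow>
    ind_coact M \<rho> (pt D'.A M b m) = sw D'.A D'.H (W \<^bold>\<otimes> D'.C) (alg_coact D'.A b) (\<lambda>b0 b1.
      sw M D.C (W \<^bold>\<otimes> D'.C) (\<rho> m) (\<lambda>m0 m1.
        pt W D'.C (pt D'.A M b0 m0) (coalg_act D'.C (untwist D'.H (untwist D'.H b1)) (\<gamma> (untwist D.C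
            (untwist D.C m1))))))"
  by (simp add: ind_coact_def)

lemma ind_dh_struct: "D'.dh_struct W (ind_act M) (ind_coact M \<rho>)"
proof (rule D'.dh_structI)
  show "bilin_map K D'.A W W (ind_act M)" by (rule ind_act_bilin)
  show "lin W (W \<^bold>\<otimes> D'.C) (ind_coact M \<rho>)" by (rule ind_coact_lin)
  show "hs W" by simp
next
  fix m assume m: "m \<in> carrier W"
  show "ind_act M \<one>\<^bsub>D'.A\<^esub> m = twist W m"
    by (rule tensor_ext[OF _ _ _ _ _ _ m, where P = W]) simp_all
  show "sw W D'.C W (ind_coact M \<rho> m) (\<lambda>x y. counit D'.C y \<odot>\<^bsub>W\<^esub> x) = twist W m"
    by (rule tensor_ext[OF _ _ _ _ _ _ m, where P = W]) simp_all
  show "ind_coact M \<rho> (twist W m) = twist (W \<^bold>\<otimes> D'.C) (ind_coact M \<rho> m)"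
    by (rule tensor_ext[OF _ _ _ _ _ _ m, where P = "W \<^bold>\<otimes> D'.C"]) simp_all
  let ?P = "W \<^bold>\<otimes> (D'.C \<^bold>\<otimes> D'.C)"
  \<comment> \<open>Coassociativity is applied separately to \<open>b\<close> and to \<open>m\<close>; for this the sums over legs of \<open>b\<close>
    are moved outside those over legs of \<open>m\<close>.\<close>
  show "sw W D'.C ?P (ind_coact M \<rho> m) (\<lambda>m0 m1. sw W D'.C ?P (ind_coact M \<rho> m0)
      (\<lambda>x y. pt W (D'.C \<^bold>\<otimes> D'.C) x (pt D'.C D'.C y (twist D'.C m1)))) =
    sw W D'.C ?P (ind_coact M \<rho> m) (\<lambda>m0 m1. sw D'.C D'.C ?P (comult D'.C m1)
        (\<lambda>y z. pt W (D'.C \<^bold>\<otimes> D'.C) (twist W m0) (pt D'.C D'.C y z)))"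
    by (rule tensor_ext[OF _ _ _ _ _ _ m, where P = ?P])
       (simp_all add: D'.coassoc D.dh_coassoc[OF M]
          sw_swap[where U = M and V = D.C and U' = D'.A and V' = D'.H]
          sw_swap[where U = M and V = D.C and U' = D'.H and V' = D'.H])
next
  fix a m assume a: "a \<in> carrier D'.A" and m: "m \<in> carrier W"
  show "twist W (ind_act M a m) = ind_act M (twist D'.A a) (twist W m)"
    by (rule tensor_ext[OF _ _ _ _ _ _ m, where P = W]) (use a in simp_all)
  show "ind_coact M \<rho> (ind_act M a m) =
      sw D'.A D'.H (W \<^bold>\<otimes> D'.C) (alg_coact D'.A a) (\<lambda>a0 a1. sw W D'.C (W \<^bold>\<otimes> D'.C) (ind_coact M \<rho> m) (\<lambda>m0 m1.
        pt W D'.C (ind_act M a0 m0) (coalg_act D'.C a1 m1)))"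
    by (rule tensor_ext[OF _ _ _ _ _ _ m, where P = "W \<^bold>\<otimes> D'.C"]) (use a in simp_all)
  fix b assume b: "b \<in> carrier D'.A"
  show "ind_act M (twist D'.A a) (ind_act M b m) = ind_act M (a \<otimes>\<^bsub>D'.A\<^esub> b) (twist W m)"
    by (rule tensor_ext[OF _ _ _ _ _ _ m, where P = W]) (use a b in simp_all)
qed

text \<open>Any map \<open>p\<close> that identifies \<open>b \<beta>(a) \<otimes> \<alpha>(m)\<close> with \<open>\<alpha>(b) \<otimes> a \<cdot> m\<close> also identifies their images
  under the action of \<open>a'\<close>, since \<open>\<alpha>(a') (b \<beta>(a)) = (a' b) \<beta>(\<alpha>(a))\<close>, and \<open>p \<otimes> id\<close> identifies
  their coactions, since \<open>\<alpha>(b\<^sub>1) \<cdot> \<gamma>(a\<^sub>1 \<cdot> m\<^sub>1) = (b\<^sub>1 \<theta>(a\<^sub>1)) \<cdot> \<alpha>(\<gamma>(m\<^sub>1))\<close>.\<close>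

context
  fixes Q :: "('k, 'u, 'y) hom_space_scheme" and p
  assumes Q: "hs Q" and p: "lin W Q p"
    and balanced: "\<And>b a m. b \<in> carrier D'.A \<Longrightarrow> a \<in> carrier D.A \<Longrightarrow> m \<in> carrier M \<Longrightarrow>
      p (pt D'.A M (b \<otimes>\<^bsub>D'.A\<^esub> \<beta> a) (twist M m)) = p (pt D'.A M (twist D'.A b) (act a m))"
begin

private lemma rew: "b \<in> carrier D'.A \<Longrightarrow> a \<in> carrier D.A \<Longrightarrow> m \<in> carrier M \<Longrightarrow>
    p (pt D'.A M (b \<otimes>\<^bsub>D'.A\<^esub> \<beta> a) m) = p (pt D'.A M (twist D'.A b) (act a (untwist M m)))"
  using balanced[of b a "untwist M m"] by simp

lemma ind_act_balanced:
  assumes "a' \<in> carrier D'.A" "b \<in> carrier D'.A" "a \<in> carrier D.A" "m \<in> carrier M"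
  shows "p (ind_act M a' (pt D'.A M (b \<otimes>\<^bsub>D'.A\<^esub> \<beta> a) (twist M m))) =
    p (ind_act M a' (pt D'.A M (twist D'.A b) (act a m)))"
  using assms Q by (simp add: rew)

lemma ind_coact_balanced:
  assumes "b \<in> carrier D'.A" "a \<in> carrier D.A" "m \<in> carrier M"
  shows "sw W D'.C (Q \<^bold>\<otimes> D'.C) (ind_coact M \<rho> (pt D'.A M (b \<otimes>\<^bsub>D'.A\<^esub> \<beta> a) (twist M m)))
      (\<lambda>x y. pt Q D'.C (p x) y) =
    sw W D'.C (Q \<^bold>\<otimes> D'.C) (ind_coact M \<rho> (pt D'.A M (twist D'.A b) (act a m))) (\<lambda>x y. pt Q D'.C (p x) y)"
  using assms Q by (simp add: rew lin_rules[OF p ind_hs Q])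

end

end

end


section \<open>Extended records, subspaces and quotient spaces\<close>

lemma extend_simps [simp]:
  "carrier (hom_space.extend V F) = carrier V"
  "mult (hom_space.extend V F) = mult V"
  "one (hom_space.extend V F) = one V"
  "zero (hom_space.extend V F) = zero V"
  "add (hom_space.extend V F) = add V"
  "smult (hom_space.extend V F) = smult V"
  "twist (hom_space.extend V F) = twist V"
  "mod_act (hom_space.extend V (dh_module.fields act \<rho>)) = act"
  "mod_coact (hom_space.extend V (dh_module.fields act \<rho>)) = \<rho>"
  by (simp_all add: hom_space.extend_def dh_module.fields_def)

lemma module_cong:
  assumes "Module.module K V" "carrier V' = carrier V" "zero V' = zero V" "add V' = add V"
    "smult V' = smult V"
  shows "Module.module K V'"
proof -
  interpret V: Module.module K V by fact
  have "abelian_group V'"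
  proof (rule abelian_groupI)
    fix x assume "x \<in> carrier V'"
    then show "\<exists>y\<in>carrier V'. y \<oplus>\<^bsub>V'\<^esub> x = \<zero>\<^bsub>V'\<^esub>"
      using assms V.M.l_neg[of x] by (intro bexI[of _ "\<ominus>\<^bsub>V\<^esub> x"]) auto
  qed (use assms in \<open>auto simp: V.M.a_ac\<close>)
  then show ?thesis
    by (intro Module.moduleI) (use assms in \<open>auto simp: V.smult_l_distr V.smult_r_distr
        V.smult_assoc1 intro: V.R.is_cring\<close>)
qed

text \<open>The tensor product only depends on the underlying vector spaces, so that it does not change
  when a space is extended to a record that carries an action and a coaction.\<close>

lemma tensor_eq_cong:
  assumes "tensor_eq K M N xs ys"
    and "carrier M' = carrier M" "zero M' = zero M" "add M' = add M" "smult M' = smult M"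
    and "carrier N' = carrier N" "add N' = add N" "smult N' = smult N"
  shows "tensor_eq K M' N' xs ys"
  using assms(1)
proof induction
  case (refl xs)
  then show ?case using assms by (intro tensor_eq.refl) simp
next
  case (sym xs ys)
  show ?case by (rule tensor_eq.sym[OF sym(2)])
next
  case (trans xs ys zs)
  show ?case by (rule tensor_eq.trans[OF trans(3,4)])
next
  case (append xs xs' ys ys')
  then show ?case by (intro tensor_eq.append)
next
  case (commute xs ys)
  then show ?case using assms by (intro tensor_eq.commute) simp_all
next
  case (zero n)
  then show ?case using assms tensor_eq.zero[of n N' K M'] by simp
next
  case (add_left m m' n)
  then show ?case using assms tensor_eq.add_left[of m M' m' n N' K] by simp
next
  case (add_right m n n')
  then show ?case using assms tensor_eq.add_right[of m M' n N' n' K] by simp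
next
  case (scalar a m n)
  then show ?case using assms tensor_eq.scalar[of a K m M' n N'] by simp
qed

lemma tensor_class_extend [simp]:
  "tensor_class K (hom_space.extend V F) W = tensor_class K V W"
  "tensor_class K W (hom_space.extend V F) = tensor_class K W V"
proof -
  have "tensor_eq K (hom_space.extend V F) W = tensor_eq K V W"
    "tensor_eq K W (hom_space.extend V F) = tensor_eq K W V"
    by (intro ext iffI; erule tensor_eq_cong; simp)+
  then show "tensor_class K (hom_space.extend V F) W = tensor_class K V W"
    "tensor_class K W (hom_space.extend V F) = tensor_class K W V"
    by (simp_all add: tensor_class_def fun_eq_iff)
qed

lemma tensor_extend [simp]:
  "tensor K (hom_space.extend V F) W = tensor K V W"
  "tensor K W (hom_space.extend V F) = tensor K W V"
  by (simp_all add: tensor_def)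

lemma lin_map_extend [simp]:
  "lin_map K (hom_space.extend V F) W f = lin_map K V W f"
  "lin_map K W (hom_space.extend V F) f = lin_map K W V f"
  by (simp_all add: lin_map_def)

lemma hom_space_extend [simp]: "hom_space K (hom_space.extend V F) = hom_space K V"
  unfolding hom_space_def by (auto intro: module_cong)

context ground_field
begin

lemma sw_extend [simp]:
  "sw (hom_space.extend V F) U P = sw V U P"
  "sw U (hom_space.extend V F) P = sw U V P"
  "sw U W (hom_space.extend V F) = sw U W V"
  by (simp_all add: sw_def fun_eq_iff sum_over_def cong: if_cong)

lemma pt_extend [simp]:
  "pt (hom_space.extend V F) U = pt V U"
  "pt U (hom_space.extend V F) = pt U V"
  by (simp_all add: pt_def fun_eq_iff)

lemma lin_minus:
  assumes "hs V" "hs W" "lin V W f" "x \<in> carrier V" "y \<in> carrier V"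
  shows "f (x \<ominus>\<^bsub>V\<^esub> y) = f x \<ominus>\<^bsub>W\<^esub> f y"
proof -
  interpret V: Module.module K V using assms(1) by (rule hs_module)
  interpret W: Module.module K W using assms(2) by (rule hs_module)
  have "(\<ominus>\<^bsub>K\<^esub> \<one>\<^bsub>K\<^esub>) \<odot>\<^bsub>V\<^esub> y = \<ominus>\<^bsub>V\<^esub> y" "(\<ominus>\<^bsub>K\<^esub> \<one>\<^bsub>K\<^esub>) \<odot>\<^bsub>W\<^esub> f y = \<ominus>\<^bsub>W\<^esub> f y"
    using assms lin_closed[OF assms(3)] by (simp_all add: V.smult_l_minus W.smult_l_minus)
  then show ?thesis
    using lin_smult[OF assms(3), of "\<ominus>\<^bsub>K\<^esub> \<one>\<^bsub>K\<^esub>" y] lin_add[OF assms(3), of x "\<ominus>\<^bsub>V\<^esub> y"] assms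
    by (simp add: a_minus_def)
qed

lemma equalizer_subspace:
  assumes "hs V" "hs X" "lin V X f" "lin V X g"
  shows "submodule {v \<in> carrier V. f v = g v} K V"
  using assms
  by (intro subspaceI hs_module)
     (auto simp: lin_add[OF assms(3)] lin_add[OF assms(4)] lin_smult[OF assms(3)] lin_smult[OF assms(4)]
        lin_zero[OF assms(1,2,3)] lin_zero[OF assms(1,2,4)])

lemma hs_subspace:
  assumes V: "hs V" and W: "submodule W K V"
    and tw: "\<And>w. w \<in> W \<Longrightarrow> twist V w \<in> W" "\<And>w. w \<in> W \<Longrightarrow> untwist V w \<in> W"
  shows "hs (V\<lparr>carrier := W\<rparr>)"
proof -
  note W' = subspaceD[OF hs_module[OF V] W]
  have in_V: "w \<in> carrier V" if "w \<in> W" for w using that W'(1) by auto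
  have "lin (V\<lparr>carrier := W\<rparr>) (V\<lparr>carrier := W\<rparr>) (twist V)"
    using tw(1) by (auto simp: lin_map_def in_V lin_add[OF lin_twist[OF V]] lin_smult[OF lin_twist[OF V]])
  moreover have "bij_betw (twist V) W W"
    by (rule bij_betw_byWitness[of _ "untwist V"]) (use tw W' V in auto)
  ultimately show ?thesis
    using submodule.submodule_is_module[OF W hs_module[OF V]]
    by (simp add: hom_space_def field_K)
qed

lemma lin_subspace: "submodule W K V \<Longrightarrow> hs V \<Longrightarrow> lin (V\<lparr>carrier := W\<rparr>) V (\<lambda>x. x)"
  using subspaceD(1)[OF hs_module] by (fastforce simp: lin_map_def)

context
  fixes V :: "('k, 'u) hom_space" and W
  assumes V: "hs V" and W: "submodule W K V"
    and tw: "\<And>w. w \<in> W \<Longrightarrow> twist V w \<in> W" "\<And>w. w \<in> W \<Longrightarrow> untwist V w \<in> W"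
begin

private abbreviation "p \<equiv> coset_rep V W"
private abbreviation "Q \<equiv> quotient_space V W"

interpretation V: Module.module K V by (rule hs_module[OF V])

private lemmas W' = subspaceD[OF hs_module[OF V] W]

private lemma W_closed: "w \<in> W \<Longrightarrow> w \<in> carrier V" using W' by auto

lemma coset_rep_eq:
  assumes "v \<in> carrier V" "v' \<in> carrier V" "v \<ominus>\<^bsub>V\<^esub> v' \<in> W"
  shows "p v = p v'"
proof -
  have "W +>\<^bsub>V\<^esub> v = W +>\<^bsub>V\<^esub> v'"
  proof (rule equalityI; rule subsetI)
    have *: "\<exists>w'\<in>W. w \<oplus>\<^bsub>V\<^esub> v = w' \<oplus>\<^bsub>V\<^esub> v'" if "w \<in> W" "v \<in> carrier V" "v' \<in> carrier V" "v \<ominus>\<^bsub>V\<^esub> v' \<in>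
        W" for w v v'
    proof (intro bexI)
      show "w \<oplus>\<^bsub>V\<^esub> v = (w \<oplus>\<^bsub>V\<^esub> (v \<ominus>\<^bsub>V\<^esub> v')) \<oplus>\<^bsub>V\<^esub> v'"
        using that W_closed by (simp add: a_minus_def V.M.a_assoc V.M.l_neg)
    qed (use that W' in auto)
    have "\<ominus>\<^bsub>V\<^esub> (v \<ominus>\<^bsub>V\<^esub> v') = v' \<ominus>\<^bsub>V\<^esub> v"
      using assms by (simp add: a_minus_def V.M.minus_add V.M.a_comm)
    then have "v' \<ominus>\<^bsub>V\<^esub> v \<in> W" using assms(3) W' by metis
    then show "x \<in> W +>\<^bsub>V\<^esub> v'" if "x \<in> W +>\<^bsub>V\<^esub> v" for x
      using that *[of _ v v'] assms by (auto simp: a_r_coset_def')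
    show "x \<in> W +>\<^bsub>V\<^esub> v" if "x \<in> W +>\<^bsub>V\<^esub> v'" for x
      using that *[of _ v' v] assms \<open>v' \<ominus>\<^bsub>V\<^esub> v \<in> W\<close> by (auto simp: a_r_coset_def')
  qed
  then show ?thesis by (simp add: coset_rep_def)
qed

lemma coset_rep_minus:
  assumes "v \<in> carrier V"
  shows "p v \<in> carrier V" "p v \<ominus>\<^bsub>V\<^esub> v \<in> W"
proof -
  have "v \<in> W +>\<^bsub>V\<^esub> v"
    using assms W' V.M.l_zero[of v] by (force simp: a_r_coset_def')
  then have "p v \<in> W +>\<^bsub>V\<^esub> v" unfolding coset_rep_def by (rule someI)
  then obtain w where w: "w \<in> W" "p v = w \<oplus>\<^bsub>V\<^esub> v" by (auto simp: a_r_coset_def')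
  then show "p v \<in> carrier V" using assms W_closed by simp
  show "p v \<ominus>\<^bsub>V\<^esub> v \<in> W" using w assms W_closed by (simp add: a_minus_def V.M.a_assoc V.M.r_neg)
qed

text \<open>The elements of the quotient are representatives, hence elements of \<open>V\<close>, on which the
  projection is the identity.\<close>

lemma coset_rep_idem: "v \<in> carrier V \<Longrightarrow> p (p v) = p v"
  by (rule coset_rep_eq) (use coset_rep_minus in auto)

lemma coset_rep_respects:
  assumes "hs X" "lin V X f" "\<And>w. w \<in> W \<Longrightarrow> f w = \<zero>\<^bsub>X\<^esub>" "v \<in> carrier V"
  shows "f (p v) = f v"
proof -
  interpret X: Module.module K X by (rule hs_module[OF assms(1)])
  have "f (p v) \<ominus>\<^bsub>X\<^esub> f v = \<zero>\<^bsub>X\<^esub>"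
    using assms(3,4) coset_rep_minus[OF assms(4)] lin_minus[OF V assms(1,2)] by metis
  then show ?thesis
    using eq_if_minus_zero[OF X.module_axioms] lin_closed[OF assms(2)] assms(4) coset_rep_minus by blast
qed

private lemma p_add: "x \<in> carrier V \<Longrightarrow> y \<in> carrier V \<Longrightarrow> p (p x \<oplus>\<^bsub>V\<^esub> p y) = p (x \<oplus>\<^bsub>V\<^esub> y)"
proof (rule coset_rep_eq)
  assume xy: "x \<in> carrier V" "y \<in> carrier V"
  note c = coset_rep_minus[OF xy(1)] coset_rep_minus[OF xy(2)]
  have "p x \<oplus>\<^bsub>V\<^esub> p y \<ominus>\<^bsub>V\<^esub> (x \<oplus>\<^bsub>V\<^esub> y) = (p x \<ominus>\<^bsub>V\<^esub> x) \<oplus>\<^bsub>V\<^esub> (p y \<ominus>\<^bsub>V\<^esub> y)"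
    using xy c by (simp add: a_minus_def V.M.minus_add V.M.a_ac)
  then show "p x \<oplus>\<^bsub>V\<^esub> p y \<ominus>\<^bsub>V\<^esub> (x \<oplus>\<^bsub>V\<^esub> y) \<in> W" using c W' by simp
qed (use coset_rep_minus in auto)

private lemma p_smult: "a \<in> carrier K \<Longrightarrow> x \<in> carrier V \<Longrightarrow> p (a \<odot>\<^bsub>V\<^esub> p x) = p (a \<odot>\<^bsub>V\<^esub> x)"
proof (rule coset_rep_eq)
  assume a: "a \<in> carrier K" and x: "x \<in> carrier V"
  have "a \<odot>\<^bsub>V\<^esub> p x \<ominus>\<^bsub>V\<^esub> a \<odot>\<^bsub>V\<^esub> x = a \<odot>\<^bsub>V\<^esub> (p x \<ominus>\<^bsub>V\<^esub> x)"
    using a x coset_rep_minus(1)[OF x] by (simp add: a_minus_def V.smult_r_distr V.smult_r_minus)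
  then show "a \<odot>\<^bsub>V\<^esub> p x \<ominus>\<^bsub>V\<^esub> a \<odot>\<^bsub>V\<^esub> x \<in> W" using coset_rep_minus[OF x] a W' by simp
qed (use coset_rep_minus in auto)

private lemma p_twist: "x \<in> carrier V \<Longrightarrow> p (twist V (p x)) = p (twist V x)"
  by (rule coset_rep_eq)
     (use coset_rep_minus tw V in \<open>auto simp flip: lin_minus[OF V V lin_twist[OF V]]\<close>)

private lemma p_untwist: "x \<in> carrier V \<Longrightarrow> p (untwist V (p x)) = p (untwist V x)"
  by (rule coset_rep_eq)
     (use coset_rep_minus tw V in \<open>auto simp flip: lin_minus[OF V V lin_untwist[OF V]]\<close>)

lemma quotient_simps [simp]:
  "carrier Q = p ` carrier V" "zero Q = p \<zero>\<^bsub>V\<^esub>"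
  "x \<oplus>\<^bsub>Q\<^esub> y = p (x \<oplus>\<^bsub>V\<^esub> y)" "a \<odot>\<^bsub>Q\<^esub> x = p (a \<odot>\<^bsub>V\<^esub> x)" "twist Q x = p (twist V x)"
  by (simp_all add: quotient_space_def)

lemma hs_quotient: "hs Q"
proof -
  note c = coset_rep_minus(1)
  have pz: "p \<zero>\<^bsub>V\<^esub> \<in> carrier V" using c by simp
  have p_add': "p (p x \<oplus>\<^bsub>V\<^esub> y) = p (x \<oplus>\<^bsub>V\<^esub> y)" "p (y \<oplus>\<^bsub>V\<^esub> p x) =
      p (y \<oplus>\<^bsub>V\<^esub> x)" if "x \<in> carrier V" "y \<in> carrier V" for x y
    using p_add[of "p x" y] p_add[of x y] p_add[of y "p x"] p_add[of y x] that c by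
        (simp_all add: coset_rep_idem)
  have "abelian_group Q"
  proof (rule abelian_groupI)
    fix x y z assume "x \<in> carrier Q" "y \<in> carrier Q" "z \<in> carrier Q"
    then obtain u v w where u: "u \<in> carrier V" "x = p u" "v \<in> carrier V" "y = p v"
      "w \<in> carrier V" "z = p w" by auto
    then show "x \<oplus>\<^bsub>Q\<^esub> y \<oplus>\<^bsub>Q\<^esub> z = x \<oplus>\<^bsub>Q\<^esub> (y \<oplus>\<^bsub>Q\<^esub> z)"
      by (simp add: p_add p_add' c V.M.a_assoc)
  next
    fix x y assume "x \<in> carrier Q" "y \<in> carrier Q"
    then obtain u v where u: "u \<in> carrier V" "x = p u" "v \<in> carrier V" "y = p v" by auto
    then show "x \<oplus>\<^bsub>Q\<^esub> y = y \<oplus>\<^bsub>Q\<^esub> x" by (simp add: c V.M.a_comm)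
    show "x \<oplus>\<^bsub>Q\<^esub> y \<in> carrier Q" using u c by simp
  next
    fix x assume "x \<in> carrier Q"
    then obtain v where v: "v \<in> carrier V" "x = p v" by auto
    then show "\<zero>\<^bsub>Q\<^esub> \<oplus>\<^bsub>Q\<^esub> x = x" by (simp add: p_add)
    show "\<exists>y\<in>carrier Q. y \<oplus>\<^bsub>Q\<^esub> x = \<zero>\<^bsub>Q\<^esub>"
      using v by (intro bexI[of _ "p (\<ominus>\<^bsub>V\<^esub> v)"]) (auto simp: p_add V.M.l_neg)
  qed simp
  moreover have "Module.module K Q"
  proof (rule Module.moduleI[OF K.is_cring calculation])
    fix a b x y assume a: "a \<in> carrier K" "b \<in> carrier K" and "x \<in> carrier Q" "y \<in> carrier Q"
    then obtain u v where u: "u \<in> carrier V" "x = p u" "v \<in> carrier V" "y = p v" by auto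
    show "(a \<oplus>\<^bsub>K\<^esub> b) \<odot>\<^bsub>Q\<^esub> x = a \<odot>\<^bsub>Q\<^esub> x \<oplus>\<^bsub>Q\<^esub> b \<odot>\<^bsub>Q\<^esub> x"
      using a u by (simp add: p_add p_smult V.smult_l_distr)
    show "a \<odot>\<^bsub>Q\<^esub> (x \<oplus>\<^bsub>Q\<^esub> y) = a \<odot>\<^bsub>Q\<^esub> x \<oplus>\<^bsub>Q\<^esub> a \<odot>\<^bsub>Q\<^esub> y"
      using a u by (simp add: p_add p_smult V.smult_r_distr)
    show "(a \<otimes>\<^bsub>K\<^esub> b) \<odot>\<^bsub>Q\<^esub> x = a \<odot>\<^bsub>Q\<^esub> (b \<odot>\<^bsub>Q\<^esub> x)"
      using a u by (simp add: p_smult V.smult_assoc1)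
    show "a \<odot>\<^bsub>Q\<^esub> x \<in> carrier Q" using a u c by simp
  next
    fix x assume "x \<in> carrier Q"
    then obtain u where u: "u \<in> carrier V" "x = p u" by auto
    then show "\<one>\<^bsub>K\<^esub> \<odot>\<^bsub>Q\<^esub> x = x" by (simp add: p_smult)
  qed
  moreover have "lin Q Q (twist Q)"
  proof (rule linI)
    fix a x y assume "x \<in> carrier Q" "y \<in> carrier Q"
    then obtain u v where u: "u \<in> carrier V" "x = p u" "v \<in> carrier V" "y = p v" by auto
    show "twist Q x \<in> carrier Q" using u c V by simp
    show "twist Q (x \<oplus>\<^bsub>Q\<^esub> y) = twist Q x \<oplus>\<^bsub>Q\<^esub> twist Q y"
      using u V by (simp add: p_add p_twist lin_add[OF lin_twist[OF V]])
    assume "a \<in> carrier K"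
    then show "twist Q (a \<odot>\<^bsub>Q\<^esub> x) = a \<odot>\<^bsub>Q\<^esub> twist Q x"
      using u V by (simp add: p_smult p_twist lin_smult[OF lin_twist[OF V]])
  qed
  moreover have "bij_betw (twist Q) (carrier Q) (carrier Q)"
    by (rule bij_betw_byWitness[of _ "\<lambda>x. p (untwist V x)"])
       (use c V in \<open>auto simp: p_twist p_untwist\<close>)
  ultimately show ?thesis by (simp add: hom_space_def field_K)
qed

lemma lin_coset_rep: "lin V Q p"
  by (rule linI) (auto simp: p_add p_smult)

lemma coset_rep_twist: "v \<in> carrier V \<Longrightarrow> twist Q (p v) = p (twist V v)"
  by (simp add: p_twist)

end

end


section \<open>The category of Doi-Hopf modules\<close>

context dh_datum
begin

text \<open>Morphisms for unbundled structures.\<close>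

definition dh_map ::
  "('k, 'u, 'x) hom_space_scheme \<Rightarrow> ('u \<Rightarrow> 'u \<Rightarrow> 'u) \<Rightarrow> ('u \<Rightarrow> 'u) \<Rightarrow>
    ('k, 'u, 'y) hom_space_scheme \<Rightarrow> ('u \<Rightarrow> 'u \<Rightarrow> 'u) \<Rightarrow> ('u \<Rightarrow> 'u) \<Rightarrow> ('u \<Rightarrow> 'u) \<Rightarrow> bool"
  where "dh_map M act \<rho> N act' \<rho>' f \<longleftrightarrow> lin M N f \<and> (\<forall>m\<in>carrier M.
    f (twist M m) = twist N (f m) \<and> (\<forall>a\<in>carrier A. f (act a m) = act' a (f m)) \<and>
    \<rho>' (f m) = sw M C (N \<^bold>\<otimes> C) (\<rho> m) (\<lambda>x y. pt N C (f x) y))"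

lemma dh_mapD:
  assumes "dh_map M act \<rho> N act' \<rho>' f"
  shows "lin M N f" "m \<in> carrier M \<Longrightarrow> f (twist M m) = twist N (f m)"
    "a \<in> carrier A \<Longrightarrow> m \<in> carrier M \<Longrightarrow> f (act a m) = act' a (f m)"
    "m \<in> carrier M \<Longrightarrow> \<rho>' (f m) = sw M C (N \<^bold>\<otimes> C) (\<rho> m) (\<lambda>x y. pt N C (f x) y)"
  using assms by (auto simp: dh_map_def)

lemma doi_hopf_hom_iff:
  assumes M: "doi_hopf_module K D M" and N: "doi_hopf_module K D N"
  shows "f \<in> doi_hopf_hom K D M N \<longleftrightarrow> f \<in> extensional (carrier M) \<and>
    dh_map M (mod_act M) (mod_coact M) N (mod_act N) (mod_coact N) f"
proof -
  note [simp] = dh_rules[OF M[unfolded doi_hopf_module_iff]] dh_rules[OF N[unfolded doi_hopf_module_iff]]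
  have "sweedler (N \<^bold>\<otimes> C) (mod_coact M m) (\<lambda>x y. pt N C (f x) y) =
      sw M C (N \<^bold>\<otimes> C) (mod_coact M m) (\<lambda>x y. pt N C (f x) y)"
    if "m \<in> carrier M" "lin M N f" for m
    using that by (intro sweedler_sw) (auto simp: lin_closed)
  then show ?thesis
    by (auto simp: doi_hopf_hom_def dh_map_def pt_def)
qed

lemma dh_map_cong:
  assumes M: "dh_struct M act \<rho>" and eq: "\<And>m. m \<in> carrier M \<Longrightarrow> f m = g m"
    and f: "dh_map M act \<rho> N act' \<rho>' f"
  shows "dh_map M act \<rho> N act' \<rho>' g"
proof -
  note [simp] = dh_rules[OF M]
  have "lin M N g" using lin_cong[of M f g N] eq dh_mapD(1)[OF f] by simp
  moreover have "sw M C (N \<^bold>\<otimes> C) (\<rho> m) (\<lambda>x y. pt N C (g x) y) = sw M C (N \<^bold>\<otimes> C) (\<rho> m)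
      (\<lambda>x y. pt N C (f x) y)" for m
    by (rule sw_cong) (simp_all add: eq)
  ultimately show ?thesis using f by (simp add: dh_map_def eq)
qed

lemma dh_map_id: "dh_struct M act \<rho> \<Longrightarrow> dh_map M act \<rho> M act \<rho> (\<lambda>m. m)"
  using dh_rules[of M act \<rho>] by (simp add: dh_map_def)

lemma dh_map_comp:
  assumes S: "dh_struct L actL \<rho>L" "dh_struct M act \<rho>" "dh_struct N act' \<rho>'"
    and f: "dh_map L actL \<rho>L M act \<rho> f" and g: "dh_map M act \<rho> N act' \<rho>' g"
  shows "dh_map L actL \<rho>L N act' \<rho>' (\<lambda>x. g (f x))"
proof -
  note [simp] = dh_rules[OF S(1)] dh_rules[OF S(2)] dh_rules[OF S(3)]
  note [simp] = lin_rules[OF dh_mapD(1)[OF f] dh_hs[OF S(1)] dh_hs[OF S(2)]]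
    lin_rules[OF dh_mapD(1)[OF g] dh_hs[OF S(2)] dh_hs[OF S(3)]]
  show ?thesis
    unfolding dh_map_def by (simp add: dh_mapD(2-4)[OF f] dh_mapD(2-4)[OF g])
qed

text \<open>A map into a subobject is a morphism if it is one into the larger object; dually for maps
  from a quotient, below.\<close>

lemma dh_map_into_sub:
  assumes S: "dh_struct L actL \<rho>L" "dh_struct Q actQ \<rho>Q" "dh_struct V act \<rho>"
    and i: "dh_map Q actQ \<rho>Q V act \<rho> i" "inj_on i (carrier Q)"
    and f: "\<And>x. x \<in> carrier L \<Longrightarrow> f x \<in> carrier Q" "dh_map L actL \<rho>L V act \<rho> (\<lambda>x. i (f x))"
  shows "dh_map L actL \<rho>L Q actQ \<rho>Q f"
proof -
  note [simp] = dh_rules[OF S(1)] dh_rules[OF S(2)] dh_rules[OF S(3)] f(1)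
  note inj = inj_onD[OF i(2)]
  note [simp] = lin_rules[OF dh_mapD(1)[OF i(1)] dh_hs[OF S(2)] dh_hs[OF S(3)]]
  have lin: "lin L Q f" by (rule lin_reflect[OF _ _ dh_mapD(1)[OF i(1)] i(2) _ dh_mapD(1)[OF f(2)]]) simp_all
  note [simp] = lin_rules[OF lin dh_hs[OF S(1)] dh_hs[OF S(2)]]
  show ?thesis
    unfolding dh_map_def
  proof (intro conjI ballI)
    fix m assume m: "m \<in> carrier L"
    show "f (twist L m) = twist Q (f m)"
      by (rule inj) (use m dh_mapD(2)[OF f(2)] dh_mapD(2)[OF i(1)] in simp_all)
    show "f (actL a m) = actQ a (f m)" if "a \<in> carrier A" for a
      by (rule inj) (use m that dh_mapD(3)[OF f(2)] dh_mapD(3)[OF i(1)] in simp_all)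
    show "\<rho>Q (f m) = sw L C (Q \<^bold>\<otimes> C) (\<rho>L m) (\<lambda>x y. pt Q C (f x) y)"
      by (rule tensor_inj[where C = C, OF _ _ _ dh_mapD(1)[OF i(1)] i(2)])
         (use m dh_mapD(4)[OF f(2)] in \<open>simp_all flip: dh_mapD(4)[OF i(1)]\<close>)
  qed (rule lin)
qed

lemma dh_map_from_quotient:
  assumes S: "dh_struct V act \<rho>" "dh_struct Q actQ \<rho>Q" "dh_struct N act' \<rho>'"
    and p: "dh_map V act \<rho> Q actQ \<rho>Q p" "p ` carrier V = carrier Q"
    and f: "dh_map V act \<rho> N act' \<rho>' (\<lambda>x. f (p x))"
  shows "dh_map Q actQ \<rho>Q N act' \<rho>' f"
proof -
  note [simp] = dh_rules[OF S(1)] dh_rules[OF S(2)] dh_rules[OF S(3)]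
  note [simp] = lin_rules[OF dh_mapD(1)[OF p(1)] dh_hs[OF S(1)] dh_hs[OF S(2)]]
  have lin: "lin Q N f" by (rule lin_surj[OF _ _ _ dh_mapD(1)[OF p(1)] p(2) dh_mapD(1)[OF f]]) simp_all
  note [simp] = lin_rules[OF lin dh_hs[OF S(2)] dh_hs[OF S(3)]]
  show ?thesis
    unfolding dh_map_def
  proof (intro conjI ballI)
    fix m assume "m \<in> carrier Q"
    then obtain v where v: "v \<in> carrier V" "m = p v" using p(2) by (metis imageE)
    show "f (twist Q m) = twist N (f m)"
      using v dh_mapD(2)[OF f] by (simp flip: dh_mapD(2)[OF p(1)])
    show "f (actQ a m) = act' a (f m)" if "a \<in> carrier A" for a
      using v that dh_mapD(3)[OF f] by (simp flip: dh_mapD(3)[OF p(1)])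
    show "\<rho>' (f m) = sw Q C (N \<^bold>\<otimes> C) (\<rho>Q m) (\<lambda>x y. pt N C (f x) y)"
      using v dh_mapD(4)[OF f] by (simp add: dh_mapD(4)[OF p(1)])
  qed (rule lin)
qed

lemma is_category_doi_hopf: "is_category (doi_hopf_category K D)"
proof -
  have ident: "(\<lambda>m\<in>carrier M. m) \<in> doi_hopf_hom K D M M" if "doi_hopf_module K D M" for M
    using that unfolding doi_hopf_hom_iff[OF that that] doi_hopf_module_iff
    by (auto intro: dh_map_cong[OF _ _ dh_map_id])
  have comp: "compose (carrier L) g f \<in> doi_hopf_hom K D L N"
    if "doi_hopf_module K D L" "doi_hopf_module K D M" "doi_hopf_module K D N"
      "f \<in> doi_hopf_hom K D L M" "g \<in> doi_hopf_hom K D M N" for L M N f g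
    using that(4,5) that(1-3)[unfolded doi_hopf_module_iff]
    unfolding doi_hopf_hom_iff[OF that(1,3)] doi_hopf_hom_iff[OF that(1,2)] doi_hopf_hom_iff[OF that(2,3)]
    by (auto intro!: dh_map_cong[OF _ _ dh_map_comp[of L _ _ M _ _ N _ _ f g]] simp: compose_def)
  have hom: "f \<in> extensional (carrier M) \<and> f \<in> carrier M \<rightarrow> carrier N"
    if "f \<in> doi_hopf_hom K D M N" for f M N
    using that by (auto simp: doi_hopf_hom_def lin_map_def)
  show ?thesis
    unfolding is_category_def
    by (auto simp: doi_hopf_category_def ident intro: comp)
       (auto simp: compose_def fun_eq_iff extensional_def dest!: hom)
qed

end


section \<open>The cotensor product\<close>

context dh_morphism
begin

context
  fixes N :: "('k, 'u) dh_module"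
  assumes N: "doi_hopf_module K D' N"
begin

private lemmas N_struct = N[unfolded D'.doi_hopf_module_iff]
private lemmas [simp] = D'.dh_rules[OF N_struct]
abbreviation "VN \<equiv> N \<^bold>\<otimes> D.C"
abbreviation "QN \<equiv> cotensor K D D' \<gamma> N"
private lemmas [simp] =
  bilin_rules[OF coind_act_bilin[OF N_struct] algebra_hs[OF D.algebra_A] D.dh_hs[OF coind_dh_struct[OF N_struct]] D.dh_hs[OF coind_dh_struct[OF N_struct]]]
  lin_rules[OF coind_coact_lin[OF N_struct]]

lemma cotensor_eq: "QN = VN\<lparr>carrier := {x \<in> carrier VN. cot_left N x = cot_right N (mod_coact N) x}\<rparr>"
proof -
  let ?P = "N \<^bold>\<otimes> D'.C \<^bold>\<otimes> D.C"
  have "sweedler ?P x (\<lambda>n c. sweedler ?P (comult D.C c)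
      (\<lambda>c1 c2. pt N (D'.C \<^bold>\<otimes> D.C) (twist N n) (pt D'.C D.C (\<gamma> c1) c2))) = cot_left N x"
    if "x \<in> carrier VN" for x
    unfolding cot_left_def using that
    by (intro sweedler_sw_cong) (auto simp: sweedler_sw[where U = D.C and V = D.C])
  moreover have "sweedler ?P x (\<lambda>n c. sweedler ?P (mod_coact N n)
      (\<lambda>n0 n1. pt N (D'.C \<^bold>\<otimes> D.C) n0 (pt D'.C D.C n1 (twist D.C c)))) = cot_right N (mod_coact N) x"
    if "x \<in> carrier VN" for x
    unfolding cot_right_def using that
    by (intro sweedler_sw_cong) (auto simp: sweedler_sw[where U = N and V = D'.C])
  ultimately have "{x \<in> carrier VN.
       sweedler ?P x (\<lambda>n c. sweedler ?P (comult D.C c)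
           (\<lambda>c1 c2. pt N (D'.C \<^bold>\<otimes> D.C) (twist N n) (pt D'.C D.C (\<gamma> c1) c2))) =
       sweedler ?P x (\<lambda>n c. sweedler ?P (mod_coact N n)
           (\<lambda>n0 n1. pt N (D'.C \<^bold>\<otimes> D.C) n0 (pt D'.C D.C n1 (twist D.C c))))} =
    {x \<in> carrier VN. cot_left N x = cot_right N (mod_coact N) x}" by auto
  then show ?thesis by (simp add: cotensor_def Let_def pt_def)
qed

lemma cotensor_carrier: "x \<in> carrier QN \<longleftrightarrow> x \<in> carrier VN \<and> cot_left N x = cot_right N (mod_coact N) x"
  by (simp add: cotensor_eq)

private lemmas [simp] = lin_rules[OF cot_left_lin[OF N_struct]] lin_rules[OF cot_right_lin[OF N_struct]]

private lemma equalizer_sub: "submodule {x \<in> carrier VN. cot_left N x = cot_right N (mod_coact N) x} K VN"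
  by (rule equalizer_subspace[where X = "N \<^bold>\<otimes> D'.C \<^bold>\<otimes> D.C"])
      (simp_all add: cot_left_lin[OF N_struct] cot_right_lin[OF N_struct])

lemma hs_cotensor: "hs QN"
proof -
  let ?P = "N \<^bold>\<otimes> D'.C \<^bold>\<otimes> D.C"
  have "cot_left N (untwist VN x) = cot_right N (mod_coact N) (untwist VN x)"
    if "x \<in> carrier VN" "cot_left N x = cot_right N (mod_coact N) x" for x
  proof -
    have u: "untwist VN x \<in> carrier VN" "twist VN (untwist VN x) = x"
      using that by simp_all
    have "twist ?P (cot_left N (untwist VN x)) = twist ?P (cot_right N (mod_coact N) (untwist VN x))"
      using that(2) unfolding cot_twist[OF N_struct u(1), symmetric] u(2) .
    moreover have "cot_left N (untwist VN x) \<in> carrier ?P"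
      "cot_right N (mod_coact N) (untwist VN x) \<in> carrier ?P"
      using u(1) by simp_all
    ultimately show ?thesis
      using twist_eq_iff[of ?P] by simp
  qed
  note untw = this
  show ?thesis
    unfolding cotensor_eq
  proof (rule hs_subspace[OF _ equalizer_sub])
    fix x assume x: "x \<in> {x \<in> carrier VN. cot_left N x = cot_right N (mod_coact N) x}"
    then show "twist VN x \<in> {x \<in> carrier VN. cot_left N x = cot_right N (mod_coact N) x}"
      by (simp add: cot_twist[OF N_struct])
    show "untwist VN x \<in> {x \<in> carrier VN. cot_left N x = cot_right N (mod_coact N) x}"
      using x untw[of x] by simp
  qed simp
qed

lemma lin_cotensor: "lin QN VN (\<lambda>x. x)"
  unfolding cotensor_eq by (rule lin_subspace[OF equalizer_sub]) simp

lemma twist_cotensor [simp]: "twist QN = twist VN"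
  by (simp add: cotensor_eq)

private lemma inj_QN: "inj_on (\<lambda>x. x) (carrier QN)" by simp

private lemmas [simp] = hs_cotensor
    lin_rules[OF lin_cotensor hs_cotensor D.dh_hs[OF coind_dh_struct[OF N_struct]]]

text \<open>Both formulas are bilinear in \<open>n \<otimes> c\<close>, so that they do not depend on the formal sum that
  represents a tensor.\<close>

lemma cotensor_act_formula_eq:
  assumes "a \<in> carrier D.A" "set xs \<subseteq> carrier N \<times> carrier D.C"
  shows "cotensor_act_formula K D \<beta> N a xs = coind_act N (mod_act N) a (tensor_class K N D.C xs)"
proof -
  have "coind_act N (mod_act N) a (tensor_class K N D.C xs) = sum_over VN xs (\<lambda>n c.
    sw D.A D.H VN (alg_coact D.A a) (\<lambda>a0 a1. pt N D.C (mod_act N (\<beta> a0) n) (coalg_act D.C a1 c)))"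
    unfolding coind_act_def using assms by (intro sw_tensor_class) simp_all
  also have "\<dots> = cotensor_act_formula K D \<beta> N a xs"
    unfolding cotensor_act_formula_def Let_def pt_def[symmetric]
    using assms by (intro sum_over_cong) (auto simp: sweedler_sw[where U = D.A and V = D.H])
  finally show ?thesis by simp
qed

lemma cotensor_coact_formula_eq:
  assumes "set xs \<subseteq> carrier N \<times> carrier D.C"
  shows "cotensor_coact_formula K D N xs = coind_coact N (tensor_class K N D.C xs)"
proof -
  have "coind_coact N (tensor_class K N D.C xs) = sum_over (VN \<^bold>\<otimes> D.C) xs (\<lambda>n c.
    sw D.C D.C (VN \<^bold>\<otimes> D.C) (comult D.C c) (\<lambda>c1 c2. pt VN D.C (pt N D.C (twist N n) c1) (untwist D.C c2)))"
    unfolding coind_coact_def using assms by (intro sw_tensor_class) simp_all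
  also have "\<dots> = cotensor_coact_formula K D N xs"
    unfolding cotensor_coact_formula_def Let_def pt_def[symmetric]
    using assms by (intro sum_over_cong) (auto simp: sweedler_sw[where U = D.C and V = D.C])
  finally show ?thesis by simp
qed

lemma cotensor_incl_eq:
  "t \<in> carrier (QN \<^bold>\<otimes> D.C) \<Longrightarrow> cotensor_incl K D N t = sw QN D.C (VN \<^bold>\<otimes> D.C) t (\<lambda>x c. pt VN D.C x c)"
  unfolding cotensor_incl_def pt_def[symmetric] by (intro sweedler_sw) simp_all

lemma cotensor_act_closed:
  "a \<in> carrier D.A \<Longrightarrow> x \<in> carrier QN \<Longrightarrow> coind_act N (mod_act N) a x \<in> carrier QN"
  by (simp add: cotensor_carrier cot_act_eq[OF N_struct])

text \<open>By exactness, the coaction of the coinduced module maps the cotensor product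
  \<open>N \<box> C\<close> into \<open>(N \<box> C) \<otimes> C\<close>.\<close>

lemma cotensor_coact_ex1:
  assumes x: "x \<in> carrier QN"
  shows "\<exists>!t. t \<in> carrier (QN \<^bold>\<otimes> D.C) \<and> cotensor_incl K D N t = coind_coact N x"
proof (rule ex_ex1I)
  let ?P = "N \<^bold>\<otimes> D'.C \<^bold>\<otimes> D.C"
  have xV: "x \<in> carrier VN" and eq: "cot_left N x = cot_right N (mod_coact N) x"
    using x by (auto simp: cotensor_carrier)
  have "sw VN D.C (?P \<^bold>\<otimes> D.C) (coind_coact N x) (\<lambda>v c. pt ?P D.C (cot_left N v) c) =
      sw VN D.C (?P \<^bold>\<otimes> D.C) (coind_coact N x) (\<lambda>v c. pt ?P D.C (cot_right N (mod_coact N) v) c)"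
    by (simp add: cot_coact_eq[OF N_struct xV] eq)
  then obtain xs where xs: "set xs \<subseteq> {v \<in> carrier VN. cot_left N v = cot_right N (mod_coact N) v} \<times> carrier D.C"
      "coind_coact N x = tensor_class K VN D.C xs"
    using xV by (rule_tac tensor_equalizer[OF _ _ _ cot_left_lin[OF N_struct] cot_right_lin[OF N_struct]]) auto
  have ok: "set xs \<subseteq> carrier QN \<times> carrier D.C" "set xs \<subseteq> carrier VN \<times> carrier D.C"
    using xs(1) by (auto simp: cotensor_carrier)
  have t: "tensor_class K QN D.C xs \<in> carrier (QN \<^bold>\<otimes> D.C)"
    by (rule tensor_class_in[OF _ _ ok(1)]) simp_all
  have "sw QN D.C (VN \<^bold>\<otimes> D.C) (tensor_class K QN D.C xs) (\<lambda>x c. pt VN D.C x c) =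
      sum_over (VN \<^bold>\<otimes> D.C) xs (\<lambda>x c. pt VN D.C x c)"
    by (rule sw_tensor_class) (use ok in simp_all)
  also have "\<dots> = tensor_class K VN D.C xs"
    by (rule tensor_class_sum[symmetric, OF _ _ ok(2)]) simp_all
  finally show "\<exists>t. t \<in> carrier (QN \<^bold>\<otimes> D.C) \<and> cotensor_incl K D N t = coind_coact N x"
    using t xs(2) by (auto simp: cotensor_incl_eq)
next
  fix s t assume s: "s \<in> carrier (QN \<^bold>\<otimes> D.C) \<and> cotensor_incl K D N s = coind_coact N x"
    and t: "t \<in> carrier (QN \<^bold>\<otimes> D.C) \<and> cotensor_incl K D N t = coind_coact N x"
  have hs: "hs QN" "hs VN" "hs D.C" by simp_all
  show "s = t"
  proof (rule tensor_inj[OF hs lin_cotensor inj_QN])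
    show "sw QN D.C (VN \<^bold>\<otimes> D.C) s (\<lambda>x c. pt VN D.C x c) = sw QN D.C (VN \<^bold>\<otimes> D.C) t (\<lambda>x c. pt VN D.C x c)"
      using s t cotensor_incl_eq by metis
  qed (use s t in blast)+
qed

abbreviation "GN \<equiv> on_obj (cotensor_functor K D D' \<beta> \<gamma>) N"

private lemma GN: "GN = hom_space.extend QN (dh_module.fields
    (\<lambda>a x. cotensor_act_formula K D \<beta> N a (summands x))
    (\<lambda>x. THE t. t \<in> carrier (QN \<^bold>\<otimes> D.C) \<and> cotensor_incl K D N t = cotensor_coact_formula K D N (summands x)))"
  by (simp add: cotensor_functor_def Let_def)

lemma cotensor_object [simp]: "carrier GN = carrier QN" "twist GN = twist VN" "hs GN"
  "tensor K GN W = tensor K QN W" "lin GN W' f = lin QN W' f" "lin W' GN f = lin W' QN f"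
  "sw GN U R = sw QN U R" "pt GN W = pt QN W"
  by (simp_all add: GN)

lemma cotensor_object_act [simp]:
  assumes "a \<in> carrier D.A" "x \<in> carrier QN"
  shows "mod_act GN a x = coind_act N (mod_act N) a x"
proof -
  have x: "x \<in> carrier VN" using assms(2) by (simp add: cotensor_carrier)
  then obtain xs where xs: "set xs \<subseteq> carrier N \<times> carrier D.C" "x = tensor_class K N D.C xs" "summands x = xs"
    by (rule_tac tensor_cases[OF _ _ x]) auto
  then show ?thesis using assms(1) by (simp add: GN cotensor_act_formula_eq)
qed

lemma cotensor_object_coact:
  assumes "x \<in> carrier QN"
  shows "mod_coact GN x \<in> carrier (QN \<^bold>\<otimes> D.C)" "cotensor_incl K D N (mod_coact GN x) = coind_coact N x"
proof -
  have x: "x \<in> carrier VN" using assms by (simp add: cotensor_carrier)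
  then obtain xs where xs: "set xs \<subseteq> carrier N \<times> carrier D.C" "x = tensor_class K N D.C xs" "summands x = xs"
    by (rule_tac tensor_cases[OF _ _ x]) auto
  then have "cotensor_coact_formula K D N (summands x) = coind_coact N x"
    by (simp add: cotensor_coact_formula_eq)
  then show "mod_coact GN x \<in> carrier (QN \<^bold>\<otimes> D.C)" "cotensor_incl K D N (mod_coact GN x) = coind_coact N x"
    using theI'[OF cotensor_coact_ex1[OF assms]] by (simp_all add: GN)
qed

lemma cotensor_object_incl:
  "x \<in> carrier QN \<Longrightarrow> sw QN D.C (VN \<^bold>\<otimes> D.C) (mod_coact GN x) (\<lambda>x c. pt VN D.C x c) = coind_coact N x"
  using cotensor_incl_eq cotensor_object_coact by metis

lemma cotensor_doi_hopf_module: "doi_hopf_module K D GN"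
  unfolding D.doi_hopf_module_iff
  by (rule D.dh_struct_sub[OF coind_dh_struct[OF N_struct], where i = "\<lambda>x. x"])
     (simp_all add: cotensor_object_coact cotensor_object_incl lin_cotensor cotensor_act_closed)

lemma cotensor_inclusion:
  "D.dh_map GN (mod_act GN) (mod_coact GN) VN (coind_act N (mod_act N)) (coind_coact N) (\<lambda>x. x)"
  unfolding D.dh_map_def by (simp add: cotensor_object_incl lin_cotensor)

end


section \<open>The balanced tensor product\<close>

context
  fixes M :: "('k, 'u) dh_module"
  assumes M: "doi_hopf_module K D M"
begin

private lemmas M_struct = M[unfolded D.doi_hopf_module_iff]
private lemmas [simp] = D.dh_rules[OF M_struct]
abbreviation "VM \<equiv> D'.A \<^bold>\<otimes> M"
abbreviation "QM \<equiv> balanced_tensor K D D' \<beta> M"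
private abbreviation "B \<equiv> balancing K D D' \<beta> M"
abbreviation "pM \<equiv> coset_rep VM B"
private lemma hs_VM: "hs VM" by simp
private lemmas [simp] =
  bilin_rules[OF ind_act_bilin[OF M_struct] algebra_hs[OF D'.algebra_A] hs_VM hs_VM]
  lin_rules[OF ind_coact_lin[OF M_struct]] ind_act_pt[OF M_struct] ind_coact_pt[OF M_struct]

interpretation VM: Module.module K VM by (rule hs_module[OF hs_VM])

private definition gens where
  "gens = {pt D'.A M (b \<otimes>\<^bsub>D'.A\<^esub> \<beta> a) (twist M m) \<ominus>\<^bsub>VM\<^esub> pt D'.A M (twist D'.A b) (mod_act M a m)
        | b a m. b \<in> carrier D'.A \<and> a \<in> carrier D.A \<and> m \<in> carrier M}"

private lemma B_hull: "B = (\<lambda>W. submodule W K VM) hull gens"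
  by (simp add: balancing_def Let_def gens_def pt_def)

private lemma gens_closed: "gens \<subseteq> carrier VM"
  by (auto simp: gens_def)

lemma balancing_subspace: "submodule B K VM"
proof -
  note sD = subspaceD[OF VM.module_axioms]
  have "submodule (carrier VM) K VM" by (rule VM.carrier_is_submodule)
  then show ?thesis
    unfolding B_hull hull_def using gens_closed
    by (intro subspaceI[OF VM.module_axioms]) (auto intro: sD(2-4) simp del: tensor_simps)
qed

lemma balancing_generator:
  "b \<in> carrier D'.A \<Longrightarrow> a \<in> carrier D.A \<Longrightarrow> m \<in> carrier M \<Longrightarrow>
    pt D'.A M (b \<otimes>\<^bsub>D'.A\<^esub> \<beta> a) (twist M m) \<ominus>\<^bsub>VM\<^esub> pt D'.A M (twist D'.A b) (mod_act M a m) \<in> B"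
  unfolding B_hull by (rule hull_inc) (auto simp: gens_def)

lemma balancing_minimal: "submodule W K VM \<Longrightarrow> gens \<subseteq> W \<Longrightarrow> B \<subseteq> W"
  unfolding B_hull by (rule hull_minimal)

text \<open>The kernel of \<open>f\<close> is a subspace, so that it contains \<open>B\<close> if it contains the generators.\<close>

lemma balancing_vanish:
  assumes X: "hs X" and f: "lin VM X f"
    and eq: "\<And>b a m. b \<in> carrier D'.A \<Longrightarrow> a \<in> carrier D.A \<Longrightarrow> m \<in> carrier M \<Longrightarrow>
      f (pt D'.A M (b \<otimes>\<^bsub>D'.A\<^esub> \<beta> a) (twist M m)) = f (pt D'.A M (twist D'.A b) (mod_act M a m))"
    and w: "w \<in> B"
  shows "f w = \<zero>\<^bsub>X\<^esub>"
proof -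
  interpret X: Module.module K X by (rule hs_module[OF X])
  have "submodule {v \<in> carrier VM. f v = \<zero>\<^bsub>X\<^esub>} K VM"
    by (rule equalizer_subspace[OF hs_VM X f lin_zero_map[OF X]])
  moreover have "gens \<subseteq> {v \<in> carrier VM. f v = \<zero>\<^bsub>X\<^esub>}"
    using lin_closed[OF f] by (auto simp: gens_def lin_minus[OF hs_VM X f] eq a_minus_def[of X] X.M.r_neg)
  ultimately have "B \<subseteq> {v \<in> carrier VM. f v = \<zero>\<^bsub>X\<^esub>}" by (rule balancing_minimal)
  then show ?thesis using w by auto
qed

private lemma preimage_subspace:
  assumes "lin VM VM f"
  shows "submodule {v \<in> carrier VM. f v \<in> B} K VM"
  using subspaceD(2-4)[OF VM.module_axioms balancing_subspace] lin_zero[OF hs_VM hs_VM assms]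
  by (intro subspaceI[OF VM.module_axioms]) (auto simp: lin_add[OF assms] lin_smult[OF assms])

text \<open>The preimage of \<open>B\<close> under \<open>\<alpha>\<close>, or \<open>\<alpha>\<^sup>-\<^sup>1\<close>, is a subspace that contains the generators, as
  \<open>\<alpha>\<close> permutes these.\<close>

lemma balancing_twist: "w \<in> B \<Longrightarrow> twist VM w \<in> B" "w \<in> B \<Longrightarrow> untwist VM w \<in> B"
proof -
  have "B \<subseteq> {v \<in> carrier VM. twist VM v \<in> B}"
  proof (rule balancing_minimal[OF preimage_subspace[OF lin_twist[OF hs_VM]]])
    show "gens \<subseteq> {v \<in> carrier VM. twist VM v \<in> B}"
    proof
      fix w assume w: "w \<in> gens"
      then obtain b a m where bam: "b \<in> carrier D'.A" "a \<in> carrier D.A" "m \<in> carrier M"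
        and w_eq: "w = pt D'.A M (b \<otimes>\<^bsub>D'.A\<^esub> \<beta> a) (twist M m) \<ominus>\<^bsub>VM\<^esub> pt D'.A M (twist D'.A b) (mod_act M a m)"
        by (auto simp: gens_def)
      have "twist VM w \<in> B"
        using balancing_generator[of "twist D'.A b" "twist D.A a" "twist M m"] bam
        by (simp add: w_eq lin_minus[OF hs_VM hs_VM lin_twist[OF hs_VM]])
      then show "w \<in> {v \<in> carrier VM. twist VM v \<in> B}" using w gens_closed by auto
    qed
  qed
  then show "w \<in> B \<Longrightarrow> twist VM w \<in> B" by auto
  have "B \<subseteq> {v \<in> carrier VM. untwist VM v \<in> B}"
  proof (rule balancing_minimal[OF preimage_subspace[OF lin_untwist[OF hs_VM]]])
    show "gens \<subseteq> {v \<in> carrier VM. untwist VM v \<in> B}"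
    proof
      fix w assume w: "w \<in> gens"
      then obtain b a m where bam: "b \<in> carrier D'.A" "a \<in> carrier D.A" "m \<in> carrier M"
        and w_eq: "w = pt D'.A M (b \<otimes>\<^bsub>D'.A\<^esub> \<beta> a) (twist M m) \<ominus>\<^bsub>VM\<^esub> pt D'.A M (twist D'.A b) (mod_act M a m)"
        by (auto simp: gens_def)
      have "untwist VM w \<in> B"
        using balancing_generator[of "untwist D'.A b" "untwist D.A a" "untwist M m"] bam
        by (simp add: w_eq lin_minus[OF hs_VM hs_VM lin_untwist[OF hs_VM]])
      then show "w \<in> {v \<in> carrier VM. untwist VM v \<in> B}" using w gens_closed by auto
    qed
  qed
  then show "w \<in> B \<Longrightarrow> untwist VM w \<in> B" by auto
qed

private lemmas quotient_facts = hs_VM balancing_subspace balancing_twist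

lemma balanced_eq: "QM = quotient_space VM B" by (simp add: balanced_tensor_def)

lemma pure_balanced_eq: "pure_balanced K D D' \<beta> M b m = pM (pt D'.A M b m)"
  by (simp add: pure_balanced_def pt_def)

lemma hs_balanced: "hs QM"
  unfolding balanced_eq by (rule hs_quotient[OF quotient_facts])

lemma lin_balanced: "lin VM QM pM"
  unfolding balanced_eq by (rule lin_coset_rep[OF quotient_facts])

lemma balanced_carrier: "carrier QM = pM ` carrier VM"
  unfolding balanced_eq by (simp add: quotient_simps[OF quotient_facts])

lemma balanced_twist: "v \<in> carrier VM \<Longrightarrow> twist QM (pM v) = pM (twist VM v)"
  unfolding balanced_eq by (rule coset_rep_twist[OF quotient_facts])

lemma balanced_closed: "v \<in> carrier VM \<Longrightarrow> pM v \<in> carrier VM"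
  by (rule coset_rep_minus(1)[OF quotient_facts])

lemma balanced_subset: "q \<in> carrier QM \<Longrightarrow> q \<in> carrier VM" "q \<in> carrier QM \<Longrightarrow> pM q = q"
  unfolding balanced_carrier by (auto simp: balanced_closed coset_rep_idem[OF quotient_facts])

lemma balanced_relation:
  "b \<in> carrier D'.A \<Longrightarrow> a \<in> carrier D.A \<Longrightarrow> m \<in> carrier M \<Longrightarrow>
    pM (pt D'.A M (b \<otimes>\<^bsub>D'.A\<^esub> \<beta> a) (twist M m)) = pM (pt D'.A M (twist D'.A b) (mod_act M a m))"
  by (rule coset_rep_eq[OF quotient_facts]) (simp_all add: balancing_generator)

text \<open>The universal property of \<open>A' \<otimes>\<^sub>A M\<close>. Since elements of the quotient are themselves elements
  of \<open>A' \<otimes> M\<close>, the map induced by \<open>f\<close> is the restriction of \<open>f\<close>.\<close>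

lemma balanced_respects:
  assumes "hs X" "lin VM X f"
    and "\<And>b a m. b \<in> carrier D'.A \<Longrightarrow> a \<in> carrier D.A \<Longrightarrow> m \<in> carrier M \<Longrightarrow>
      f (pt D'.A M (b \<otimes>\<^bsub>D'.A\<^esub> \<beta> a) (twist M m)) = f (pt D'.A M (twist D'.A b) (mod_act M a m))"
    and "v \<in> carrier VM"
  shows "f (pM v) = f v"
  by (rule coset_rep_respects[OF quotient_facts assms(1,2) balancing_vanish[OF assms(1-3)] assms(4)])

private lemmas [simp] = hs_balanced lin_rules[OF lin_balanced hs_VM hs_balanced] balanced_closed

abbreviation "FM \<equiv> on_obj (induction_functor K D D' \<beta> \<gamma>) M"

private lemma FM: "FM = hom_space.extend QM (dh_module.fields
    (\<lambda>a q. sweedler QM q (\<lambda>b m. pM (pt D'.A M (twist D'.A a \<otimes>\<^bsub>D'.A\<^esub> b) (twist M m))))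
    (\<lambda>q. sweedler (QM \<^bold>\<otimes> D'.C) q (\<lambda>b m. sweedler (QM \<^bold>\<otimes> D'.C) (alg_coact D'.A b) (\<lambda>b0 b1.
      sweedler (QM \<^bold>\<otimes> D'.C) (mod_coact M m) (\<lambda>m0 m1. pt QM D'.C (pM (pt D'.A M b0 m0))
        (untwist D'.C (untwist D'.C (coalg_act D'.C b1 (\<gamma> m1)))))))))"
  by (simp add: induction_functor_def Let_def pure_balanced_eq pt_def[of QM])

lemma balanced_object [simp]: "carrier FM = carrier QM" "twist FM = twist QM" "hs FM"
  "tensor K FM W = tensor K QM W" "lin FM W' f = lin QM W' f" "lin W' FM f = lin W' QM f"
  "sw FM U R = sw QM U R" "pt FM W = pt QM W"
  by (simp_all add: FM)

lemma balanced_object_act: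
  assumes a: "a \<in> carrier D'.A" and v: "v \<in> carrier VM"
  shows "mod_act FM a (pM v) = pM (ind_act M a v)"
proof -
  have "mod_act FM a (pM v) = sw D'.A M QM (pM v) (\<lambda>b m. pM (pt D'.A M (twist D'.A a \<otimes>\<^bsub>D'.A\<^esub> b) (twist M m)))"
    using a v by (simp add: FM) (intro sweedler_sw; simp)
  also have "\<dots> = pM (ind_act M a (pM v))"
    using a v by (simp add: ind_act_def)
  also have "\<dots> = pM (ind_act M a v)"
    by (rule balanced_respects[where X = QM and f = "\<lambda>v. pM (ind_act M a v)"])
       (rule ind_act_balanced[OF M_struct hs_balanced lin_balanced balanced_relation, OF _ _ _ a] |
           use a v in simp)+
  finally show ?thesis .
qed

lemma balanced_object_coact:
  assumes v: "v \<in> carrier VM"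
  shows "mod_coact FM (pM v) = sw VM D'.C (QM \<^bold>\<otimes> D'.C) (ind_coact M (mod_coact M) v)
      (\<lambda>x y. pt QM D'.C (pM x) y)"
proof -
  have "mod_coact FM (pM v) = sw D'.A M (QM \<^bold>\<otimes> D'.C) (pM v) (\<lambda>b m.
    sw D'.A D'.H (QM \<^bold>\<otimes> D'.C) (alg_coact D'.A b) (\<lambda>b0 b1.
      sw M D.C (QM \<^bold>\<otimes> D'.C) (mod_coact M m) (\<lambda>m0 m1.
        pt QM D'.C (pM (pt D'.A M b0 m0)) (untwist D'.C (untwist D'.C (coalg_act D'.C b1 (\<gamma> m1)))))))"
    using v by (simp add: FM) (intro sweedler_sw_cong; simp add:
        sweedler_sw_cong[where U = D'.A and V = D'.H] sweedler_sw[where U = M and V = D.C])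
  also have "\<dots> = sw VM D'.C (QM \<^bold>\<otimes> D'.C) (ind_coact M (mod_coact M) (pM v)) (\<lambda>x y. pt QM D'.C (pM x) y)"
    using v by (simp add: ind_coact_def)
  also have "\<dots> = sw VM D'.C (QM \<^bold>\<otimes> D'.C) (ind_coact M (mod_coact M) v) (\<lambda>x y. pt QM D'.C (pM x) y)"
    by (rule balanced_respects[where X = "QM \<^bold>\<otimes> D'.C" and f = "\<lambda>v. sw VM D'.C (QM \<^bold>\<otimes> D'.C) (ind_coact M (mod_coact M) v) (\<lambda>x y. pt QM D'.C (pM x) y)"])
       (rule ind_coact_balanced[OF M_struct hs_balanced lin_balanced balanced_relation]; assumption
           | use v in simp)+
  finally show ?thesis .
qed

lemma balanced_doi_hopf_module: "doi_hopf_module K D' FM"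
  unfolding D'.doi_hopf_module_iff
proof (rule D'.dh_struct_quotient[OF ind_dh_struct[OF M_struct], where p = pM])
  show "mod_coact FM (pM v) = sw VM D'.C (FM \<^bold>\<otimes> D'.C) (ind_coact M (mod_coact M) v) (\<lambda>x y. pt FM D'.C (pM x) y)"
    if "v \<in> carrier VM" for v
    unfolding balanced_object by (rule balanced_object_coact[OF that])
qed (simp_all add: balanced_carrier balanced_twist balanced_object_act lin_balanced)

lemma balanced_projection:
  "D'.dh_map VM (ind_act M) (ind_coact M (mod_coact M)) FM (mod_act FM) (mod_coact FM) pM"
  unfolding D'.dh_map_def balanced_object
  by (simp add: balanced_twist balanced_object_act balanced_object_coact lin_balanced)

end

end

lemma doi_hopf_category_simps [simp]:
  "Obj (doi_hopf_category K D) = {M. doi_hopf_module K D M}"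
  "Hom (doi_hopf_category K D) = doi_hopf_hom K D"
  "Ident (doi_hopf_category K D) M = (\<lambda>m\<in>carrier M. m)"
  "Comp (doi_hopf_category K D) L M N g f = compose (carrier L) g f"
  by (simp_all add: doi_hopf_category_def)


section \<open>The two functors\<close>

context dh_datum
begin

lemma doi_hopf_homD:
  assumes "doi_hopf_module K D M" "doi_hopf_module K D N" "f \<in> doi_hopf_hom K D M N"
  shows "f \<in> extensional (carrier M)" "dh_map M (mod_act M) (mod_coact M) N (mod_act N) (mod_coact N) f"
  using assms(3) unfolding doi_hopf_hom_iff[OF assms(1,2)] by auto

lemma restrict_hom:
  assumes M: "doi_hopf_module K D M" and N: "doi_hopf_module K D N"
    and f: "dh_map M (mod_act M) (mod_coact M) N (mod_act N) (mod_coact N) f"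
  shows "restrict f (carrier M) \<in> doi_hopf_hom K D M N"
  unfolding doi_hopf_hom_iff[OF M N]
  using dh_map_cong[OF M[unfolded doi_hopf_module_iff] _ f, of "restrict f (carrier M)"] by simp

lemma dh_map_rules:
  assumes S: "dh_struct M act \<rho>" "dh_struct N act' \<rho>'" and f: "dh_map M act \<rho> N act' \<rho>' f"
  shows "m \<in> carrier M \<Longrightarrow> twist N (f m) = f (twist M m)"
    "m \<in> carrier M \<Longrightarrow> untwist N (f m) = f (untwist M m)"
    "a \<in> carrier A \<Longrightarrow> m \<in> carrier M \<Longrightarrow> f (act a m) = act' a (f m)"
    "m \<in> carrier M \<Longrightarrow> \<rho>' (f m) = sw M C (N \<^bold>\<otimes> C) (\<rho> m) (\<lambda>x y. pt N C (f x) y)"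
    "lin X M g \<Longrightarrow> lin X N (\<lambda>x. f (g x))"
    "x \<in> carrier M \<Longrightarrow> f x \<in> carrier N"
    "(\<And>x y. x \<in> carrier U' \<Longrightarrow> y \<in> carrier V' \<Longrightarrow> h x y \<in> carrier M) \<Longrightarrow>
      f (sw U' V' M t h) = sw U' V' N t (\<lambda>x y. f (h x y))"
    "c \<in> carrier K \<Longrightarrow> x \<in> carrier M \<Longrightarrow> f (c \<odot>\<^bsub>M\<^esub> x) = c \<odot>\<^bsub>N\<^esub> f x"
proof -
  note hs = dh_hs[OF S(1)] dh_hs[OF S(2)] and r = lin_rules[OF dh_mapD(1)[OF f] dh_hs[OF S(1)] dh_hs[OF S(2)]]
  show "m \<in> carrier M \<Longrightarrow> twist N (f m) = f (twist M m)" by (simp add: dh_mapD(2)[OF f])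
  show "m \<in> carrier M \<Longrightarrow> untwist N (f m) = f (untwist M m)"
    by (rule untwist_unique) (simp_all add: hs r flip: dh_mapD(2)[OF f])
qed (fact dh_mapD(3,4)[OF f] lin_rules[OF dh_mapD(1)[OF f] dh_hs[OF S(1)] dh_hs[OF S(2)]])+

end

context dh_morphism
begin

context
  fixes N N' :: "('k, 'u) dh_module" and f
  assumes N: "doi_hopf_module K D' N" and N': "doi_hopf_module K D' N'"
    and f: "D'.dh_map N (mod_act N) (mod_coact N) N' (mod_act N') (mod_coact N') f"
begin

private lemmas N_structs = N[unfolded D'.doi_hopf_module_iff] N'[unfolded D'.doi_hopf_module_iff]
private lemmas coind_structs = coind_dh_struct[OF N_structs(1)] coind_dh_struct[OF N_structs(2)]
private lemmas [simp] = D'.dh_rules[OF N_structs(1)] D'.dh_rules[OF N_structs(2)]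
  D'.dh_map_rules[OF N_structs f] D.dh_rules[OF coind_structs(1)] D.dh_rules[OF coind_structs(2)]
  coind_act_pt[OF N_structs(1)] coind_act_pt[OF N_structs(2)] coind_coact_pt[OF N_structs(1)]
      coind_coact_pt[OF N_structs(2)]
  lin_rules[OF cot_left_lin[OF N_structs(1)]] lin_rules[OF cot_right_lin[OF N_structs(1)]]
  lin_rules[OF cot_left_lin[OF N_structs(2)]] lin_rules[OF cot_right_lin[OF N_structs(2)]]
  cot_left_pt[OF N_structs(1)] cot_right_pt[OF N_structs(1)] cot_left_pt[OF N_structs(2)]
      cot_right_pt[OF N_structs(2)]

text \<open>The map \<open>f \<otimes> id\<close>, on all of \<open>N \<otimes> C\<close>.\<close>

definition coind_map :: "'u \<Rightarrow> 'u"
  where "coind_map x = sw N D.C (VN N') x (\<lambda>n c. pt N' D.C (f n) c)"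

lemma coind_map_lin: "lin (VN N) (VN N') coind_map"
  unfolding coind_map_def by simp

private lemmas [simp] = lin_rules[OF coind_map_lin]

lemma coind_map_pt [simp]: "n \<in> carrier N \<Longrightarrow> c \<in> carrier D.C \<Longrightarrow> coind_map (pt N D.C n c) = pt N' D.C (f n) c"
  by (simp add: coind_map_def)

lemma coind_map_dh_map:
  "D.dh_map (VN N) (coind_act N (mod_act N)) (coind_coact N) (VN N') (coind_act N' (mod_act N'))
      (coind_coact N') coind_map"
  unfolding D.dh_map_def
proof (intro conjI ballI)
  show "lin (VN N) (VN N') coind_map" by (rule coind_map_lin)
  fix m assume m: "m \<in> carrier (VN N)"
  show "coind_map (twist (VN N) m) = twist (VN N') (coind_map m)"
    by (rule tensor_ext[OF _ _ _ _ _ _ m, where P = "VN N'"]) simp_all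
  show "coind_map (coind_act N (mod_act N) a m) = coind_act N' (mod_act N') a (coind_map m)"
    if "a \<in> carrier D.A" for a
    by (rule tensor_ext[OF _ _ _ _ _ _ m, where P = "VN N'"]) (use that in simp_all)
  show "coind_coact N' (coind_map m) =
      sw (VN N) D.C (VN N' \<^bold>\<otimes> D.C) (coind_coact N m) (\<lambda>x y. pt (VN N') D.C (coind_map x) y)"
    by (rule tensor_ext[OF _ _ _ _ _ _ m, where P = "VN N' \<^bold>\<otimes> D.C"]) simp_all
qed

lemma coind_map_cotensor:
  assumes "x \<in> carrier (QN N)"
  shows "coind_map x \<in> carrier (QN N')"
proof -
  have x: "x \<in> carrier (VN N)" "cot_left N x = cot_right N (mod_coact N) x"
    using assms by (auto simp: cotensor_carrier[OF N])
  let ?P' = "N' \<^bold>\<otimes> D'.C \<^bold>\<otimes> D.C"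
  \<comment> \<open>\<open>f \<otimes> id\<close> commutes with both maps that define the cotensor product.\<close>
  have "cot_left N' (coind_map x) = sw N (D'.C \<^bold>\<otimes> D.C) ?P' (cot_left N x) (\<lambda>n u. pt N' (D'.C \<^bold>\<otimes> D.C) (f n) u)"
    by (rule tensor_ext[OF _ _ _ _ _ _ x(1), where P = ?P']) simp_all
  moreover have "cot_right N' (mod_coact N') (coind_map x) =
      sw N (D'.C \<^bold>\<otimes> D.C) ?P' (cot_right N (mod_coact N) x) (\<lambda>n u. pt N' (D'.C \<^bold>\<otimes> D.C) (f n) u)"
    by (rule tensor_ext[OF _ _ _ _ _ _ x(1), where P = ?P']) simp_all
  ultimately show ?thesis using x by (simp add: cotensor_carrier[OF N'])
qed

lemma cotensor_functor_hom:
  "x \<in> carrier (QN N) \<Longrightarrow> on_hom (cotensor_functor K D D' \<beta> \<gamma>) N N' f x = coind_map x"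
  by (simp add: cotensor_functor_def coind_map_def pt_def[symmetric] cotensor_carrier[OF N]
      sweedler_sw[where U = N and V = D.C])

lemma cotensor_functor_hom_in:
  "on_hom (cotensor_functor K D D' \<beta> \<gamma>) N N' f \<in> doi_hopf_hom K D (GN N) (GN N')"
proof -
  note G = cotensor_doi_hopf_module[OF N] cotensor_doi_hopf_module[OF N']
  note G_structs = G[unfolded D.doi_hopf_module_iff]
  have "D.dh_map (GN N) (mod_act (GN N)) (mod_coact (GN N)) (GN N') (mod_act (GN N')) (mod_coact (GN
      N')) coind_map"
    by (rule D.dh_map_into_sub[OF G_structs coind_structs(2) cotensor_inclusion[OF N'] _ _
          D.dh_map_comp[OF G_structs(1) coind_structs cotensor_inclusion[OF N] coind_map_dh_map]])
       (simp_all add: cotensor_object[OF N] cotensor_object[OF N'] coind_map_cotensor)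
  from D.restrict_hom[OF G this]
  have "restrict coind_map (carrier (QN N)) \<in> doi_hopf_hom K D (GN N) (GN N')"
    by (simp add: cotensor_object[OF N])
  moreover have "on_hom (cotensor_functor K D D' \<beta> \<gamma>) N N' f = restrict coind_map (carrier (QN N))"
    by (rule ext) (simp add: cotensor_functor_hom restrict_def, simp add: cotensor_functor_def)
  ultimately show ?thesis by simp
qed

end

lemma is_functor_cotensor:
  "is_functor (doi_hopf_category K D') (doi_hopf_category K D) (cotensor_functor K D D' \<beta> \<gamma>)"
  (is "is_functor _ _ ?G")
  unfolding is_functor_def doi_hopf_category_simps
proof (intro conjI ballI D.is_category_doi_hopf D'.is_category_doi_hopf; clarify)
  show "doi_hopf_module K D (on_obj ?G N)" if "doi_hopf_module K D' N" for N
    by (rule cotensor_doi_hopf_module[OF that])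
  show "on_hom ?G X Y f \<in> doi_hopf_hom K D (on_obj ?G X) (on_obj ?G Y)"
    if "doi_hopf_module K D' X" "doi_hopf_module K D' Y" "f \<in> doi_hopf_hom K D' X Y" for X Y f
    by (rule cotensor_functor_hom_in[OF that(1,2) D'.doi_hopf_homD(2)[OF that]])
next
  fix X assume X: "doi_hopf_module K D' X"
  note dX = X[unfolded D'.doi_hopf_module_iff]
  note [simp] = D'.dh_rules[OF dX]
  have id: "D'.dh_map X (mod_act X) (mod_coact X) X (mod_act X) (mod_coact X) (\<lambda>m\<in>carrier X. m)"
    by (rule D'.dh_map_cong[OF dX _ D'.dh_map_id[OF dX]]) simp
  show "on_hom ?G X X (\<lambda>m\<in>carrier X. m) = (\<lambda>m\<in>carrier (on_obj ?G X). m)"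
  proof (rule ext)
    fix x
    show "on_hom ?G X X (\<lambda>m\<in>carrier X. m) x = (\<lambda>m\<in>carrier (on_obj ?G X). m) x"
    proof (cases "x \<in> carrier (QN X)")
      case True
      then have "x \<in> carrier (VN X)" by (simp add: cotensor_carrier[OF X])
      then show ?thesis using True
        by (simp add: cotensor_functor_hom[OF X X id] coind_map_def[OF X X id] cotensor_object[OF X])
    qed (simp add: cotensor_functor_def Let_def)
  qed
next
  fix X Y Z f g
  assume X: "doi_hopf_module K D' X" and Y: "doi_hopf_module K D' Y" and Z: "doi_hopf_module K D' Z"
    and f: "f \<in> doi_hopf_hom K D' X Y" and g: "g \<in> doi_hopf_hom K D' Y Z"
  note f' = D'.doi_hopf_homD(2)[OF X Y f] and g' = D'.doi_hopf_homD(2)[OF Y Z g]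
  note d = X[unfolded D'.doi_hopf_module_iff] Y[unfolded D'.doi_hopf_module_iff]
      Z[unfolded D'.doi_hopf_module_iff]
  note [simp] = D'.dh_rules[OF d(1)] D'.dh_rules[OF d(2)] D'.dh_rules[OF d(3)]
    D'.dh_map_rules[OF d(1,2) f'] D'.dh_map_rules[OF d(2,3) g']
  have gf: "D'.dh_map X (mod_act X) (mod_coact X) Z (mod_act Z) (mod_coact Z) (compose (carrier X) g f)"
    by (rule D'.dh_map_cong[OF d(1) _ D'.dh_map_comp[OF d f' g']]) (simp add: compose_def)
  show "on_hom ?G X Z (compose (carrier X) g f) =
      compose (carrier (on_obj ?G X)) (on_hom ?G Y Z g) (on_hom ?G X Y f)"
  proof (rule ext)
    fix x
    show "on_hom ?G X Z (compose (carrier X) g f) x =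
      compose (carrier (on_obj ?G X)) (on_hom ?G Y Z g) (on_hom ?G X Y f) x"
    proof (cases "x \<in> carrier (QN X)")
      case True
      then have x: "x \<in> carrier (VN X)" by (simp add: cotensor_carrier[OF X])
      have "compose (carrier (on_obj ?G X)) (on_hom ?G Y Z g) (on_hom ?G X Y f) x =
          coind_map Y Z g (coind_map X Y f x)"
        using True coind_map_cotensor[OF X Y f' True]
        by (simp add: compose_def cotensor_object[OF X] cotensor_functor_hom[OF X Y f']
            cotensor_functor_hom[OF Y Z g'])
      also have "\<dots> = coind_map X Z (compose (carrier X) g f) x"
        unfolding coind_map_def[OF X Y f'] coind_map_def[OF Y Z g'] coind_map_def[OF X Z gf]
        using x by (simp add: compose_def)
      also have "\<dots> = on_hom ?G X Z (compose (carrier X) g f) x"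
        using True by (simp add: cotensor_functor_hom[OF X Z gf])
      finally show ?thesis by simp
    qed (simp add: cotensor_functor_def Let_def compose_def)
  qed
qed

context
  fixes M M' :: "('k, 'u) dh_module" and f
  assumes M: "doi_hopf_module K D M" and M': "doi_hopf_module K D M'"
    and f: "D.dh_map M (mod_act M) (mod_coact M) M' (mod_act M') (mod_coact M') f"
begin

private lemmas M_structs = M[unfolded D.doi_hopf_module_iff] M'[unfolded D.doi_hopf_module_iff]
private lemmas ind_structs = ind_dh_struct[OF M_structs(1)] ind_dh_struct[OF M_structs(2)]
private lemmas [simp] = D.dh_rules[OF M_structs(1)] D.dh_rules[OF M_structs(2)]
  D.dh_map_rules[OF M_structs f] D'.dh_rules[OF ind_structs(1)] D'.dh_rules[OF ind_structs(2)]
  ind_act_pt[OF M_structs(1)] ind_act_pt[OF M_structs(2)] ind_coact_pt[OF M_structs(1)]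
      ind_coact_pt[OF M_structs(2)]
  hs_balanced[OF M] hs_balanced[OF M']
  lin_rules[OF lin_balanced[OF M] D'.dh_hs[OF ind_structs(1)] hs_balanced[OF M]]
  lin_rules[OF lin_balanced[OF M'] D'.dh_hs[OF ind_structs(2)] hs_balanced[OF M']]

text \<open>The map \<open>id \<otimes> f\<close>, on all of \<open>A' \<otimes> M\<close>.\<close>

definition ind_map :: "'u \<Rightarrow> 'u"
  where "ind_map x = sw D'.A M (VM M') x (\<lambda>b m. pt D'.A M' b (f m))"

lemma ind_map_lin: "lin (VM M) (VM M') ind_map"
  unfolding ind_map_def by simp

private lemmas [simp] = lin_rules[OF ind_map_lin]

lemma ind_map_pt [simp]: "b \<in> carrier D'.A \<Longrightarrow> m \<in> carrier M \<Longrightarrow> ind_map (pt D'.A M b m) = pt D'.A M' b (f m)"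
  by (simp add: ind_map_def)

lemma ind_map_dh_map:
  "D'.dh_map (VM M) (ind_act M) (ind_coact M (mod_coact M)) (VM M') (ind_act M') (ind_coact M'
      (mod_coact M')) ind_map"
  unfolding D'.dh_map_def
proof (intro conjI ballI)
  show "lin (VM M) (VM M') ind_map" by (rule ind_map_lin)
  fix m assume m: "m \<in> carrier (VM M)"
  show "ind_map (twist (VM M) m) = twist (VM M') (ind_map m)"
    by (rule tensor_ext[OF _ _ _ _ _ _ m, where P = "VM M'"]) simp_all
  show "ind_map (ind_act M a m) = ind_act M' a (ind_map m)"
    if "a \<in> carrier D'.A" for a
    by (rule tensor_ext[OF _ _ _ _ _ _ m, where P = "VM M'"]) (use that in simp_all)
  show "ind_coact M' (mod_coact M') (ind_map m) =
      sw (VM M) D'.C (VM M' \<^bold>\<otimes> D'.C) (ind_coact M (mod_coact M) m) (\<lambda>x y. pt (VM M') D'.C (ind_map x) y)"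
    by (rule tensor_ext[OF _ _ _ _ _ _ m, where P = "VM M' \<^bold>\<otimes> D'.C"]) simp_all
qed

lemma induction_functor_hom:
  assumes v: "v \<in> carrier (VM M)"
  shows "on_hom (induction_functor K D D' \<beta> \<gamma>) M M' f (pM M v) = pM M' (ind_map v)"
proof -
  have "on_hom (induction_functor K D D' \<beta> \<gamma>) M M' f (pM M v) =
      sw D'.A M (QM M') (pM M v) (\<lambda>b m. pM M' (pt D'.A M' b (f m)))"
    using v by (simp add: induction_functor_def balanced_carrier[OF M] pure_balanced_eq[OF M']
        balanced_closed[OF M] sweedler_sw[where U = D'.A and V = M])
  also have "\<dots> = pM M' (ind_map (pM M v))"
    using v by (simp add: ind_map_def balanced_closed[OF M])
  also have "\<dots> = pM M' (ind_map v)"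
  proof (rule balanced_respects[OF M, where X = "QM M'" and f = "\<lambda>v. pM M' (ind_map v)"])
    fix b a m assume "b \<in> carrier D'.A" "a \<in> carrier D.A" "m \<in> carrier M"
    then show "pM M' (ind_map (pt D'.A M (b \<otimes>\<^bsub>D'.A\<^esub> \<beta> a) (twist M m))) =
        pM M' (ind_map (pt D'.A M (twist D'.A b) (mod_act M a m)))"
      using balanced_relation[OF M', of b a "f m"] by simp
  qed (use v in simp_all)
  finally show ?thesis .
qed

lemma induction_functor_hom_in:
  "on_hom (induction_functor K D D' \<beta> \<gamma>) M M' f \<in> doi_hopf_hom K D' (FM M) (FM M')"
proof -
  let ?F = "on_hom (induction_functor K D D' \<beta> \<gamma>) M M' f"
  note F = balanced_doi_hopf_module[OF M] balanced_doi_hopf_module[OF M']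
  note F_structs = F[unfolded D'.doi_hopf_module_iff]
  have "D'.dh_map (FM M) (mod_act (FM M)) (mod_coact (FM M)) (FM M') (mod_act (FM M')) (mod_coact (FM M')) ?F"
  proof (rule D'.dh_map_from_quotient[OF ind_structs(1) F_structs balanced_projection[OF M]])
    show "pM M ` carrier (VM M) = carrier (FM M)"
      by (simp add: balanced_object[OF M] balanced_carrier[OF M])
    show "D'.dh_map (VM M) (ind_act M) (ind_coact M (mod_coact M)) (FM M') (mod_act (FM M'))
        (mod_coact (FM M')) (\<lambda>x. ?F (pM M x))"
      by (rule D'.dh_map_cong[OF ind_structs(1) _ D'.dh_map_comp[OF ind_structs F_structs(2) ind_map_dh_map balanced_projection[OF M']]])
         (simp add: induction_functor_hom)
  qed
  from D'.restrict_hom[OF F this]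
  have "restrict ?F (carrier (QM M)) \<in> doi_hopf_hom K D' (FM M) (FM M')"
    by (simp add: balanced_object[OF M])
  moreover have "restrict ?F (carrier (QM M)) = ?F"
    by (rule ext) (simp add: induction_functor_def restrict_def)
  ultimately show ?thesis by simp
qed

end

lemma is_functor_induction:
  "is_functor (doi_hopf_category K D) (doi_hopf_category K D') (induction_functor K D D' \<beta> \<gamma>)"
  (is "is_functor _ _ ?F")
  unfolding is_functor_def doi_hopf_category_simps
proof (intro conjI ballI D.is_category_doi_hopf D'.is_category_doi_hopf; clarify)
  show "doi_hopf_module K D' (on_obj ?F M)" if "doi_hopf_module K D M" for M
    by (rule balanced_doi_hopf_module[OF that])
  show "on_hom ?F X Y f \<in> doi_hopf_hom K D' (on_obj ?F X) (on_obj ?F Y)"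
    if "doi_hopf_module K D X" "doi_hopf_module K D Y" "f \<in> doi_hopf_hom K D X Y" for X Y f
    by (rule induction_functor_hom_in[OF that(1,2) D.doi_hopf_homD(2)[OF that]])
next
  fix X assume X: "doi_hopf_module K D X"
  note dX = X[unfolded D.doi_hopf_module_iff]
  note [simp] = D.dh_rules[OF dX]
  have id: "D.dh_map X (mod_act X) (mod_coact X) X (mod_act X) (mod_coact X) (\<lambda>m\<in>carrier X. m)"
    by (rule D.dh_map_cong[OF dX _ D.dh_map_id[OF dX]]) simp
  show "on_hom ?F X X (\<lambda>m\<in>carrier X. m) = (\<lambda>m\<in>carrier (on_obj ?F X). m)"
  proof (rule ext)
    fix x
    show "on_hom ?F X X (\<lambda>m\<in>carrier X. m) x = (\<lambda>m\<in>carrier (on_obj ?F X). m) x"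
    proof (cases "x \<in> carrier (QM X)")
      case True
      then obtain v where v: "v \<in> carrier (VM X)" "x = pM X v" by (auto simp: balanced_carrier[OF X])
      then show ?thesis using True
        by (simp add: induction_functor_hom[OF X X id] ind_map_def[OF X X id] balanced_object[OF X])
    qed (simp add: balanced_object[OF X], simp add: induction_functor_def)
  qed
next
  fix X Y Z f g
  assume X: "doi_hopf_module K D X" and Y: "doi_hopf_module K D Y" and Z: "doi_hopf_module K D Z"
    and f: "f \<in> doi_hopf_hom K D X Y" and g: "g \<in> doi_hopf_hom K D Y Z"
  note f' = D.doi_hopf_homD(2)[OF X Y f] and g' = D.doi_hopf_homD(2)[OF Y Z g]
  note d = X[unfolded D.doi_hopf_module_iff] Y[unfolded D.doi_hopf_module_iff] Z[unfolded D.doi_hopf_module_iff]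
  note [simp] = D.dh_rules[OF d(1)] D.dh_rules[OF d(2)] D.dh_rules[OF d(3)]
    D.dh_map_rules[OF d(1,2) f'] D.dh_map_rules[OF d(2,3) g']
  have gf: "D.dh_map X (mod_act X) (mod_coact X) Z (mod_act Z) (mod_coact Z) (compose (carrier X) g f)"
    by (rule D.dh_map_cong[OF d(1) _ D.dh_map_comp[OF d f' g']]) (simp add: compose_def)
  show "on_hom ?F X Z (compose (carrier X) g f) =
      compose (carrier (on_obj ?F X)) (on_hom ?F Y Z g) (on_hom ?F X Y f)"
  proof (rule ext)
    fix x
    show "on_hom ?F X Z (compose (carrier X) g f) x =
      compose (carrier (on_obj ?F X)) (on_hom ?F Y Z g) (on_hom ?F X Y f) x"
    proof (cases "x \<in> carrier (QM X)")
      case True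
      then obtain v where v: "v \<in> carrier (VM X)" "x = pM X v" by (auto simp: balanced_carrier[OF X])
      have w: "ind_map X Y f v \<in> carrier (VM Y)"
        using v lin_closed[OF ind_map_lin[OF X Y f']] by simp
      have "compose (carrier (on_obj ?F X)) (on_hom ?F Y Z g) (on_hom ?F X Y f) x =
          pM Z (ind_map Y Z g (ind_map X Y f v))"
        using True v w
        by (simp add: compose_def balanced_object[OF X] induction_functor_hom[OF X Y f']
            induction_functor_hom[OF Y Z g'])
      also have "ind_map Y Z g (ind_map X Y f v) = ind_map X Z (compose (carrier X) g f) v"
        unfolding ind_map_def[OF X Y f'] ind_map_def[OF Y Z g'] ind_map_def[OF X Z gf]
        using v(1) by (simp add: compose_def)
      also have "pM Z \<dots> = on_hom ?F X Z (compose (carrier X) g f) x"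
        using v by (simp add: induction_functor_hom[OF X Z gf])
      finally show ?thesis by simp
    qed (simp add: compose_def balanced_object[OF X], simp add: induction_functor_def)
  qed
qed


section \<open>The adjunction\<close>

text \<open>The linear maps from a module over \<open>(H, A, C)\<close> to one over \<open>(H', A', C')\<close> that are
  compatible with the structures along \<open>\<beta>\<close> and \<open>\<gamma>\<close>. They mediate between the two sides of the
  adjunction.\<close>

definition semilinear :: "('k, 'u) dh_module \<Rightarrow> ('k, 'u) dh_module \<Rightarrow> ('u \<Rightarrow> 'u) set"
  where "semilinear M N = {\<phi> \<in> extensional (carrier M). lin M N \<phi> \<and> (\<forall>m\<in>carrier M.
    \<phi> (twist M m) = twist N (\<phi> m) \<and>
    (\<forall>a\<in>carrier D.A. \<phi> (mod_act M a m) = mod_act N (\<beta> a) (\<phi> m)) \<and>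
    mod_coact N (\<phi> m) = sw M D.C (N \<^bold>\<otimes> D'.C) (mod_coact M m) (\<lambda>x y. pt N D'.C (\<phi> x) (\<gamma> y)))}"

lemma semilinearD:
  assumes "\<phi> \<in> semilinear M N"
  shows "\<phi> \<in> extensional (carrier M)" "lin M N \<phi>"
    "m \<in> carrier M \<Longrightarrow> \<phi> (twist M m) = twist N (\<phi> m)"
    "a \<in> carrier D.A \<Longrightarrow> m \<in> carrier M \<Longrightarrow> \<phi> (mod_act M a m) = mod_act N (\<beta> a) (\<phi> m)"
    "m \<in> carrier M \<Longrightarrow> mod_coact N (\<phi> m) =
      sw M D.C (N \<^bold>\<otimes> D'.C) (mod_coact M m) (\<lambda>x y. pt N D'.C (\<phi> x) (\<gamma> y))"
  using assms by (auto simp: semilinear_def)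

lemma semilinearI:
  assumes "hs M" "\<And>m. m \<in> carrier M \<Longrightarrow> mod_coact M m \<in> carrier (M \<^bold>\<otimes> D.C)"
    "\<And>a m. a \<in> carrier D.A \<Longrightarrow> m \<in> carrier M \<Longrightarrow> mod_act M a m \<in> carrier M"
  and "lin M N \<phi>" "\<And>m. m \<in> carrier M \<Longrightarrow> \<phi> (twist M m) = twist N (\<phi> m)"
    "\<And>a m. a \<in> carrier D.A \<Longrightarrow> m \<in> carrier M \<Longrightarrow> \<phi> (mod_act M a m) = mod_act N (\<beta> a) (\<phi> m)"
    "\<And>m. m \<in> carrier M \<Longrightarrow> mod_coact N (\<phi> m) =
      sw M D.C (N \<^bold>\<otimes> D'.C) (mod_coact M m) (\<lambda>x y. pt N D'.C (\<phi> x) (\<gamma> y))"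
  shows "restrict \<phi> (carrier M) \<in> semilinear M N"
  using assms lin_cong[of M "restrict \<phi> (carrier M)" \<phi> N] by (simp add: semilinear_def)

context
  fixes M N :: "('k, 'u) dh_module"
  assumes M: "doi_hopf_module K D M" and N: "doi_hopf_module K D' N"
begin

private lemmas M_dh = M[unfolded D.doi_hopf_module_iff]
private lemmas N_dh = N[unfolded D'.doi_hopf_module_iff]
private lemmas ind_dh = ind_dh_struct[OF M_dh]
private lemmas coind_dh = coind_dh_struct[OF N_dh]
private lemmas F_module = balanced_doi_hopf_module[OF M]
private lemmas G_module = cotensor_doi_hopf_module[OF N]
private lemmas F_dh = F_module[unfolded D'.doi_hopf_module_iff]
private lemmas G_dh = G_module[unfolded D.doi_hopf_module_iff]
private lemmas [simp] = D.dh_rules[OF M_dh] D'.dh_rules[OF N_dh] D'.dh_rules[OF ind_dh] D.dh_rules[OF coind_dh]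
  ind_act_pt[OF M_dh] ind_coact_pt[OF M_dh] coind_act_pt[OF N_dh] coind_coact_pt[OF N_dh]
  hs_balanced[OF M]
  lin_rules[OF lin_balanced[OF M] D'.dh_hs[OF ind_dh] hs_balanced[OF M]]
  lin_rules[OF cot_left_lin[OF N_dh]] lin_rules[OF cot_right_lin[OF N_dh]]
  cot_left_pt[OF N_dh] cot_right_pt[OF N_dh]

lemma semilinear_rules:
  assumes \<phi>: "\<phi> \<in> semilinear M N"
  shows "m \<in> carrier M \<Longrightarrow> twist N (\<phi> m) = \<phi> (twist M m)"
    "m \<in> carrier M \<Longrightarrow> untwist N (\<phi> m) = \<phi> (untwist M m)"
proof -
  note r = semilinearD(3)[OF \<phi>] lin_closed[OF semilinearD(2)[OF \<phi>]]
  show "m \<in> carrier M \<Longrightarrow> twist N (\<phi> m) = \<phi> (twist M m)" by (simp add: r)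
  show "m \<in> carrier M \<Longrightarrow> untwist N (\<phi> m) = \<phi> (untwist M m)"
    by (rule untwist_unique) (simp_all add: r flip: r(1))
qed

text \<open>The two mutually inverse maps \<open>h \<mapsto> h(1 \<otimes> \<alpha>(-))\<close> and \<open>\<phi> \<mapsto> (b \<otimes> m \<mapsto> \<alpha>\<^sup>-\<^sup>2(b \<cdot> \<phi>(m)))\<close>. The
  powers of \<open>\<alpha>\<close> arise from \<open>b \<cdot> (1 \<otimes> \<alpha>(m)) = \<alpha>\<^sup>2(b) \<otimes> \<alpha>\<^sup>2(m)\<close>.\<close>

definition restrict_unit :: "('u \<Rightarrow> 'u) \<Rightarrow> 'u \<Rightarrow> 'u"
  where "restrict_unit h = (\<lambda>m\<in>carrier M. h (pM M (pt D'.A M \<one>\<^bsub>D'.A\<^esub> (twist M m))))"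

definition extend_act :: "('u \<Rightarrow> 'u) \<Rightarrow> 'u \<Rightarrow> 'u"
  where "extend_act \<phi> = (\<lambda>q\<in>carrier (QM M).
    sw D'.A M N q (\<lambda>b m. untwist N (untwist N (mod_act N b (\<phi> m)))))"

text \<open>\<open>h(1 \<otimes> -)\<close> is semilinear because of the relation \<open>\<alpha>(\<beta>(a)) \<otimes> \<alpha>(m) = 1 \<otimes> a \<cdot> m\<close> in \<open>A' \<otimes>\<^sub>A M\<close>
  and because of \<open>\<rho>(1) = 1 \<otimes> 1\<close>. Conversely, semilinearity of \<open>\<phi>\<close> is what makes
  \<open>b \<otimes> m \<mapsto> \<alpha>\<^sup>-\<^sup>2(b \<cdot> \<phi>(m))\<close> balanced and colinear.\<close>

lemma bij_restrict_unit:
  "bij_betw restrict_unit (doi_hopf_hom K D' (FM M) N) (semilinear M N)"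
proof (rule bij_betw_byWitness[of _ extend_act])
  have into_target: "restrict_unit h \<in> semilinear M N" and left_inverse: "extend_act (restrict_unit h) = h"
    if h: "h \<in> doi_hopf_hom K D' (FM M) N" for h
  proof -
    note hD = D'.doi_hopf_homD[OF F_module N h]
    define k where "k v = h (pM M v)" for v
    have k: "D'.dh_map (VM M) (ind_act M) (ind_coact M (mod_coact M)) N (mod_act N) (mod_coact N) k"
      unfolding k_def by (rule D'.dh_map_comp[OF ind_dh F_dh N_dh balanced_projection[OF M] hD(2)])
    note [simp] = D'.dh_map_rules[OF ind_dh N_dh k]
    have bal: "k (pt D'.A M (b \<otimes>\<^bsub>D'.A\<^esub> \<beta> a) (twist M m)) = k (pt D'.A M (twist D'.A b) (mod_act M a m))"
      if "b \<in> carrier D'.A" "a \<in> carrier D.A" "m \<in> carrier M" for b a m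
      unfolding k_def using balanced_relation[OF M that] by simp
    have r: "restrict_unit h = (\<lambda>m\<in>carrier M. k (pt D'.A M \<one>\<^bsub>D'.A\<^esub> (twist M m)))"
      by (simp add: restrict_unit_def k_def)
    show "restrict_unit h \<in> semilinear M N"
      unfolding r
    proof (rule semilinearI)
      fix a m assume "a \<in> carrier D.A" "m \<in> carrier M"
      then show "k (pt D'.A M \<one>\<^bsub>D'.A\<^esub> (twist M (mod_act M a m))) =
          mod_act N (\<beta> a) (k (pt D'.A M \<one>\<^bsub>D'.A\<^esub> (twist M m)))"
        using bal[of "\<one>\<^bsub>D'.A\<^esub>" "twist D.A a" "twist M m"]
        by (simp flip: D'.dh_map_rules(3)[OF ind_dh N_dh k])
    qed simp_all
    show "extend_act (restrict_unit h) = h"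
    proof (rule ext)
      fix q
      show "extend_act (restrict_unit h) q = h q"
      proof (cases "q \<in> carrier (QM M)")
        case True
        then have q: "q \<in> carrier (VM M)" "pM M q = q" by (simp_all add: balanced_subset[OF M])
        have "sw D'.A M N q (\<lambda>b m. untwist N (untwist N (mod_act N b (k (pt D'.A M \<one>\<^bsub>D'.A\<^esub> (twist M
            m)))))) = k q"
          by (rule tensor_ext[OF _ _ _ _ _ _ q(1), where P = N])
             (simp_all flip: D'.dh_map_rules(3)[OF ind_dh N_dh k])
        then show ?thesis using True q(2) by (simp add: extend_act_def r k_def)
      next
        case False
        then show ?thesis using hD(1) by (simp add: extend_act_def extensional_def balanced_object[OF M])
      qed
    qed
  qed
  have into_source: "extend_act \<phi> \<in> doi_hopf_hom K D' (FM M) N" and right_inverse: "restrict_unit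
      (extend_act \<phi>) = \<phi>"
    if \<phi>: "\<phi> \<in> semilinear M N" for \<phi>
  proof -
    note [simp] = semilinear_rules[OF \<phi>] semilinearD(4,5)[OF \<phi>] lin_rules[OF semilinearD(2)[OF \<phi>]]
    define k where "k v = sw D'.A M N v (\<lambda>b m. untwist N (untwist N (mod_act N b (\<phi> m))))" for v
    have k_lin: "lin (VM M) N k" unfolding k_def by simp
    note [simp] = lin_rules[OF k_lin]
    have k_pt [simp]: "k (pt D'.A M b m) = untwist N (untwist N (mod_act N b (\<phi> m)))"
      if "b \<in> carrier D'.A" "m \<in> carrier M" for b m
      using that by (simp add: k_def)
    have k_eq: "extend_act \<phi> (pM M v) = k v" if v: "v \<in> carrier (VM M)" for v
    proof -
      have "extend_act \<phi> (pM M v) = k (pM M v)"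
        using v by (simp add: extend_act_def k_def balanced_carrier[OF M])
      also have "\<dots> = k v"
        by (rule balanced_respects[OF M, where X = N and f = k]) (use v k_lin in simp_all)
      finally show ?thesis .
    qed
    have k: "D'.dh_map (VM M) (ind_act M) (ind_coact M (mod_coact M)) N (mod_act N) (mod_coact N) k"
      unfolding D'.dh_map_def
    proof (intro conjI ballI)
      show "lin (VM M) N k" by (rule k_lin)
      fix m assume m: "m \<in> carrier (VM M)"
      show "k (twist (VM M) m) = twist N (k m)"
        by (rule tensor_ext[OF _ _ _ _ _ _ m, where P = N]) simp_all
      show "k (ind_act M a m) = mod_act N a (k m)" if "a \<in> carrier D'.A" for a
        by (rule tensor_ext[OF _ _ _ _ _ _ m, where P = N]) (use that in simp_all)
      show "mod_coact N (k m) = sw (VM M) D'.C (N \<^bold>\<otimes> D'.C) (ind_coact M (mod_coact M) m)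
          (\<lambda>x y. pt N D'.C (k x) y)"
        by (rule tensor_ext[OF _ _ _ _ _ _ m, where P = "N \<^bold>\<otimes> D'.C"]) simp_all
    qed
    have "D'.dh_map (FM M) (mod_act (FM M)) (mod_coact (FM M)) N (mod_act N) (mod_coact N) (extend_act \<phi>)"
    proof (rule D'.dh_map_from_quotient[OF ind_dh F_dh N_dh balanced_projection[OF M]])
      show "pM M ` carrier (VM M) = carrier (FM M)"
        by (simp add: balanced_object[OF M] balanced_carrier[OF M])
      show "D'.dh_map (VM M) (ind_act M) (ind_coact M (mod_coact M)) N (mod_act N) (mod_coact N)
          (\<lambda>x. extend_act \<phi> (pM M x))"
        by (rule D'.dh_map_cong[OF ind_dh _ k]) (simp add: k_eq)
    qed
    then show "extend_act \<phi> \<in> doi_hopf_hom K D' (FM M) N"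
      unfolding D'.doi_hopf_hom_iff[OF F_module N] by (simp add: balanced_object[OF M] extend_act_def)
    show "restrict_unit (extend_act \<phi>) = \<phi>"
      using semilinearD(1)[OF \<phi>]
      by (intro ext) (auto simp: restrict_unit_def k_eq extensional_def restrict_def)
  qed
  show "\<forall>h\<in>doi_hopf_hom K D' (FM M) N. extend_act (restrict_unit h) = h"
    "\<forall>\<phi>\<in>semilinear M N. restrict_unit (extend_act \<phi>) = \<phi>"
    "restrict_unit ` doi_hopf_hom K D' (FM M) N \<subseteq> semilinear M N"
    "extend_act ` semilinear M N \<subseteq> doi_hopf_hom K D' (FM M) N"
    using into_target left_inverse into_source right_inverse by auto
qed

text \<open>The two mutually inverse maps \<open>\<phi> \<mapsto> (m \<mapsto> \<phi>(m\<^sub>0) \<otimes> m\<^sub>1)\<close> and \<open>g \<mapsto> \<alpha>\<^sup>-\<^sup>1 \<circ> (id \<otimes> \<epsilon>) \<circ> g\<close>.\<close>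

definition extend_coact :: "('u \<Rightarrow> 'u) \<Rightarrow> 'u \<Rightarrow> 'u"
  where "extend_coact \<phi> = (\<lambda>m\<in>carrier M. sw M D.C (VN N) (mod_coact M m) (\<lambda>x y. pt N D.C (\<phi> x) y))"

definition restrict_counit :: "('u \<Rightarrow> 'u) \<Rightarrow> 'u \<Rightarrow> 'u"
  where "restrict_counit g = (\<lambda>m\<in>carrier M.
    untwist N (sw N D.C N (g m) (\<lambda>n c. counit D.C c \<odot>\<^bsub>N\<^esub> n)))"

text \<open>By coassociativity of \<open>M\<close> and colinearity of \<open>\<phi>\<close>, the tensor \<open>\<phi>(m\<^sub>0) \<otimes> m\<^sub>1\<close> lies in \<open>N \<box> C\<close>
  and depends colinearly on \<open>m\<close>. Conversely, the counit recovers a map from its composite with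
  \<open>id \<otimes> \<epsilon>\<close>, and the condition that defines \<open>N \<box> C\<close>, evaluated with the counit of \<open>C\<close> on the last
  leg, says that \<open>\<phi>\<close> is colinear along \<open>\<gamma>\<close>.\<close>

lemma bij_extend_coact:
  "bij_betw extend_coact (semilinear M N) (doi_hopf_hom K D M (GN N))"
proof (rule bij_betw_byWitness[of _ restrict_counit])
  have into_target: "extend_coact \<phi> \<in> doi_hopf_hom K D M (GN N)"
    and left_inverse: "restrict_counit (extend_coact \<phi>) = \<phi>" if \<phi>: "\<phi> \<in> semilinear M N" for \<phi>
  proof -
    note [simp] = semilinear_rules[OF \<phi>] semilinearD(4,5)[OF \<phi>] lin_rules[OF semilinearD(2)[OF \<phi>]]
    define k where "k m = sw M D.C (VN N) (mod_coact M m) (\<lambda>x y. pt N D.C (\<phi> x) y)" for m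
    have k: "D.dh_map M (mod_act M) (mod_coact M) (VN N) (coind_act N (mod_act N)) (coind_coact N) k"
      unfolding D.dh_map_def k_def
      by (simp add: D.dh_coassoc[OF M_dh] sw_swap[where U = M and V = D.C and U' = D.A and V' = D.H])
    have "k m \<in> carrier (QN N)" if "m \<in> carrier M" for m
      unfolding cotensor_carrier[OF N] k_def using that by (simp add: D.dh_coassoc[OF M_dh])
    then have "D.dh_map M (mod_act M) (mod_coact M) (GN N) (mod_act (GN N)) (mod_coact (GN N)) k"
      by (intro D.dh_map_into_sub[OF M_dh G_dh coind_dh cotensor_inclusion[OF N] _ _ k])
          (simp_all add: cotensor_object[OF N])
    from D.restrict_hom[OF M G_module this] show "extend_coact \<phi> \<in> doi_hopf_hom K D M (GN N)"
      by (simp add: extend_coact_def k_def[abs_def])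
    show "restrict_counit (extend_coact \<phi>) = \<phi>"
      using semilinearD(1)[OF \<phi>]
      by (intro ext) (auto simp: restrict_counit_def extend_coact_def extensional_def restrict_def)
  qed
  have into_source: "restrict_counit g \<in> semilinear M N" and right_inverse: "extend_coact
      (restrict_counit g) = g"
    if g: "g \<in> doi_hopf_hom K D M (GN N)" for g
  proof -
    note gD = D.doi_hopf_homD[OF M G_module g]
    have k: "D.dh_map M (mod_act M) (mod_coact M) (VN N) (coind_act N (mod_act N)) (coind_coact N) g"
      using D.dh_map_comp[OF M_dh G_dh coind_dh gD(2) cotensor_inclusion[OF N]] .
    note [simp] = D.dh_map_rules[OF M_dh coind_dh k]
    have gQ: "g m \<in> carrier (QN N)" if "m \<in> carrier M" for m
      using lin_closed[OF D.dh_mapD(1)[OF gD(2)] that] by (simp add: cotensor_object[OF N])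
    define E where "E x = sw N D.C N x (\<lambda>n c. counit D.C c \<odot>\<^bsub>N\<^esub> n)" for x
    have E_lin: "lin (VN N) N E" unfolding E_def by simp
    note [simp] = lin_rules[OF E_lin]
    have E_pt [simp]: "E (pt N D.C n c) = counit D.C c \<odot>\<^bsub>N\<^esub> n" if "n \<in> carrier N" "c \<in> carrier D.C" for n c
      using that by (simp add: E_def)
    have E_twist: "E (twist (VN N) x) = twist N (E x)" if x: "x \<in> carrier (VN N)" for x
      by (rule tensor_ext[OF _ _ _ _ _ _ x, where P = N]) simp_all
    have E_act: "E (coind_act N (mod_act N) a x) = mod_act N (\<beta> (twist D.A a)) (E x)"
      if x: "x \<in> carrier (VN N)" and a: "a \<in> carrier D.A" for a x
      by (rule tensor_ext[OF _ _ _ _ _ _ x, where P = N]) (use a in simp_all)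
    \<comment> \<open>Counitality of the coaction of \<open>N \<otimes> C\<close>, with the roles of the legs interchanged: applying
      \<open>\<alpha>\<^sup>-\<^sup>1 \<circ> (id \<otimes> \<epsilon>)\<close> to the first leg \<open>N \<otimes> C\<close> gives back the tensor.\<close>
    have collapse: "sw (VN N) D.C P (coind_coact N x) (\<lambda>v c. B (untwist N (E v)) c) = sw N D.C P x B"
      if x: "x \<in> carrier (VN N)" and P: "hs P"
        and B: "\<And>x. x \<in> carrier N \<Longrightarrow> lin D.C P (B x)" "\<And>y. y \<in> carrier D.C \<Longrightarrow> lin N P (\<lambda>x. B x y)"
      for x P and B :: "'u \<Rightarrow> 'u \<Rightarrow> 'u"
    proof -
      have B': "lin X P (\<lambda>x. B (f x) y)" if "lin X N f" "y \<in> carrier D.C" for X :: "('k, 'u) hom_space" and f y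
        using lin_comp[OF B(2) that(1)] that(2) .
      have B'': "lin X P (\<lambda>x. B y (f x))" if "lin X D.C f" "y \<in> carrier N" for X :: "('k, 'u) mod_coalg" and f y
        using lin_comp[OF B(1) that(1)] that(2) .
      have Bs: "B (a \<odot>\<^bsub>N\<^esub> x) y = a \<odot>\<^bsub>P\<^esub> B x y" if "a \<in> carrier K" "x \<in> carrier N" "y \<in> carrier D.C" for a x y
        using lin_smult[OF B(2)] that by simp
      show ?thesis
        by (rule tensor_ext[OF _ _ _ _ _ _ x, where P = P]) (use P in \<open>simp_all add: B B' B'' Bs\<close>)
    qed
    have \<rho>E: "mod_coact N (E x) = sw N D.C (N \<^bold>\<otimes> D'.C) x (\<lambda>n c. pt N D'.C (twist N n) (\<gamma> (twist D.C c)))"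
      if x: "x \<in> carrier (QN N)" for x
    proof -
      have xV: "x \<in> carrier (VN N)" and eq: "cot_left N x = cot_right N (mod_coact N) x"
        using x by (auto simp: cotensor_carrier[OF N])
      \<comment> \<open>The map \<open>id \<otimes> id \<otimes> \<epsilon>\<close>; it turns the two sides of the cotensor condition into the two
        sides of the claim.\<close>
      define T where "T t = sw N (D'.C \<^bold>\<otimes> D.C) (N \<^bold>\<otimes> D'.C) t (\<lambda>n u.
        sw D'.C D.C (N \<^bold>\<otimes> D'.C) u (\<lambda>y c. counit D.C c \<odot>\<^bsub>N \<^bold>\<otimes> D'.C\<^esub> pt N D'.C n y))" for t
      have T_lin: "lin (N \<^bold>\<otimes> D'.C \<^bold>\<otimes> D.C) (N \<^bold>\<otimes> D'.C) T" unfolding T_def by simp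
      note [simp] = lin_rules[OF T_lin]
      have T_pt [simp]: "T (pt N (D'.C \<^bold>\<otimes> D.C) n (pt D'.C D.C y c)) = counit D.C c \<odot>\<^bsub>N \<^bold>\<otimes> D'.C\<^esub> pt N D'.C n y"
        if "n \<in> carrier N" "y \<in> carrier D'.C" "c \<in> carrier D.C" for n y c
        using that by (simp add: T_def)
      have "sw N D.C (N \<^bold>\<otimes> D'.C) x (\<lambda>n c. pt N D'.C (twist N n) (\<gamma> (twist D.C c))) = T (cot_left N x)"
        by (rule tensor_ext[OF _ _ _ _ _ _ xV, where P = "N \<^bold>\<otimes> D'.C"]) simp_all
      moreover have "mod_coact N (E x) = T (cot_right N (mod_coact N) x)"
        by (rule tensor_ext[OF _ _ _ _ _ _ xV, where P = "N \<^bold>\<otimes> D'.C"]) simp_all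
      ultimately show ?thesis by (simp add: eq)
    qed
    have r: "restrict_counit g = (\<lambda>m\<in>carrier M. untwist N (E (g m)))"
      by (simp add: restrict_counit_def E_def)
    show "restrict_counit g \<in> semilinear M N"
      unfolding r
    proof (rule semilinearI)
      fix m assume m: "m \<in> carrier M"
      show "untwist N (E (g (twist M m))) = twist N (untwist N (E (g m)))"
        using m E_twist[of "g m"] by simp
      show "untwist N (E (g (mod_act M a m))) = mod_act N (\<beta> a) (untwist N (E (g m)))" if "a \<in>
          carrier D.A" for a
        using m that E_act[of "g m" a] by simp
      have "sw M D.C (N \<^bold>\<otimes> D'.C) (mod_coact M m) (\<lambda>x y. pt N D'.C (untwist N (E (g x))) (\<gamma> y)) =
          sw (VN N) D.C (N \<^bold>\<otimes> D'.C) (coind_coact N (g m)) (\<lambda>v c. pt N D'.C (untwist N (E v)) (\<gamma> c))"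
        using m by simp
      also have "\<dots> = sw N D.C (N \<^bold>\<otimes> D'.C) (g m) (\<lambda>n c. pt N D'.C n (\<gamma> c))"
        using m by (intro collapse) simp_all
      also have "\<dots> = mod_coact N (untwist N (E (g m)))"
        using m by (simp add: \<rho>E[OF gQ])
      finally show "mod_coact N (untwist N (E (g m))) =
        sw M D.C (N \<^bold>\<otimes> D'.C) (mod_coact M m) (\<lambda>x y. pt N D'.C (untwist N (E (g x))) (\<gamma> y))" by simp
    qed simp_all
    show "extend_coact (restrict_counit g) = g"
    proof (rule ext)
      fix m
      show "extend_coact (restrict_counit g) m = g m"
      proof (cases "m \<in> carrier M")
        case True
        have "extend_coact (restrict_counit g) m =
            sw (VN N) D.C (VN N) (coind_coact N (g m)) (\<lambda>v c. pt N D.C (untwist N (E v)) c)"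
          using True by (simp add: extend_coact_def r)
        also have "\<dots> = sw N D.C (VN N) (g m) (\<lambda>n c. pt N D.C n c)"
          using True by (intro collapse) simp_all
        also have "\<dots> = g m" using True by simp
        finally show ?thesis .
      next
        case False
        then show ?thesis using gD(1) by (simp add: extend_coact_def extensional_def)
      qed
    qed
  qed
  show "\<forall>\<phi>\<in>semilinear M N. restrict_counit (extend_coact \<phi>) = \<phi>"
    "\<forall>g\<in>doi_hopf_hom K D M (GN N). extend_coact (restrict_counit g) = g"
    "extend_coact ` semilinear M N \<subseteq> doi_hopf_hom K D M (GN N)"
    "restrict_counit ` doi_hopf_hom K D M (GN N) \<subseteq> semilinear M N"
    using into_target left_inverse into_source right_inverse by auto
qed

end

lemma adjoint_induction_cotensor:
  "adjoint_functors (doi_hopf_category K D) (doi_hopf_category K D')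
    (induction_functor K D D' \<beta> \<gamma>) (cotensor_functor K D D' \<beta> \<gamma>)"
  (is "adjoint_functors _ _ ?F ?G")
  unfolding adjoint_functors_def doi_hopf_category_simps
proof (intro conjI is_functor_induction is_functor_cotensor exI ballI)
  define \<Phi> where "\<Phi> X Y h = extend_coact X Y (restrict_unit X h)" for X Y :: "('k, 'u) dh_module" and h
  have bij: "bij_betw (\<Phi> X Y) (doi_hopf_hom K D' (FM X) Y) (doi_hopf_hom K D X (GN Y))"
    if "doi_hopf_module K D X" "doi_hopf_module K D' Y" for X Y
    using bij_betw_trans[OF bij_restrict_unit[OF that] bij_extend_coact[OF that]]
    by (simp add: \<Phi>_def[abs_def] comp_def)
  then show "bij_betw (\<Phi> X Y) (doi_hopf_hom K D' (FM X) Y) (doi_hopf_hom K D X (GN Y))"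
    if "X \<in> {M. doi_hopf_module K D M}" "Y \<in> {M. doi_hopf_module K D' M}" for X Y
    using that by blast
  fix X X' Y Y' f h g
  assume "X \<in> {M. doi_hopf_module K D M}" "X' \<in> {M. doi_hopf_module K D M}"
    "Y \<in> {M. doi_hopf_module K D' M}" "Y' \<in> {M. doi_hopf_module K D' M}"
    and f: "f \<in> doi_hopf_hom K D X' X" and h: "h \<in> doi_hopf_hom K D' (FM X) Y"
    and g: "g \<in> doi_hopf_hom K D' Y Y'"
  then have o: "doi_hopf_module K D X" "doi_hopf_module K D X'" "doi_hopf_module K D' Y"
      "doi_hopf_module K D' Y'"
    by auto
  note d = o(1,2)[unfolded D.doi_hopf_module_iff] o(3,4)[unfolded D'.doi_hopf_module_iff]
  note f' = D.doi_hopf_homD(2)[OF o(2,1) f] and g' = D'.doi_hopf_homD(2)[OF o(3,4) g]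
  define \<phi> where "\<phi> = restrict_unit X h"
  have \<phi>: "\<phi> \<in> semilinear X Y"
    using bij_restrict_unit[OF o(1,3)] h by (auto simp: \<phi>_def bij_betw_def)
  note [simp] = D.dh_rules[OF d(1)] D.dh_rules[OF d(2)] D'.dh_rules[OF d(3)] D'.dh_rules[OF d(4)]
    D.dh_map_rules[OF d(2,1) f'] D'.dh_map_rules[OF d(3,4) g'] lin_rules[OF semilinearD(2)[OF \<phi>]]
  let ?h = "compose (carrier (FM X')) g (compose (carrier (FM X')) h (on_hom ?F X' X f))"
  show "\<Phi> X' Y' ?h = compose (carrier X') (on_hom ?G Y Y' g) (compose (carrier X') (\<Phi> X Y h) f)"
  proof (rule ext)
    fix m
    show "\<Phi> X' Y' ?h m = compose (carrier X') (on_hom ?G Y Y' g) (compose (carrier X') (\<Phi> X Y h) f) m"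
    proof (cases "m \<in> carrier X'")
      case True
      \<comment> \<open>Naturality holds already for the semilinear maps: the composite \<open>g \<circ> h \<circ> F(f)\<close>
        corresponds to \<open>g \<circ> \<phi> \<circ> f\<close>.\<close>
      have unit: "restrict_unit X' ?h x = g (\<phi> (f x))" if x: "x \<in> carrier X'" for x
      proof -
        let ?v = "pt D'.A X' \<one>\<^bsub>D'.A\<^esub> (twist X' x)"
        have v: "?v \<in> carrier (VM X')" using x by simp
        have "on_hom ?F X' X f (pM X' ?v) = pM X (pt D'.A X \<one>\<^bsub>D'.A\<^esub> (twist X (f x)))"
          using x by (simp add: induction_functor_hom[OF o(2,1) f' v] ind_map_pt[OF o(2,1) f'])
        moreover have "pM X' ?v \<in> carrier (QM X')"
          unfolding balanced_carrier[OF o(2)] using v by (rule imageI)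
        ultimately show ?thesis
          using x by (simp add: restrict_unit_def[OF o(2,4)] \<phi>_def restrict_unit_def[OF o(1,3)]
              compose_def balanced_object[OF o(2)])
      qed
      have \<Phi>h: "\<Phi> X Y h \<in> doi_hopf_hom K D X (GN Y)"
        using bij[OF o(1,3)] h by (auto simp: bij_betw_def)
      have "\<Phi> X Y h (f m) \<in> carrier (QN Y)"
        using lin_closed[OF D.dh_mapD(1)[OF D.doi_hopf_homD(2)[OF o(1) cotensor_doi_hopf_module[OF o(3)] \<Phi>h]], of "f m"] True
        by (simp add: cotensor_object[OF o(3)])
      then have "on_hom ?G Y Y' g (\<Phi> X Y h (f m)) = coind_map Y Y' g (\<Phi> X Y h (f m))"
        by (rule cotensor_functor_hom[OF o(3,4) g'])
      also have "\<dots> = sw X' D.C (VN Y') (mod_coact X' m) (\<lambda>x y. pt Y' D.C (g (\<phi> (f x))) y)"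
        using True by (simp add: \<Phi>_def extend_coact_def[OF o(1,3)] \<phi>_def[symmetric] coind_map_def[OF o(3,4) g'])
      also have "\<dots> = \<Phi> X' Y' ?h m"
        using True by (simp add: \<Phi>_def extend_coact_def[OF o(2,4)] unit cong: sw_cong)
      finally show ?thesis using True by (simp add: compose_def)
    qed (simp add: \<Phi>_def extend_coact_def[OF o(2,4)] compose_def)
  qed
qed

end

theorem proposition2p7:
  fixes K :: "'k ring"
    and D D' :: "('k, 'u::infinite) doi_hopf"
    and \<theta> \<beta> \<gamma> :: "'u \<Rightarrow> 'u"
  assumes "field K"
    and "doi_hopf_datum K D"
    and "doi_hopf_datum K D'"
    and "doi_hopf_map K D D' \<theta> \<beta> \<gamma>"
  shows "let F = induction_functor K D D' \<beta> \<gamma>; G = cotensor_functor K D D' \<beta> \<gamma>;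
      C = coalg D; \<M> = doi_hopf_category K D; \<M>' = doi_hopf_category K D'
    in is_functor \<M>' \<M> G \<and>
      (\<forall>N\<in>Obj \<M>'. \<forall>xs.
        set xs \<subseteq> carrier N \<times> carrier C \<and>
        tensor_class K N C xs \<in> carrier (cotensor K D D' \<gamma> N) \<longrightarrow>
        (\<forall>a\<in>carrier (alg D).
          mod_act (on_obj G N) a (tensor_class K N C xs) = cotensor_act_formula K D \<beta> N a xs) \<and>
        mod_coact (on_obj G N) (tensor_class K N C xs) \<in> carrier (tensor K (on_obj G N) C) \<and>
        cotensor_incl K D N (mod_coact (on_obj G N) (tensor_class K N C xs)) =
          cotensor_coact_formula K D N xs) \<and>
      adjoint_functors \<M> \<M>' F G"
proof -
  interpret dh_morphism K D D' \<theta> \<beta> \<gamma>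
    by (intro dh_morphism.intro dh_datum.intro ground_field.intro dh_datum_axioms.intro
        dh_morphism_axioms.intro assms)
  show ?thesis
    unfolding Let_def doi_hopf_category_simps
    using is_functor_cotensor adjoint_induction_cotensor
    by (auto simp: cotensor_object cotensor_object_act cotensor_object_coact
        cotensor_act_formula_eq cotensor_coact_formula_eq)
qed

end
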